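(* Consider the free-time sweeping optimal control problem $(P)$ described in the context. Fix $\varepsilon>0$ and suppose that along some minimizing sequence $\{(\bar x^k(\cdot),\bar u^k(\cdot),\bar a^k(\cdot),\bar T^k)\}$ of $(P)$ the standing assumptions (f), (g), ($\nu$), (A), (cost) of the context are satisfied with $T=\bar T^k+\varepsilon$ for all $k\in\mathbb N$. Suppose in addition that $\{\bar u^k(\cdot)\}$ is bounded in $W^{1,2}([0,\bar T^k+\varepsilon];\mathbb R^n)$, that $\{(\bar a^k(0),\bar T^k)\}$ is bounded, that $\mathrm{var}(\bar a^k(\cdot);[0,\bar T^k+\varepsilon])\le\mu$ for some constant $\mu$ and all $k$, and that the running cost $\ell$ is convex with respect to the velocity variables $(\dot x,\dot u)$ while $\ell(t,\cdot)$ is majorized by a summable function. Then problem $(P)$ admits an optimal solution $(\bar x(\cdot),\bar u(\cdot),\bar a(\cdot),\bar T)$ in $W^{1,2}([0,\bar T];\mathbb R^n)\times W^{1,2}([0,\bar T];\mathbb R^n)\times L^2([0,\bar T];\mathbb R^d)\times[0,\infty)$.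
   Context: Data. $f:\mathbb R^n\times\mathbb R^d\to\mathbb R^n$; $g_i:\mathbb R^n\to\mathbb R$ ($i=1,\dots,m$) convex and $C^2$; $\nu_i:\mathbb R^n\to\mathbb R$ ($i=1,\dots,s$) $C^1$ with Jacobian of full rank; $A\subset\mathbb R^d$ nonempty; $\Xi_x\subset\mathbb R^n$, $\Xi_T\subset[0,\infty)$; $x_0\in\mathbb R^n$; $\varphi:\mathbb R^n\times[0,\infty]\to(-\infty,\infty]$ and $\ell:[0,T]\times\mathbb R^{4n+d}\to(-\infty,\infty]$ l.s.c. on their domains. $C_i:=\{x: g_i(x)\ge0\}$, $C:=\bigcap_{i=1}^mC_i$, $C_u:=C+u$, $U_i:=\nu_i^{-1}((-\infty,0])$, $U:=\bigcap_{i=1}^sU_i$. Normal cone. $N_\Omega(\bar x)$ is the limiting (Mordukhovich) normal cone: for $\bar x\in\Omega$, $N_\Omega(\bar x)=\{v:\exists x_k\to\bar x,\ w_k\in\Pi(x_k;\Omega),\ \alpha_k\ge0,\ \alpha_k(x_k-w_k)\to v\}$ with $\Pi(x;\Omega)$ the Euclidean projection set, and $N_\Omega(\bar x)=\emptyset$ if $\bar x\notin\Omega$. $F(x,u,a):=N_C(x-u)-f(x,a)$. Problem $(P)$: minimize $$J[x,u,a,T]:=\varphi(x(T),T)+\int_0^T\ell(t,x(t),u(t),a(t),\dot x(t),\dot u(t))\,dt$$ over feasible quadruples $(x,u,a,T)$, i.e. $T\ge0$, $x,u\in W^{1,2}([0,T];\mathbb R^n)$, $a\in L^2([0,T];\mathbb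 R^d)$ with $-\dot x(t)\in F(x(t),u(t),a(t))$, $u(t)\in U$, $a(t)\in A$ for a.e. $t\in[0,T]$, $x(0)=x_0\in C_{u(0)}$, $(x(T),T)\in\Xi_x\times\Xi_T$. Functions defined on $[0,T]$ are identified with their extensions by the constant value at $T$ for $t>T$. Standing assumptions. (f) There is $L_f>0$ with $\|f(x_1,a_1)-f(x_2,a_2)\|\le L_f(\|x_1-x_2\|+\|a_1-a_2\|)$ for all arguments; and there is $M>0$ with $\|f(x,a)\|\le M(1+\|x\|)$ for all $x\in\bigcup_{t\in[0,T],T\ge0}C_{u(t)}$, $a\in\mathbb R^d$. (g) There are constants $c,M_1,M_2,M_3>0$ and open sets $V_i\supset C_i$ with $d_H(C_i,\mathbb R^n\setminus V_i)>c$ ($d_H$ the Hausdorff distance) and $M_1\le\|\nabla g_i(x)\|\le M_2$, $\|\nabla^2g_i(x)\|\le M_3$ for all $x\in V_i$, $i=1,\dots,m$; there are $\beta,\rho>0$ with $\sum_{i\in I_\rho(x)}\lambda_i\|\nabla g_i(x)\|\le\beta\|\sum_{i\in I_\rho(x)}\lambda_i\nabla g_i(x)\|$ for all $x\in C$, $\lambda_i\ge0$, where $I_\rho(x):=\{i: g_i(x)\le\rho\}$. ($\nu$) There is $L_\nu>0$ with $|\nu_i(u_2)-\nu_i(u_1)|\le L_\nu\|u_2-u_1\|$ and $\max_i\|\nabla\nu_i(u)\|\le L_\nu$ for all $u,u_1,u_2\in\mathbb R^n$; and if $u\in U$, $v_i\in N_{U_i}(u)$, $\sum_iv_i=0$,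 then all $v_i=0$. (A) $A$ is compact and $f(x,A):=\{f(x,a):a\in A\}$ is convex for each $x$. (cost) $\varphi$ is l.s.c.; $\ell(t,\cdot)$ is l.s.c. for a.e. $t\in[0,T]$ and bounded from below on bounded sets; and $t\mapsto\ell(t,x(t),u(t),a(t),\dot x(t),\dot u(t))$ is summable on $[0,T]$ for each feasible triple $(x(t),u(t),a(t))$.
   Formalization: The endpoint constraint sets Ξ_x and Ξ_T are additionally assumed closed; without this the claim fails, e.g. φ(x,T)=T, ℓ=0, f=0, Ξ_T=(0,∞), where the infimum 0 is not attained. *)

theory Defs
  imports "HOL-Analysis.Analysis"
begin

section \<open>Analytic notions\<close>

definition lsc_on :: "'a::topological_space set \<Rightarrow> ('a \<Rightarrow> ereal) \<Rightarrow> bool" where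
  "lsc_on S f \<longleftrightarrow> (\<forall>x\<in>S. f x \<le> Liminf (at x within S) f)"

definition C1_fun :: "('a::real_normed_vector \<Rightarrow> 'b::real_normed_vector) \<Rightarrow> bool" where
  "C1_fun f \<longleftrightarrow> (\<forall>x. f differentiable (at x)) \<and>
     (\<forall>h. continuous_on UNIV (\<lambda>x. frechet_derivative f (at x) h))"

definition gradient :: "('a::real_inner \<Rightarrow> real) \<Rightarrow> 'a \<Rightarrow> 'a" where
  "gradient g x = (THE D. GDERIV g x :> D)"

text \<open>The Hessian as a linear map; its norm below is the operator norm.\<close>

definition hessian :: "('a::real_inner \<Rightarrow> real) \<Rightarrow> 'a \<Rightarrow> 'a \<Rightarrow> 'a" where
  "hessian g x = frechet_derivative (gradient g) (at x)"

definition C2_fun :: "('a::real_inner \<Rightarrow> real) \<Rightarrow> bool" where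
  "C2_fun g \<longleftrightarrow> C1_fun g \<and> C1_fun (gradient g)"

text \<open>
  Hausdorff distance with values in \<open>[0, \<infinity>]\<close>, so that it is meaningful for unbounded sets;
  the distance to the empty set is \<open>\<infinity>\<close> (unlike for \<open>infdist\<close>).
\<close>

definition hausdorff_distance :: "'a::metric_space set \<Rightarrow> 'a set \<Rightarrow> ennreal" where
  "hausdorff_distance X Y =
     max (SUP x\<in>X. INF y\<in>Y. ennreal (dist x y)) (SUP y\<in>Y. INF x\<in>X. ennreal (dist x y))"

definition projection_set :: "'a::metric_space \<Rightarrow> 'a set \<Rightarrow> 'a set" where
  "projection_set x \<Omega> = {w \<in> \<Omega>. \<forall>y\<in>\<Omega>. dist x w \<le> dist x y}"

definition limiting_normal_cone :: "'a::real_normed_vector set \<Rightarrow> 'a \<Rightarrow> 'a set" where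
  "limiting_normal_cone \<Omega> xbar =
     (if xbar \<in> \<Omega> then
        {v. \<exists>(x :: nat \<Rightarrow> 'a) w \<alpha>. x \<longlonglongrightarrow> xbar \<and>
              (\<forall>k. w k \<in> projection_set (x k) \<Omega>) \<and> (\<forall>k. (0::real) \<le> \<alpha> k) \<and>
              (\<lambda>k. \<alpha> k *\<^sub>R (x k - w k)) \<longlonglongrightarrow> v}
      else {})"

section \<open>Functions on \<open>[0, T]\<close>\<close>

text \<open>
  Functions on \<open>[0, T]\<close> are total functions of which only the values on \<open>[0, T]\<close> matter;
  \<open>const_ext T f\<close> is the extension by the constant value at \<open>T\<close>.
\<close>

definition const_ext :: "real \<Rightarrow> (real \<Rightarrow> 'a) \<Rightarrow> real \<Rightarrow> 'a" where
  "const_ext T f t = (if t \<le> T then f t else f T)"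

definition L2_on :: "real \<Rightarrow> (real \<Rightarrow> 'a::euclidean_space) \<Rightarrow> bool" where
  "L2_on T f \<longleftrightarrow> f \<in> borel_measurable (lebesgue_on {0..T}) \<and>
     integrable (lebesgue_on {0..T}) (\<lambda>t. (norm (f t))\<^sup>2)"

text \<open>
  \<open>W\<^sup>1\<^sup>,\<^sup>2([0, T])\<close>: the indefinite integrals of square integrable functions.  By the Lebesgue
  differentiation theorem the density is a.e. the pointwise derivative, which is what
  \<open>velocity\<close> denotes.
\<close>

definition W12_on :: "real \<Rightarrow> (real \<Rightarrow> 'a::euclidean_space) \<Rightarrow> bool" where
  "W12_on T x \<longleftrightarrow> (\<exists>v. L2_on T v \<and> (\<forall>t\<in>{0..T}. x t = x 0 + integral {0..t} v))"

definition velocity :: "(real \<Rightarrow> 'a::euclidean_space) \<Rightarrow> real \<Rightarrow> 'a" where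
  "velocity x t = vector_derivative x (at t)"

definition W12_norm :: "real \<Rightarrow> (real \<Rightarrow> 'a::euclidean_space) \<Rightarrow> real" where
  "W12_norm T x = sqrt ((\<integral>t. (norm (x t))\<^sup>2 \<partial>lebesgue_on {0..T})
                      + (\<integral>t. (norm (velocity x t))\<^sup>2 \<partial>lebesgue_on {0..T}))"

definition total_variation :: "real \<Rightarrow> (real \<Rightarrow> 'a::real_normed_vector) \<Rightarrow> ereal" where
  "total_variation T a =
     (SUP (N, s) \<in> {(N :: nat, s :: nat \<Rightarrow> real). mono_on {..N} s \<and> s ` {..N} \<subseteq> {0..T}}.
        ereal (\<Sum>i<N. norm (a (s (Suc i)) - a (s i))))"

text \<open>
  Integral of an extended-real function: integral of the positive part minus integral of the
  negative part, with \<open>\<infinity> - \<infinity> = \<infinity>\<close>; \<open>e2ennreal\<close> maps negative arguments to \<open>0\<close>.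
\<close>

definition ereal_integral :: "real \<Rightarrow> (real \<Rightarrow> ereal) \<Rightarrow> ereal" where
  "ereal_integral T h =
     enn2ereal (\<integral>\<^sup>+t. e2ennreal (h t) \<partial>lebesgue_on {0..T})
     - enn2ereal (\<integral>\<^sup>+t. e2ennreal (- h t) \<partial>lebesgue_on {0..T})"

definition summable_fun :: "real \<Rightarrow> (real \<Rightarrow> ereal) \<Rightarrow> bool" where
  "summable_fun T h \<longleftrightarrow> (AE t in lebesgue_on {0..T}. \<bar>h t\<bar> \<noteq> \<infinity>) \<and>
     integrable (lebesgue_on {0..T}) (\<lambda>t. real_of_ereal (h t))"

section \<open>The free-time sweeping control problem\<close>

text \<open>
  The index ranges \<open>i = 1, \<dots>, m\<close> and \<open>i = 1, \<dots>, s\<close> are the finite types \<open>'m\<close> and \<open>'s\<close>.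
  The arguments of the running cost \<open>ell t\<close> are, in order, \<open>x\<close>, \<open>u\<close>, \<open>a\<close>, \<open>dx/dt\<close>, \<open>du/dt\<close>; the
  second argument of the terminal cost \<open>phi\<close> ranges over \<open>[0, \<infinity>]\<close>.  As the final time is free,
  \<open>ell t\<close> is relevant for all \<open>t \<ge> 0\<close>.
\<close>

record ('n, 'd, 'm, 's) sweeping_problem =
  f :: "real ^ 'n::finite \<Rightarrow> real ^ 'd::finite \<Rightarrow> real ^ 'n"
  g :: "'m::finite \<Rightarrow> real ^ 'n \<Rightarrow> real"
  nu :: "real ^ 'n \<Rightarrow> real ^ 's::finite"
  A :: "(real ^ 'd) set"
  Xi_x :: "(real ^ 'n) set"
  Xi_T :: "real set"
  x0 :: "real ^ 'n"
  phi :: "(real ^ 'n) \<times> ennreal \<Rightarrow> ereal"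
  ell :: "real \<Rightarrow> (real ^ 'n) \<times> (real ^ 'n) \<times> (real ^ 'd) \<times> (real ^ 'n) \<times> (real ^ 'n) \<Rightarrow> ereal"

hide_const (open) f g nu A Xi_x Xi_T x0 phi ell

definition problem_data :: "('n::finite, 'd::finite, 'm::finite, 's::finite) sweeping_problem \<Rightarrow> bool"
where
  "problem_data P \<longleftrightarrow>
     (\<forall>i. convex_on UNIV (sweeping_problem.g P i) \<and> C2_fun (sweeping_problem.g P i)) \<and>
     C1_fun (sweeping_problem.nu P) \<and>
     (\<forall>u. rank (jacobian (sweeping_problem.nu P) (at u)) = min CARD('n) CARD('s)) \<and>
     sweeping_problem.A P \<noteq> {} \<and>
     sweeping_problem.Xi_T P \<subseteq> {0..} \<and>
     (\<forall>y. sweeping_problem.phi P y \<noteq> - \<infinity>) \<and>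
     lsc_on UNIV (sweeping_problem.phi P) \<and>
     (\<forall>t\<ge>0. \<forall>z. sweeping_problem.ell P t z \<noteq> - \<infinity>) \<and>
     lsc_on ({0..} \<times> UNIV) (\<lambda>(t, z). sweeping_problem.ell P t z)"

definition Cset_i ::
  "('n::finite, 'd::finite, 'm::finite, 's::finite) sweeping_problem \<Rightarrow> 'm \<Rightarrow> (real ^ 'n) set" where
  "Cset_i P i = {x. 0 \<le> sweeping_problem.g P i x}"

definition Cset ::
  "('n::finite, 'd::finite, 'm::finite, 's::finite) sweeping_problem \<Rightarrow> (real ^ 'n) set" where
  "Cset P = (\<Inter>i. Cset_i P i)"

definition moving_set ::
  "('n::finite, 'd::finite, 'm::finite, 's::finite) sweeping_problem \<Rightarrow> real ^ 'n \<Rightarrow> (real ^ 'n) set"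
where
  "moving_set P u = (\<lambda>y. y + u) ` Cset P"

definition Uset_i ::
  "('n::finite, 'd::finite, 'm::finite, 's::finite) sweeping_problem \<Rightarrow> 's \<Rightarrow> (real ^ 'n) set" where
  "Uset_i P i = {u. sweeping_problem.nu P u $ i \<le> 0}"

definition Uset ::
  "('n::finite, 'd::finite, 'm::finite, 's::finite) sweeping_problem \<Rightarrow> (real ^ 'n) set" where
  "Uset P = (\<Inter>i. Uset_i P i)"

definition Fmap ::
  "('n::finite, 'd::finite, 'm::finite, 's::finite) sweeping_problem
     \<Rightarrow> real ^ 'n \<Rightarrow> real ^ 'n \<Rightarrow> real ^ 'd \<Rightarrow> (real ^ 'n) set" where
  "Fmap P x u a = (\<lambda>v. v - sweeping_problem.f P x a) ` limiting_normal_cone (Cset P) (x - u)"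

definition feasible ::
  "('n::finite, 'd::finite, 'm::finite, 's::finite) sweeping_problem
     \<Rightarrow> (real \<Rightarrow> real ^ 'n) \<Rightarrow> (real \<Rightarrow> real ^ 'n) \<Rightarrow> (real \<Rightarrow> real ^ 'd) \<Rightarrow> real \<Rightarrow> bool" where
  "feasible P x u a T \<longleftrightarrow>
     0 \<le> T \<and> W12_on T x \<and> W12_on T u \<and> L2_on T a \<and>
     (AE t in lebesgue_on {0..T}. - velocity x t \<in> Fmap P (x t) (u t) (a t)) \<and>
     (AE t in lebesgue_on {0..T}. u t \<in> Uset P) \<and>
     (AE t in lebesgue_on {0..T}. a t \<in> sweeping_problem.A P) \<and>
     x 0 = sweeping_problem.x0 P \<and> sweeping_problem.x0 P \<in> moving_set P (u 0) \<and>
     x T \<in> sweeping_problem.Xi_x P \<and> T \<in> sweeping_problem.Xi_T P"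

definition running_cost ::
  "('n::finite, 'd::finite, 'm::finite, 's::finite) sweeping_problem
     \<Rightarrow> (real \<Rightarrow> real ^ 'n) \<Rightarrow> (real \<Rightarrow> real ^ 'n) \<Rightarrow> (real \<Rightarrow> real ^ 'd) \<Rightarrow> real \<Rightarrow> ereal" where
  "running_cost P x u a t =
     sweeping_problem.ell P t (x t, u t, a t, velocity x t, velocity u t)"

definition J ::
  "('n::finite, 'd::finite, 'm::finite, 's::finite) sweeping_problem
     \<Rightarrow> (real \<Rightarrow> real ^ 'n) \<Rightarrow> (real \<Rightarrow> real ^ 'n) \<Rightarrow> (real \<Rightarrow> real ^ 'd) \<Rightarrow> real \<Rightarrow> ereal" where
  "J P x u a T =
     sweeping_problem.phi P (x T, ennreal T) + ereal_integral T (running_cost P x u a)"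

definition minimizing_sequence ::
  "('n::finite, 'd::finite, 'm::finite, 's::finite) sweeping_problem
     \<Rightarrow> (nat \<Rightarrow> real \<Rightarrow> real ^ 'n) \<Rightarrow> (nat \<Rightarrow> real \<Rightarrow> real ^ 'n) \<Rightarrow> (nat \<Rightarrow> real \<Rightarrow> real ^ 'd)
     \<Rightarrow> (nat \<Rightarrow> real) \<Rightarrow> bool" where
  "minimizing_sequence P x u a T \<longleftrightarrow>
     (\<forall>k. feasible P (x k) (u k) (a k) (T k)) \<and>
     (\<lambda>k. J P (x k) (u k) (a k) (T k)) \<longlonglongrightarrow>
       (INF (y, w, b, S) \<in> {(y, w, b, S). feasible P y w b S}. J P y w b S)"

definition optimal_solution ::
  "('n::finite, 'd::finite, 'm::finite, 's::finite) sweeping_problem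
     \<Rightarrow> (real \<Rightarrow> real ^ 'n) \<Rightarrow> (real \<Rightarrow> real ^ 'n) \<Rightarrow> (real \<Rightarrow> real ^ 'd) \<Rightarrow> real \<Rightarrow> bool" where
  "optimal_solution P x u a T \<longleftrightarrow> feasible P x u a T \<and>
     (\<forall>y w b S. feasible P y w b S \<longrightarrow> J P x u a T \<le> J P y w b S)"

section \<open>Standing assumptions\<close>

text \<open>The growth condition is required on the moving sets generated by the control \<open>u\<close> on \<open>[0, T]\<close>.\<close>

definition assumption_f ::
  "('n::finite, 'd::finite, 'm::finite, 's::finite) sweeping_problem
     \<Rightarrow> real \<Rightarrow> (real \<Rightarrow> real ^ 'n) \<Rightarrow> bool" where
  "assumption_f P T u \<longleftrightarrow>
     (\<exists>L>0. \<forall>x1 x2 a1 a2.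
        norm (sweeping_problem.f P x1 a1 - sweeping_problem.f P x2 a2)
          \<le> L * (norm (x1 - x2) + norm (a1 - a2))) \<and>
     (\<exists>M>0. \<forall>x\<in>(\<Union>t\<in>{0..T}. moving_set P (u t)). \<forall>a.
        norm (sweeping_problem.f P x a) \<le> M * (1 + norm x))"

definition near_active ::
  "('n::finite, 'd::finite, 'm::finite, 's::finite) sweeping_problem
     \<Rightarrow> real \<Rightarrow> real ^ 'n \<Rightarrow> 'm set" where
  "near_active P \<rho> x = {i. sweeping_problem.g P i x \<le> \<rho>}"

definition assumption_g ::
  "('n::finite, 'd::finite, 'm::finite, 's::finite) sweeping_problem \<Rightarrow> bool" where
  "assumption_g P \<longleftrightarrow>
     (\<exists>c M1 M2 M3. \<exists>V :: 'm \<Rightarrow> (real ^ 'n) set. 0 < c \<and> 0 < M1 \<and> 0 < M2 \<and> 0 < M3 \<and>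
        (\<forall>i. open (V i) \<and> Cset_i P i \<subseteq> V i \<and>
             ennreal c < hausdorff_distance (Cset_i P i) (- V i) \<and>
             (\<forall>x\<in>V i. M1 \<le> norm (gradient (sweeping_problem.g P i) x) \<and>
                       norm (gradient (sweeping_problem.g P i) x) \<le> M2 \<and>
                       onorm (hessian (sweeping_problem.g P i) x) \<le> M3))) \<and>
     (\<exists>\<beta> \<rho>. 0 < \<beta> \<and> 0 < \<rho> \<and>
        (\<forall>x\<in>Cset P. \<forall>lam :: 'm \<Rightarrow> real. (\<forall>i. 0 \<le> lam i) \<longrightarrow>
           (\<Sum>i\<in>near_active P \<rho> x. lam i * norm (gradient (sweeping_problem.g P i) x))
             \<le> \<beta> * norm (\<Sum>i\<in>near_active P \<rho> x. lam i *\<^sub>R gradient (sweeping_problem.g P i) x)))"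

definition assumption_nu ::
  "('n::finite, 'd::finite, 'm::finite, 's::finite) sweeping_problem \<Rightarrow> bool" where
  "assumption_nu P \<longleftrightarrow>
     (\<exists>L>0. \<forall>i.
        (\<forall>u1 u2. \<bar>sweeping_problem.nu P u2 $ i - sweeping_problem.nu P u1 $ i\<bar>
                   \<le> L * norm (u2 - u1)) \<and>
        (\<forall>u. norm (gradient (\<lambda>w. sweeping_problem.nu P w $ i) u) \<le> L)) \<and>
     (\<forall>u\<in>Uset P. \<forall>v :: 's \<Rightarrow> real ^ 'n.
        (\<forall>i. v i \<in> limiting_normal_cone (Uset_i P i) u) \<longrightarrow> (\<Sum>i\<in>UNIV. v i) = 0 \<longrightarrow>
        (\<forall>i. v i = 0))"

definition assumption_A ::
  "('n::finite, 'd::finite, 'm::finite, 's::finite) sweeping_problem \<Rightarrow> bool" where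
  "assumption_A P \<longleftrightarrow> compact (sweeping_problem.A P) \<and>
     (\<forall>x. convex (sweeping_problem.f P x ` sweeping_problem.A P))"

text \<open>
  Feasible triples live on their own interval \<open>[0, S]\<close> and are extended by constants to
  \<open>[0, T]\<close>, with zero velocity beyond \<open>S\<close>.
\<close>

definition assumption_cost ::
  "('n::finite, 'd::finite, 'm::finite, 's::finite) sweeping_problem \<Rightarrow> real \<Rightarrow> bool" where
  "assumption_cost P T \<longleftrightarrow>
     lsc_on UNIV (sweeping_problem.phi P) \<and>
     (AE t in lebesgue_on {0..T}.
        lsc_on UNIV (sweeping_problem.ell P t) \<and>
        (\<forall>B. bounded B \<longrightarrow> (\<exists>b::real. \<forall>z\<in>B. ereal b \<le> sweeping_problem.ell P t z))) \<and>
     (\<forall>x u a S. feasible P x u a S \<longrightarrow>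
        summable_fun T (running_cost P (const_ext S x) (const_ext S u) (const_ext S a)))"

definition standing_assumptions ::
  "('n::finite, 'd::finite, 'm::finite, 's::finite) sweeping_problem
     \<Rightarrow> real \<Rightarrow> (real \<Rightarrow> real ^ 'n) \<Rightarrow> bool" where
  "standing_assumptions P T u \<longleftrightarrow> assumption_f P T u \<and> assumption_g P \<and> assumption_nu P \<and>
     assumption_A P \<and> assumption_cost P T"

text \<open>Convexity of an extended-real function is convexity of its epigraph.\<close>

definition convex_in_velocities ::
  "('n::finite, 'd::finite, 'm::finite, 's::finite) sweeping_problem \<Rightarrow> real \<Rightarrow> bool" where
  "convex_in_velocities P T \<longleftrightarrow> (\<forall>t\<in>{0..T}. \<forall>x u a.
     convex {((v, w), r :: real). sweeping_problem.ell P t (x, u, a, v, w) \<le> ereal r})"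

definition majorized_by_summable ::
  "('n::finite, 'd::finite, 'm::finite, 's::finite) sweeping_problem \<Rightarrow> real \<Rightarrow> bool" where
  "majorized_by_summable P T \<longleftrightarrow>
     (\<exists>\<theta> :: real \<Rightarrow> real. integrable (lebesgue_on {0..T}) \<theta> \<and>
        (AE t in lebesgue_on {0..T}. \<forall>z. sweeping_problem.ell P t z \<le> ereal (\<theta> t)))"

end

theory Submission
  imports Defs "HOL-Complex_Analysis.Great_Picard"
begin

text \<open>
  The set \<open>C\<close> is locally prox-regular: a normal \<open>v\<close> at \<open>w\<close> satisfies
  \<open>v \<bullet> (z - w) \<le> K \<bar>v\<bar> \<bar>z - w\<bar>\<^sup>2\<close> for all \<open>z\<close> in \<open>C\<close>.  Along a feasible trajectory this makes the normal
  component of \<open>x'\<close> orthogonal to \<open>(x - u)'\<close>, so \<open>\<bar>x'\<bar> \<le> 2 \<bar>f\<bar> + \<bar>u'\<bar>\<close>, and Gronwall's inequality bounds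
  a minimizing sequence in \<open>W\<^sup>1\<^sup>,\<^sup>2\<close>.  A subsequence of \<open>(x, u)\<close> converges uniformly by Arzela--Ascoli,
  and the controls \<open>a\<close> converge almost everywhere by Helly's theorem.  Weak compactness of the
  velocities is replaced by convex combinations of tails that converge almost everywhere; the
  prox-regularity inequalities, being linear in \<open>v\<close> and in an upper bound for \<open>\<bar>v\<bar>\<close>, survive this passage
  to the limit and characterize proximal normals, so the limit is feasible.  Finally, a convex function which
  is majorized by a constant is constant, hence the running cost does not depend on the velocities;
  joint lower semicontinuity then bounds it from below along the bounded trajectories, and Fatou's
  lemma gives lower semicontinuity of the cost.
\<close>

section \<open>Lebesgue differentiation on the line\<close>

text \<open>\<open>C\<close> is an intersection of superlevel sets of convex functions, hence in
  general not convex, and convex combinations of normals taken at different points of different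
  trajectories need not be normals. This obstacle decides what is averaged: the triple of
  \<open>x'\<close>, \<open>u'\<close> and the norm of \<open>x'\<close>, with common weights, the
  last entry supplying the norm bound that enters the prox-regularity inequality linearly. Since
  \<open>velocity\<close> is a pointwise derivative while the limit is obtained as the integral of a
  density, the two have to be identified almost everywhere; this is why Lebesgue differentiation
  comes first. The final time is free, so trajectories are compared on one interval
  \<open>[0, S]\<close>, states extended by constants and velocities by zero. The margin
  \<open>\<epsilon>\<close> lets some \<open>T k + \<epsilon>\<close> reach the limiting time, so
  that the cost assumptions apply to the limit, and it keeps the intervals long enough to turn the
  L2 bound on \<open>u\<close> into a uniform one.\<close>

lemma negligible_integral_not_density:
  fixes f :: "real \<Rightarrow> 'a::euclidean_space"
  assumes int: "f integrable_on {a..b}" and e: "e > 0"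
  shows "negligible {x\<in>{a..b}. \<forall>\<delta>>0. \<exists>c d. c \<le> x \<and> x \<le> d \<and> c < d \<and> d - c < \<delta> \<and> {c..d} \<subseteq> {a..b} \<and>
           e * (d - c) \<le> norm ((d - c) *\<^sub>R f x - integral {c..d} f)}" (is "negligible ?E")
  unfolding negligible_outer_le
proof (intro allI impI)
  fix \<eta> :: real assume eta: "\<eta> > 0"
  \<comment> \<open>The 5 anticipates the dilation factor of Vitali's lemma: disjoint bad intervals
    will have total length at most \<eta>/5, and their fivefold enlargements cover the set. The
    factor \<open>e\<close> converts integration errors into lengths.\<close>
  have "e * \<eta> / 5 > 0" using e eta by simp
  then obtain \<gamma> where g: "gauge \<gamma>"
    and hen: "\<And>p. \<lbrakk>p tagged_partial_division_of {a..b}; \<gamma> fine p\<rbrakk> \<Longrightarrow>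
             sum (\<lambda>(x,k). norm(measure lborel k *\<^sub>R f x - integral k f)) p < e * \<eta> / 5"
    using Henstock_lemma[of f a b] int unfolding box_real by blast
  define Q where "Q x c d \<longleftrightarrow> c \<le> x \<and> x \<le> d \<and> c < d \<and> {c..d} \<subseteq> \<gamma> x \<and> {c..d} \<subseteq> {a..b} \<and>
           e * (d - c) \<le> norm ((d - c) *\<^sub>R f x - integral {c..d} f)" for x c d
  have "\<exists>c d. Q x c d" if xE: "x \<in> ?E" for x
  proof -
    have "x \<in> \<gamma> x" "open (\<gamma> x)" using g by (auto simp: gauge_def)
    then obtain \<delta> where d: "\<delta> > 0" "ball x \<delta> \<subseteq> \<gamma> x" by (meson openE)
    obtain c d where "c \<le> x" "x \<le> d" "c < d" "d - c < \<delta>" "{c..d} \<subseteq> {a..b}"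
           "e * (d - c) \<le> norm ((d - c) *\<^sub>R f x - integral {c..d} f)" using xE d(1) by blast
    moreover have "{c..d} \<subseteq> ball x \<delta>" using calculation by (auto simp: dist_real_def)
    ultimately show ?thesis unfolding Q_def using d(2) by blast
  qed
  then have "\<forall>x. \<exists>c d. x \<in> ?E \<longrightarrow> Q x c d" by blast
  then obtain c d where cQ: "\<forall>x. x \<in> ?E \<longrightarrow> Q x (c x) (d x)" by (subst (asm) choice_iff, subst (asm) choice_iff) blast
  define E where "E = ?E"
  from cQ have cd: "c x \<le> x \<and> x \<le> d x \<and> c x < d x \<and> {c x..d x} \<subseteq> \<gamma> x \<and> {c x..d x} \<subseteq> {a..b} \<and>
           e * (d x - c x) \<le> norm ((d x - c x) *\<^sub>R f x - integral {c x..d x} f)" if "x \<in> E" for x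
    using that unfolding Q_def E_def by blast
  \<comment> \<open>Midpoints and radii, because the covering lemma is about balls.\<close>
  define m where "m x = (c x + d x) / 2" for x
  define r where "r x = (d x - c x) / 2" for x
  have mr: "m x - r x = c x" "m x + r x = d x" for x unfolding m_def r_def by argo+
  then have cb: "cball (m x) (r x) = {c x..d x}" for x
    by (simp only: cball_eq_atLeastAtMost mr)
  have cov: "E \<subseteq> (\<Union>i\<in>E. cball (m i) (r i))"
  proof
    fix i assume "i \<in> E"
    from cd[OF this] have "i \<in> cball (m i) (r i)" unfolding cb by simp
    with \<open>i \<in> E\<close> show "i \<in> (\<Union>i\<in>E. cball (m i) (r i))" by (rule UN_I)
  qed
  have "0 < r i \<and> r i \<le> (b - a)/2" if "i \<in> E" for i
  proof -
    have "c i \<in> {c i..d i}" "d i \<in> {c i..d i}" "{c i..d i} \<subseteq> {a..b}" using cd[OF that] by auto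
    then have "c i \<in> {a..b}" "d i \<in> {a..b}" by blast+
    then show ?thesis using cd[OF that] by (auto simp: r_def)
  qed
  note rb = this
  obtain C where C: "countable C" "C \<subseteq> E"
     "pairwise (\<lambda>i j. disjnt (cball (m i) (r i)) (cball (m j) (r j))) C"
     "E \<subseteq> (\<Union>i\<in>C. cball (m i) (5 * r i))"
    by (rule Vitali_covering_lemma_cballs[OF cov rb]) (assumption, rule that)
  have fin: "(\<Sum>i\<in>F. d i - c i) \<le> \<eta> / 5" if F: "finite F" "F \<subseteq> C" for F
  proof -
    \<comment> \<open>Disjoint bad intervals, each tagged by its own point, form a partial division
      that is fine for \<open>\<gamma>\<close>, so Henstock's lemma bounds the sum of their
      errors.\<close>
    define p where "p = (\<lambda>i. (i, {c i..d i})) ` F"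
    have FE: "i \<in> E" if "i \<in> F" for i using F C(2) that by blast
    have inj: "inj_on (\<lambda>i. (i, {c i..d i})) F" by (auto simp: inj_on_def)
    have part: "p tagged_partial_division_of {a..b}"
      unfolding tagged_partial_division_of_def
    proof (intro conjI allI impI)
      show "finite p" using F by (simp add: p_def)
      fix x k assume "(x,k) \<in> p"
      then have x: "x \<in> F" "k = {c x..d x}" by (auto simp: p_def)
      show "x \<in> k" "k \<subseteq> {a..b}" using x cd[OF FE[OF x(1)]] by auto
      show "\<exists>a b. k = cbox a b" unfolding box_real x(2) by blast
    next
      fix x k x' k' assume xk: "(x, k) \<in> p \<and> (x', k') \<in> p \<and> (x, k) \<noteq> (x', k')"
      then have ne: "(x, k) \<noteq> (x', k')" by simp
      from xk have x: "x \<in> F" "k = {c x..d x}" by (auto simp: p_def)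
      from xk have x': "x' \<in> F" "k' = {c x'..d x'}" by (auto simp: p_def)
      with ne x have "x \<noteq> x'" by auto
      then have "disjnt k k'" using C(3) F x x' unfolding pairwise_def cb by blast
      then show "interior k \<inter> interior k' = {}" unfolding disjnt_def
        using interior_subset by blast
    qed
    have "\<gamma> fine p" using cd FE unfolding fine_def p_def by fastforce
    from hen[OF part this]
    have "(\<Sum>i\<in>F. norm (measure lborel {c i..d i} *\<^sub>R f i - integral {c i..d i} f)) < e * \<eta> / 5"
      unfolding p_def sum.reindex[OF inj] by (simp only: o_def prod.case)
    moreover have "(\<Sum>i\<in>F. norm (measure lborel {c i..d i} *\<^sub>R f i - integral {c i..d i} f))
        = (\<Sum>i\<in>F. norm ((d i - c i) *\<^sub>R f i - integral {c i..d i} f))"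
    proof (rule sum.cong[OF refl])
      fix i assume "i \<in> F"
      have "measure lborel {c i..d i} = d i - c i" using cd[OF FE[OF \<open>i \<in> F\<close>]] by simp
      then show "norm (measure lborel {c i..d i} *\<^sub>R f i - integral {c i..d i} f)
          = norm ((d i - c i) *\<^sub>R f i - integral {c i..d i} f)" by (simp only:)
    qed
    ultimately have "(\<Sum>i\<in>F. norm ((d i - c i) *\<^sub>R f i - integral {c i..d i} f)) < e * \<eta> / 5"
      by linarith
    moreover have "(\<Sum>i\<in>F. e * (d i - c i)) \<le> (\<Sum>i\<in>F. norm ((d i - c i) *\<^sub>R f i - integral {c i..d i} f))"
      using cd FE by (intro sum_mono) blast
    ultimately have "e * (\<Sum>i\<in>F. d i - c i) \<le> e * (\<eta> / 5)" by (simp add: sum_distrib_left)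
    then show ?thesis using e by simp
  qed
  have bound: "measure lebesgue (\<Union>i\<in>F. cball (m i) (5 * r i)) \<le> \<eta>" if F: "finite F" "F \<subseteq> C" for F
  proof -
    have "measure lebesgue (\<Union>i\<in>F. cball (m i) (5 * r i)) \<le> (\<Sum>i\<in>F. measure lebesgue (cball (m i) (5 * r i)))"
      by (rule measure_UNION_le) (use F in auto)
    also have "\<dots> = (\<Sum>i\<in>F. 5 * (d i - c i))"
    proof (rule sum.cong)
      fix i assume "i \<in> F"
      then have "c i < d i" using cd C F by blast
      then have "0 \<le> r i" by (simp add: r_def)
      then have "measure lebesgue (cball (m i) (5 * r i)) = 10 * r i" by (simp add: cball_eq_atLeastAtMost)
      then show "measure lebesgue (cball (m i) (5 * r i)) = 5 * (d i - c i)" by (simp add: r_def)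
    qed simp
    also have "\<dots> \<le> \<eta>" using fin[OF F] unfolding sum_distrib_left[symmetric] by simp
    finally show ?thesis .
  qed
  show "\<exists>T. ?E \<subseteq> T \<and> T \<in> lmeasurable \<and> measure lebesgue T \<le> \<eta>"
  proof (intro exI conjI)
    show "?E \<subseteq> (\<Union>i\<in>C. cball (m i) (5 * r i))" using C(4) unfolding E_def .
    show "(\<Union>i\<in>C. cball (m i) (5 * r i)) \<in> lmeasurable"
      by (rule fmeasurable_UN_bound[OF C(1) _ bound]) auto
    show "measure lebesgue (\<Union>i\<in>C. cball (m i) (5 * r i)) \<le> \<eta>"
      by (rule measure_UN_bound[OF C(1) _ bound]) auto
  qed
qed

text \<open>The exceptional sets for the accuracies 1/(n+1) form a countable union of null sets.
  Outside it, intervals having \<open>t\<close> as an endpoint give exactly the one-sided difference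
  quotients.\<close>

lemma negligible_indefinite_integral_not_differentiable:
  fixes f :: "real \<Rightarrow> 'a::euclidean_space"
  assumes int: "f integrable_on {a..b}"
  shows "negligible {t\<in>{a<..<b}. \<not> ((\<lambda>s. integral {a..s} f) has_vector_derivative f t) (at t)}"
proof -
  define E where "E e = {x\<in>{a..b}. \<forall>\<delta>>0. \<exists>c d. c \<le> x \<and> x \<le> d \<and> c < d \<and> d - c < \<delta> \<and> {c..d} \<subseteq> {a..b} \<and>
           e * (d - c) \<le> norm ((d - c) *\<^sub>R f x - integral {c..d} f)}" for e
  have negE: "negligible (E e)" if "e > 0" for e
    unfolding E_def by (rule negligible_integral_not_density[OF int that])
  have neg: "negligible (\<Union>n. E (inverse (real (Suc n))))"
  proof (rule negligible_countable_Union)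
    show "negligible A" if "A \<in> range (\<lambda>n. E (inverse (real (Suc n))))" for A
      using that by (elim imageE, simp only:) (rule negE, simp)
  qed simp
  have "((\<lambda>s. integral {a..s} f) has_vector_derivative f t) (at t)"
    if t: "a < t" "t < b" and nE: "t \<notin> (\<Union>n. E (inverse (real (Suc n))))" for t
    unfolding has_vector_derivative_def has_derivative_within_alt
  proof (intro conjI allI impI)
    show "bounded_linear (\<lambda>x. x *\<^sub>R f t)" by (simp add: bounded_linear_scaleR_left)
    fix e :: real assume "e > 0"
    then obtain n where n: "inverse (real (Suc n)) < e" using reals_Archimedean by blast
    define i where "i = inverse (real (Suc n))"
    have "i < e" using n i_def by simp
    from nE have "t \<notin> E i" unfolding i_def by blast
    moreover have "t \<in> {a..b}" using t by simp
    ultimately obtain \<delta> where d: "\<delta> > 0"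
      and nex: "\<nexists>c d. c \<le> t \<and> t \<le> d \<and> c < d \<and> d - c < \<delta> \<and> {c..d} \<subseteq> {a..b} \<and>
           i * (d - c) \<le> norm ((d - c) *\<^sub>R f t - integral {c..d} f)"
      unfolding E_def by blast
    have nd: "norm ((d - c) *\<^sub>R f t - integral {c..d} f) < i * (d - c)"
      if "c \<le> t" "t \<le> d" "c < d" "d - c < \<delta>" "{c..d} \<subseteq> {a..b}" for c d
      using nex that by (meson not_le)
    show "\<exists>d>0. \<forall>y\<in>UNIV. norm (y - t) < d \<longrightarrow>
            norm (integral {a..y} f - integral {a..t} f - (y - t) *\<^sub>R f t) \<le> e * norm (y - t)"
    proof (intro exI[of _ "min \<delta> (min (t - a) (b - t))"] conjI ballI impI)
      show "0 < min \<delta> (min (t - a) (b - t))" using d t by auto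
      fix y assume y: "norm (y - t) < min \<delta> (min (t - a) (b - t))"
      have comb: "integral {a..p} f + integral {p..q} f = integral {a..q} f" if "a \<le> p" "p \<le> q" "q \<le> b" for p q
        by (rule Henstock_Kurzweil_Integration.integral_combine) (use that int in \<open>auto intro: integrable_on_subinterval\<close>)
      consider "y = t" | "t < y" | "y < t" by linarith
      then show "norm (integral {a..y} f - integral {a..t} f - (y - t) *\<^sub>R f t) \<le> e * norm (y - t)"
      proof cases
        case 1 then show ?thesis by simp
      next
        case 2
        have *: "norm ((y - t) *\<^sub>R f t - integral {t..y} f) < i * (y - t)"
          using 2 t y by (intro nd) (auto simp: abs_if)
        moreover have "integral {a..y} f - integral {a..t} f = integral {t..y} f"
          using comb[of t y] 2 t y by (auto simp: abs_if algebra_simps)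
        moreover have "norm ((y - t) *\<^sub>R f t - integral {t..y} f) \<le> e * (y - t)"
          using mult_right_mono[of i e "y - t"] \<open>i < e\<close> * 2 by linarith
        ultimately show ?thesis using 2 by (simp add: norm_minus_commute)
      next
        case 3
        have *: "norm ((t - y) *\<^sub>R f t - integral {y..t} f) < i * (t - y)"
          using 3 t y by (intro nd) (auto simp: abs_if)
        moreover have "integral {a..y} f - integral {a..t} f - (y - t) *\<^sub>R f t = (t - y) *\<^sub>R f t - integral {y..t} f"
          using comb[of y t] 3 t y by (auto simp: abs_if algebra_simps)
        moreover have "norm ((t - y) *\<^sub>R f t - integral {y..t} f) \<le> e * (t - y)"
          using mult_right_mono[of i e "t - y"] \<open>i < e\<close> * 3 by linarith
        ultimately show ?thesis using 3 by simp
      qed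
    qed
  qed
  then have "{t\<in>{a<..<b}. \<not> ((\<lambda>s. integral {a..s} f) has_vector_derivative f t) (at t)}
      \<subseteq> (\<Union>n. E (inverse (real (Suc n))))"
    by (metis (no_types, lifting) greaterThanLessThan_iff mem_Collect_eq subsetI)
  then show ?thesis
    by (rule negligible_subset[OF neg])
qed

section \<open>Gradients and proximal normals\<close>

text \<open>\<open>gradient\<close> is a definite description, so both existence and uniqueness of
  the vector representing the derivative have to be established before it can be used.\<close>

lemma C1_fun_gderiv:
  fixes g :: "'a::euclidean_space \<Rightarrow> real"
  assumes "C1_fun g"
  shows "GDERIV g x :> gradient g x"
proof -
  let ?g' = "frechet_derivative g (at x)"
  have d: "(g has_derivative ?g') (at x)"
    using assms by (simp add: C1_fun_def frechet_derivative_works)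
  then have lin: "linear ?g'" by (rule has_derivative_linear)
  have "?g' h = h \<bullet> (\<Sum>b\<in>Basis. ?g' b *\<^sub>R b)" for h
  proof -
    have "?g' h = ?g' (\<Sum>b\<in>Basis. (h \<bullet> b) *\<^sub>R b)" by (simp add: euclidean_representation)
    also have "\<dots> = (\<Sum>b\<in>Basis. (h \<bullet> b) * ?g' b)"
      by (simp add: linear_sum[OF lin] linear_cmul[OF lin])
    finally show ?thesis by (simp add: inner_sum_right mult.commute)
  qed
  then have "?g' = (\<lambda>h. h \<bullet> (\<Sum>b\<in>Basis. ?g' b *\<^sub>R b))" by blast
  with d have ex: "GDERIV g x :> (\<Sum>b\<in>Basis. ?g' b *\<^sub>R b)" by (simp add: gderiv_def)
  have "GDERIV g x :> D \<Longrightarrow> D = (\<Sum>b\<in>Basis. ?g' b *\<^sub>R b)" for D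
  proof -
    assume "GDERIV g x :> D"
    then have "(\<lambda>h. h \<bullet> D) = (\<lambda>h. h \<bullet> (\<Sum>b\<in>Basis. ?g' b *\<^sub>R b))"
      using ex has_derivative_unique unfolding gderiv_def by blast
    then have "\<forall>h. h \<bullet> D = h \<bullet> (\<Sum>b\<in>Basis. ?g' b *\<^sub>R b)" by (rule fun_cong[THEN allI])
    then show ?thesis by (simp only: vector_eq_ldot)
  qed
  with ex show ?thesis unfolding gradient_def by (rule theI)
qed

text \<open>\<open>C1_fun\<close> gives continuity of the derivative one direction at a time. The
  sum of the norms over a basis dominates the operator norm and is bounded on the compact ball;
  \<open>max B 0\<close> covers an empty ball.\<close>

lemma C1_fun_lipschitz_on_cball:
  fixes h :: "'a::euclidean_space \<Rightarrow> 'b::euclidean_space"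
  assumes "C1_fun h"
  shows "\<exists>B\<ge>0. \<forall>x\<in>cball 0 R. \<forall>y\<in>cball 0 R. norm (h y - h x) \<le> B * norm (y - x)"
proof -
  let ?h' = "\<lambda>x. frechet_derivative h (at x)"
  have d: "(h has_derivative ?h' x) (at x)" for x
    using assms by (simp add: C1_fun_def frechet_derivative_works)
  have "continuous_on (cball 0 R) (\<lambda>x. \<Sum>b\<in>Basis. norm (?h' x b))"
    using assms unfolding C1_fun_def by (intro continuous_intros) (auto intro: continuous_on_subset)
  then have "bounded ((\<lambda>x. \<Sum>b\<in>Basis. norm (?h' x b)) ` cball 0 R)"
    by (intro compact_imp_bounded compact_continuous_image) auto
  then obtain B where B: "\<And>x. x \<in> cball 0 R \<Longrightarrow> (\<Sum>b\<in>Basis. norm (?h' x b)) \<le> B"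
    unfolding bounded_iff by (metis abs_le_D1 imageI real_norm_def)
  have on: "onorm (?h' x) \<le> max B 0" if "x \<in> cball 0 R" for x
  proof (rule onorm_bound)
    fix v
    have lin: "linear (?h' x)" using d by (rule has_derivative_linear)
    have "norm (?h' x v) = norm (?h' x (\<Sum>b\<in>Basis. (v \<bullet> b) *\<^sub>R b))" by (simp add: euclidean_representation)
    also have "\<dots> = norm (\<Sum>b\<in>Basis. (v \<bullet> b) *\<^sub>R ?h' x b)"
      by (simp add: linear_sum[OF lin] linear_cmul[OF lin])
    also have "\<dots> \<le> (\<Sum>b\<in>Basis. norm v * norm (?h' x b))"
      by (rule sum_norm_le) (auto intro!: mult_right_mono Basis_le_norm)
    also have "\<dots> \<le> norm v * max B 0"
      unfolding sum_distrib_left[symmetric] using B[OF that] by (intro mult_left_mono) auto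
    finally show "norm (?h' x v) \<le> max B 0 * norm v" by (simp add: mult.commute)
  qed simp
  have "norm (h y - h x) \<le> max B 0 * norm (y - x)" if "x \<in> cball 0 R" "y \<in> cball 0 R" for x y
    by (rule differentiable_bound[of "cball 0 R" h ?h'])
       (use that on d in \<open>auto intro: has_derivative_at_withinI\<close>)
  then show ?thesis by (intro exI[of _ "max B 0"]) auto
qed

text \<open>Subtracting the linear function with slope \<open>gradient g x\<close> leaves a function
  whose gradient at \<open>z\<close> is a difference of gradients, of order
  \<open>norm (z - x)\<close>; the mean value inequality on the segment supplies the second
  factor.\<close>

lemma C2_fun_quadratic_bound:
  fixes g :: "'a::euclidean_space \<Rightarrow> real"
  assumes "C2_fun g"
  shows "\<exists>L\<ge>0. \<forall>x\<in>cball 0 R. \<forall>y\<in>cball 0 R.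
           \<bar>g y - g x - gradient g x \<bullet> (y - x)\<bar> \<le> L * (norm (y - x))\<^sup>2"
proof -
  obtain B where B: "B \<ge> 0" "\<And>x y. x \<in> cball 0 R \<Longrightarrow> y \<in> cball 0 R \<Longrightarrow> norm (gradient g y - gradient g x) \<le> B * norm (y - x)"
    using C1_fun_lipschitz_on_cball[of "gradient g" R] assms unfolding C2_fun_def by blast
  have d: "(g has_derivative (\<lambda>h. h \<bullet> gradient g x)) (at x)" for x
    using assms C1_fun_gderiv[of g x] by (simp add: C2_fun_def gderiv_def)
  have "\<bar>g y - g x - gradient g x \<bullet> (y - x)\<bar> \<le> B * (norm (y - x))\<^sup>2"
    if xy: "x \<in> cball 0 R" "y \<in> cball 0 R" for x y
  proof -
    let ?\<phi> = "\<lambda>z. g z - z \<bullet> gradient g x"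
    have sub: "z \<in> cball 0 R" if "z \<in> closed_segment x y" for z
      using that xy closed_segment_subset[OF xy convex_cball] by blast
    have "norm (?\<phi> y - ?\<phi> x) \<le> (B * norm (y - x)) * norm (y - x)"
    proof (rule differentiable_bound[of "closed_segment x y" ?\<phi> "\<lambda>z h. h \<bullet> (gradient g z - gradient g x)"])
      fix z assume z: "z \<in> closed_segment x y"
      show "(?\<phi> has_derivative (\<lambda>h. h \<bullet> (gradient g z - gradient g x))) (at z within closed_segment x y)"
        by (auto intro!: derivative_eq_intros has_derivative_at_withinI[OF d] simp: inner_diff_right)
      have "norm (gradient g z - gradient g x) \<le> B * norm (z - x)" using B(2) xy sub z by blast
      also have "\<dots> \<le> B * norm (y - x)"
        using segment_bound(1)[OF z] B(1) by (intro mult_left_mono) auto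
      finally have *: "norm (gradient g z - gradient g x) \<le> B * norm (y - x)" .
      show "onorm (\<lambda>h. h \<bullet> (gradient g z - gradient g x)) \<le> B * norm (y - x)"
      proof (rule onorm_bound)
        fix h
        have "norm (h \<bullet> (gradient g z - gradient g x)) \<le> norm h * norm (gradient g z - gradient g x)"
          by (simp add: Cauchy_Schwarz_ineq2)
        also have "\<dots> \<le> norm h * (B * norm (y - x))" using * by (intro mult_left_mono) auto
        finally show "norm (h \<bullet> (gradient g z - gradient g x)) \<le> B * norm (y - x) * norm h"
          by (simp add: mult.commute)
      qed (use B in auto)
    qed auto
    moreover have "?\<phi> y - ?\<phi> x = g y - g x - gradient g x \<bullet> (y - x)"
      by (simp add: inner_diff_right inner_commute)
    ultimately show ?thesis by (simp add: power2_eq_square mult.assoc)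
  qed
  with B(1) show ?thesis by blast
qed

text \<open>The normalized point \<open>h\<close> of the hull closest to the origin works, because
  the obtuse angle property of projections gives \<open>h \<bullet> h \<le> s \<bullet> h\<close>.
  Only \<open>norm d \<le> 1\<close> is claimed, since for empty \<open>S\<close> the choice is
  0.\<close>

lemma min_norm_direction:
  fixes S :: "'a::euclidean_space set"
  assumes "finite S" "\<delta> > 0" and hull: "\<And>h. h \<in> convex hull S \<Longrightarrow> \<delta> \<le> norm h"
  shows "\<exists>d. norm d \<le> 1 \<and> (\<forall>s\<in>S. \<delta> \<le> s \<bullet> d)"
proof (cases "S = {}")
  case True then show ?thesis by (intro exI[of _ 0]) auto
next
  case False
  let ?H = "convex hull S"
  have cl: "closed ?H" using assms(1) by (simp add: compact_imp_closed compact_convex_hull finite_imp_compact)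
  have ne: "?H \<noteq> {}" using False by simp
  define h where "h = closest_point ?H 0"
  have h: "h \<in> ?H" "\<And>y. y \<in> ?H \<Longrightarrow> dist 0 h \<le> dist 0 y"
    unfolding h_def using closest_point_exists[OF cl ne, of 0] by blast+
  have nh: "\<delta> \<le> norm h" using hull h by blast
  have "\<delta> \<le> s \<bullet> ((1 / norm h) *\<^sub>R h)" if "s \<in> S" for s
  proof -
    have "(0 - h) \<bullet> (s - h) \<le> 0"
      by (rule any_closest_point_dot[OF convex_convex_hull cl h(1)]) (use h that hull_inc in auto)
    then have "h \<bullet> h \<le> s \<bullet> h"
      by (simp add: inner_diff_right inner_commute)
    then have "norm h * norm h \<le> s \<bullet> h"
      by (simp add: dot_square_norm power2_eq_square)
    moreover have "norm h > 0" using nh assms(2) by linarith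
    ultimately have "norm h \<le> (s \<bullet> h) / norm h" by (metis mult_imp_le_div_pos)
    with nh show ?thesis by simp
  qed
  then show ?thesis using nh assms(2) by (intro exI[of _ "(1 / norm h) *\<^sub>R h"]) auto
qed

text \<open>A quadratic bound on \<open>v\<close> means that \<open>w\<close> is the nearest point
  of \<open>C\<close> to \<open>w + v/\<alpha>\<close> for every large \<alpha>; the constant
  sequence \<open>w\<close> and these points then witness membership in the cone.\<close>

lemma limiting_normal_cone_of_quadratic_bound:
  fixes w :: "'a::euclidean_space"
  assumes "w \<in> C" "r > 0" "K \<ge> 0"
    and loc: "\<And>z. z \<in> C \<Longrightarrow> norm (z - w) \<le> r \<Longrightarrow> v \<bullet> (z - w) \<le> K * (norm (z - w))\<^sup>2"
  shows "v \<in> limiting_normal_cone C w"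
proof -
  \<comment> \<open>Farther than \<open>r\<close> from \<open>w\<close>, Cauchy-Schwarz and
    \<open>1 \<le> norm (z - w) / r\<close> give a quadratic bound with constant
    \<open>norm v / r\<close>, which makes the local inequality global.\<close>
  define K' where "K' = K + norm v / r"
  have K': "K' \<ge> 0" "K' \<ge> K" using assms by (auto simp: K'_def)
  have glob: "v \<bullet> (z - w) \<le> K' * (norm (z - w))\<^sup>2" if "z \<in> C" for z
  proof (cases "norm (z - w) \<le> r")
    case True
    then show ?thesis using loc[OF that True] mult_right_mono[OF K'(2), of "(norm (z - w))\<^sup>2"] by simp
  next
    case False
    then have "1 \<le> norm (z - w) / r" using assms(2) by simp
    have "v \<bullet> (z - w) \<le> norm v * norm (z - w)" by (rule norm_cauchy_schwarz)
    also have "\<dots> \<le> (norm v * norm (z - w)) * (norm (z - w) / r)"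
      using mult_left_mono[OF \<open>1 \<le> _\<close>, of "norm v * norm (z - w)"] by (simp add: mult_nonneg_nonneg)
    also have "\<dots> = norm v / r * (norm (z - w))\<^sup>2" by (simp add: power2_eq_square)
    also have "\<dots> \<le> K' * (norm (z - w))\<^sup>2" using assms(3) by (intro mult_right_mono) (auto simp: K'_def)
    finally show ?thesis .
  qed
  \<comment> \<open>Expanding the square, \<open>w\<close> is a projection as soon as \<alpha> is at
    least \<open>2 * K'\<close>; the 1 keeps \<alpha> positive, and \<open>real k\<close> moves the
    projected points to \<open>w\<close>.\<close>
  define \<alpha> where "\<alpha> k = 2 * K' + 1 + real k" for k
  have a: "\<alpha> k > 0" "\<alpha> k \<ge> 2 * K'" for k using K' by (auto simp: \<alpha>_def)
  have lim: "filterlim \<alpha> at_top sequentially"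
    unfolding \<alpha>_def by (intro filterlim_tendsto_add_at_top[OF tendsto_const] filterlim_real_sequentially)
  have "(\<lambda>k. w + inverse (\<alpha> k) *\<^sub>R v) \<longlonglongrightarrow> w + 0 *\<^sub>R v"
    by (intro tendsto_intros tendsto_inverse_0_at_top lim)
  moreover have "w \<in> projection_set (w + inverse (\<alpha> k) *\<^sub>R v) C" for k
    unfolding projection_set_def
  proof (clarsimp simp: assms(1))
    fix y assume y: "y \<in> C"
    have "2 * (v \<bullet> (y - w)) \<le> \<alpha> k * (norm (y - w))\<^sup>2"
      using glob[OF y] mult_right_mono[OF a(2)[of k], of "(norm (y - w))\<^sup>2"] by simp
    then have "inverse (\<alpha> k) * (2 * (v \<bullet> (y - w))) \<le> (norm (y - w))\<^sup>2"
      using a(1)[of k] by (simp add: field_simps)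
    moreover have "(norm ((y - w) - inverse (\<alpha> k) *\<^sub>R v))\<^sup>2 = (norm (y - w))\<^sup>2
        - inverse (\<alpha> k) * (2 * (v \<bullet> (y - w))) + (norm (inverse (\<alpha> k) *\<^sub>R v))\<^sup>2"
      by (simp only: power2_norm_eq_inner inner_diff_left inner_diff_right inner_scaleR_left inner_scaleR_right)
         (simp add: inner_commute algebra_simps)
    ultimately have "(norm (inverse (\<alpha> k) *\<^sub>R v))\<^sup>2 \<le> (norm ((y - w) - inverse (\<alpha> k) *\<^sub>R v))\<^sup>2" by simp
    then have "norm (inverse (\<alpha> k) *\<^sub>R v) \<le> norm ((y - w) - inverse (\<alpha> k) *\<^sub>R v)" by (rule power2_le_imp_le) simp
    then show "dist (w + inverse (\<alpha> k) *\<^sub>R v) w \<le> dist (w + inverse (\<alpha> k) *\<^sub>R v) y"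
      by (simp add: dist_norm norm_minus_commute algebra_simps)
  qed
  moreover have "(\<lambda>k. \<alpha> k *\<^sub>R (w + inverse (\<alpha> k) *\<^sub>R v - w)) \<longlonglongrightarrow> v"
  proof -
    have "\<alpha> k *\<^sub>R (w + inverse (\<alpha> k) *\<^sub>R v - w) = v" for k
      using a(1)[of k] by simp
    then show ?thesis by simp
  qed
  ultimately have "\<exists>(x :: nat \<Rightarrow> 'a) w' \<alpha>. x \<longlonglongrightarrow> w \<and>
              (\<forall>k. w' k \<in> projection_set (x k) C) \<and> (\<forall>k. (0::real) \<le> \<alpha> k) \<and>
              (\<lambda>k. \<alpha> k *\<^sub>R (x k - w' k)) \<longlonglongrightarrow> v"
    using a(1)[THEN less_imp_le]
    by (intro exI[of _ "\<lambda>k. w + inverse (\<alpha> k) *\<^sub>R v"] exI[of _ "\<lambda>k. w"] exI[of _ \<alpha>] conjI allI)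
       (simp_all only: scaleR_zero_left add_0_right)
  then show ?thesis unfolding limiting_normal_cone_def if_P[OF assms(1)] mem_Collect_eq .
qed

section \<open>Prox-regularity of the constraint set\<close>

lemma Cset_i_continuous:
  assumes "problem_data P"
  shows "continuous_on UNIV (sweeping_problem.g P i)"
proof -
  have "C1_fun (sweeping_problem.g P i)" using assms by (auto simp: problem_data_def C2_fun_def)
  then show ?thesis
    unfolding C1_fun_def by (meson continuous_at_imp_continuous_on differentiable_imp_continuous_within)
qed

lemma closed_Cset:
  assumes "problem_data P"
  shows "closed (Cset P)"
  unfolding Cset_def Cset_i_def
  using Cset_i_continuous[OF assms] by (intro closed_INT ballI closed_Collect_le continuous_on_const)

text \<open>Short steps from \<open>w\<close> along \<open>d\<close> stay in the set: active
  constraints increase to first order, inactive ones stay positive by continuity. As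
  \<open>w\<close> is nearest to \<open>p\<close>, such a step cannot reduce the distance, which
  bounds \<open>(p - w) \<bullet> d\<close> by a multiple of the step length.\<close>

lemma proximal_normal_interior_direction:
  assumes data: "problem_data P" and w: "w \<in> projection_set p (Cset P)"
    and dir: "\<And>i. sweeping_problem.g P i w = 0 \<Longrightarrow> gradient (sweeping_problem.g P i) w \<bullet> d > 0"
  shows "(p - w) \<bullet> d \<le> 0"
proof -
  let ?g = "sweeping_problem.g P"
  have wC: "w \<in> Cset P" and min: "\<And>y. y \<in> Cset P \<Longrightarrow> dist p w \<le> dist p y"
    using w by (auto simp: projection_set_def)
  have "eventually (\<lambda>t. 0 \<le> ?g i (w + t *\<^sub>R d)) (at_right 0)" for i
  proof (cases "?g i w = 0")
    case True
    have "C1_fun (?g i)" using data by (auto simp: problem_data_def C2_fun_def)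
    then have G: "(?g i has_derivative (\<lambda>h. h \<bullet> gradient (?g i) w)) (at w)"
      using C1_fun_gderiv[of "?g i" w] by (simp add: gderiv_def)
    have inner: "((\<lambda>t. w + t *\<^sub>R d) has_derivative (\<lambda>t. t *\<^sub>R d)) (at 0)"
      by (auto intro!: derivative_eq_intros)
    have "((\<lambda>t. ?g i (w + t *\<^sub>R d)) has_derivative (\<lambda>t. (t *\<^sub>R d) \<bullet> gradient (?g i) w)) (at 0)"
      by (rule has_derivative_compose[OF inner]) (simp add: G)
    then have "((\<lambda>t. ?g i (w + t *\<^sub>R d)) has_real_derivative (gradient (?g i) w \<bullet> d)) (at 0)"
      unfolding has_field_derivative_def
      by (rule has_derivative_eq_rhs) (simp add: fun_eq_iff inner_commute)
    from DERIV_pos_inc_right[OF this dir[OF True]] obtain e where e: "e > 0"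
      "\<And>h. 0 < h \<Longrightarrow> h < e \<Longrightarrow> ?g i w < ?g i (w + h *\<^sub>R d)" by auto
    then have "\<forall>t>0. t < e \<longrightarrow> 0 \<le> ?g i (w + t *\<^sub>R d)" using True by fastforce
    then show ?thesis unfolding eventually_at_right_field using e(1) by blast
  next
    case False
    then have pos: "?g i w > 0" using wC by (auto simp: Cset_def Cset_i_def order.strict_iff_order)
    have "((\<lambda>t. ?g i (w + t *\<^sub>R d)) \<longlongrightarrow> ?g i (w + 0 *\<^sub>R d)) (at_right 0)"
      by (rule isCont_tendsto_compose[of _ "?g i"])
         (use Cset_i_continuous[OF data, of i] in \<open>auto simp: continuous_on_eq_continuous_at intro!: tendsto_eq_intros\<close>)
    then have "((\<lambda>t. ?g i (w + t *\<^sub>R d)) \<longlongrightarrow> ?g i w) (at_right 0)" by simp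
    from order_tendstoD(1)[OF this pos] show ?thesis by (rule eventually_mono) simp
  qed
  then have "eventually (\<lambda>t. \<forall>i. 0 \<le> ?g i (w + t *\<^sub>R d)) (at_right 0)"
    by (simp add: eventually_all_finite)
  moreover have "eventually (\<lambda>t::real. t > 0) (at_right 0)" by (rule eventually_at_right_less)
  ultimately have "eventually (\<lambda>t. (p - w) \<bullet> d \<le> t * (norm d)\<^sup>2) (at_right 0)"
  proof eventually_elim
    case (elim t)
    then have "w + t *\<^sub>R d \<in> Cset P" by (simp add: Cset_def Cset_i_def)
    from min[OF this] have "norm (p - w) \<le> norm ((p - w) - t *\<^sub>R d)" by (simp add: dist_norm algebra_simps)
    then have "(norm (p - w))\<^sup>2 \<le> (norm ((p - w) - t *\<^sub>R d))\<^sup>2" by (intro power_mono) auto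
    also have "\<dots> = (norm (p - w))\<^sup>2 - 2 * t * ((p - w) \<bullet> d) + t * t * (norm d)\<^sup>2"
      using dot_norm_neg[of "p - w" "t *\<^sub>R d"] by (simp add: field_simps power2_eq_square)
    finally have "t * (2 * ((p - w) \<bullet> d)) \<le> t * (t * (norm d)\<^sup>2)" by (simp add: mult.assoc mult.left_commute)
    with elim have "2 * ((p - w) \<bullet> d) \<le> t * (norm d)\<^sup>2" by simp
    moreover have "0 \<le> t * (norm d)\<^sup>2" using elim by simp
    ultimately show ?case by linarith
  qed
  moreover have "((\<lambda>t. t * (norm d)\<^sup>2) \<longlongrightarrow> 0 * (norm d)\<^sup>2) (at_right 0)"
    by (intro tendsto_intros)
  ultimately show ?thesis
    using tendsto_lowerbound[of "\<lambda>t. t * (norm d)\<^sup>2" 0 "at_right 0" "(p - w) \<bullet> d"] by simp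
qed

text \<open>The constant is \<open>M1 / \<beta>\<close>: for weights of sum 1 the inequality with
  \<open>\<beta>\<close> bounds the norm of the combination from below by the weighted mean of the
  gradient norms over \<open>\<beta>\<close>, and each of these norms is at least
  \<open>M1\<close>.\<close>

lemma active_gradients_hull_bound:
  fixes P :: "('n::finite, 'd::finite, 'm::finite, 's::finite) sweeping_problem"
  assumes "assumption_g P"
  shows "\<exists>\<delta>>0. \<forall>w\<in>Cset P. \<forall>h \<in> convex hull ((\<lambda>i. gradient (sweeping_problem.g P i) w) ` {i. sweeping_problem.g P i w = 0}).
    \<delta> \<le> norm h"
proof -
  let ?G = "\<lambda>i. gradient (sweeping_problem.g P i)"
  have "\<exists>M1>0. \<forall>i. \<forall>x\<in>Cset_i P i. M1 \<le> norm (?G i x)"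
    using assms unfolding assumption_g_def
  proof (elim conjE exE)
    fix c M1 M2 M3 :: real and V :: "'m \<Rightarrow> (real ^ 'n) set"
    assume "0 < M1" and "\<forall>i. open (V i) \<and> Cset_i P i \<subseteq> V i \<and>
             ennreal c < hausdorff_distance (Cset_i P i) (- V i) \<and>
             (\<forall>x\<in>V i. M1 \<le> norm (?G i x) \<and> norm (?G i x) \<le> M2 \<and>
                       onorm (hessian (sweeping_problem.g P i) x) \<le> M3)"
    then show ?thesis by (intro exI[of _ M1]) (meson subsetD)
  qed
  then obtain M1 where M1: "M1 > 0" "\<And>i x. x \<in> Cset_i P i \<Longrightarrow> M1 \<le> norm (?G i x)" by blast
  from assms have "\<exists>\<beta> \<rho>. 0 < \<beta> \<and> 0 < \<rho> \<and>
        (\<forall>x\<in>Cset P. \<forall>lam. (\<forall>i. 0 \<le> lam i) \<longrightarrow>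
           (\<Sum>i\<in>near_active P \<rho> x. lam i * norm (?G i x))
             \<le> \<beta> * norm (\<Sum>i\<in>near_active P \<rho> x. lam i *\<^sub>R ?G i x))"
    unfolding assumption_g_def by (rule conjunct2)
  then obtain \<beta> \<rho> where b: "\<beta> > 0" "\<rho> > 0" and ineq: "\<And>x lam. x \<in> Cset P \<Longrightarrow> (\<And>i. 0 \<le> lam i) \<Longrightarrow>
      (\<Sum>i\<in>near_active P \<rho> x. lam i * norm (?G i x)) \<le> \<beta> * norm (\<Sum>i\<in>near_active P \<rho> x. lam i *\<^sub>R ?G i x)"
    by (elim exE conjE) (rule that, assumption+, simp)
  have "M1 / \<beta> \<le> norm h"
    if w: "w \<in> Cset P" and h: "h \<in> convex hull ((\<lambda>i. ?G i w) ` {i. sweeping_problem.g P i w = 0})" for w h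
  proof -
    let ?N = "near_active P \<rho> w"
    \<comment> \<open>Weights are attached to constraints rather than to gradient vectors, since
      distinct constraints may share a gradient. Nearly active constraints that are not active get
      weight 0.\<close>
    define H where "H = {\<Sum>i\<in>?N. l i *\<^sub>R ?G i w | l. (\<forall>i. 0 \<le> l i) \<and> (\<Sum>i\<in>?N. l i) = (1::real)}"
    have "convex H"
    proof (rule convexI)
      fix x y and p q :: real assume "x \<in> H" "y \<in> H" and pq: "0 \<le> p" "0 \<le> q" "p + q = 1"
      then obtain l k where l: "x = (\<Sum>i\<in>?N. l i *\<^sub>R ?G i w)" "\<And>i. 0 \<le> l i" "(\<Sum>i\<in>?N. l i) = 1"
        and k: "y = (\<Sum>i\<in>?N. k i *\<^sub>R ?G i w)" "\<And>i. 0 \<le> k i" "(\<Sum>i\<in>?N. k i) = 1"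
        unfolding H_def by blast
      have "p *\<^sub>R x + q *\<^sub>R y = (\<Sum>i\<in>?N. (p * l i + q * k i) *\<^sub>R ?G i w)"
        unfolding l(1) k(1) scaleR_sum_right sum.distrib[symmetric] by (simp add: scaleR_add_left)
      moreover have "(\<Sum>i\<in>?N. p * l i + q * k i) = 1"
        unfolding sum.distrib sum_distrib_left[symmetric] l(3) k(3) using pq by simp
      moreover have "\<forall>i. 0 \<le> p * l i + q * k i" using l(2) k(2) pq by simp
      ultimately show "p *\<^sub>R x + q *\<^sub>R y \<in> H" unfolding H_def
        by (intro CollectI exI[of _ "\<lambda>i. p * l i + q * k i"] conjI)
    qed
    moreover have "(\<lambda>i. ?G i w) ` {i. sweeping_problem.g P i w = 0} \<subseteq> H"
    proof clarify
      fix j assume j: "sweeping_problem.g P j w = 0"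
      then have jN: "j \<in> ?N" using b by (simp add: near_active_def)
      have "?G j w = (\<Sum>i\<in>?N. (if i = j then 1 else 0) *\<^sub>R ?G i w)"
        by (simp add: if_distrib[of "\<lambda>r. r *\<^sub>R _"] jN cong: if_cong)
      moreover have "(\<Sum>i\<in>?N. (if i = j then 1 else (0::real))) = 1" by (simp add: jN)
      ultimately show "?G j w \<in> H" unfolding H_def
        by (intro CollectI exI[of _ "\<lambda>i. if i = j then 1 else 0"] conjI) auto
    qed
    ultimately have "h \<in> H" using h hull_minimal[of _ H convex] by blast
    then obtain l where l: "h = (\<Sum>i\<in>?N. l i *\<^sub>R ?G i w)" "\<And>i. 0 \<le> l i" "(\<Sum>i\<in>?N. l i) = 1"
      unfolding H_def by blast
    have "M1 = (\<Sum>i\<in>?N. l i * M1)" using l(3) by (simp flip: sum_distrib_right)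
    also have "\<dots> \<le> (\<Sum>i\<in>?N. l i * norm (?G i w))"
    proof (intro sum_mono mult_left_mono l(2))
      fix i show "M1 \<le> norm (?G i w)" using M1(2) w unfolding Cset_def by blast
    qed
    also have "\<dots> \<le> \<beta> * norm h" unfolding l(1) by (rule ineq[OF w l(2)])
    finally show ?thesis using b by (simp add: field_simps)
  qed
  then show ?thesis using M1(1) b(1) by (intro exI[of _ "M1 / \<beta>"]) auto
qed

text \<open>The direction \<open>z - w\<close> is only feasible at \<open>w\<close> up to second order; adding a multiple of order
  \<open>\<bar>z - w\<bar>\<^sup>2\<close> of a uniformly inward direction makes it strictly feasible.\<close>

lemma Cset_prox_regular:
  fixes P :: "('n::finite, 'd::finite, 'm::finite, 's::finite) sweeping_problem"
  assumes data: "problem_data P" and g: "assumption_g P"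
  shows "\<exists>K\<ge>0. \<forall>w\<in>Cset P. \<forall>z\<in>Cset P. \<forall>v\<in>limiting_normal_cone (Cset P) w.
     norm w \<le> R \<longrightarrow> norm z \<le> R \<longrightarrow> v \<bullet> (z - w) \<le> K * norm v * (norm (z - w))\<^sup>2"
proof -
  let ?g = "sweeping_problem.g P"
  let ?G = "\<lambda>i. gradient (sweeping_problem.g P i)"
  \<comment> \<open>One unit of room is left because the projections approximating \<open>w\<close>
    lie in the ball of radius \<open>R + 1\<close> only eventually, not in that of radius
    \<open>R\<close>.\<close>
  let ?B = "cball (0::real^'n) (R + 1)"
  have "\<exists>L\<ge>0. \<forall>x\<in>?B. \<forall>y\<in>?B. \<bar>?g i y - ?g i x - ?G i x \<bullet> (y - x)\<bar> \<le> L * (norm (y - x))\<^sup>2" for i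
    using data by (intro C2_fun_quadratic_bound) (auto simp: problem_data_def)
  then obtain L' where L': "\<And>i. L' i \<ge> 0" "\<And>i x y. x \<in> ?B \<Longrightarrow> y \<in> ?B \<Longrightarrow>
      \<bar>?g i y - ?g i x - ?G i x \<bullet> (y - x)\<bar> \<le> L' i * (norm (y - x))\<^sup>2"
    by metis
  define L where "L = (\<Sum>i\<in>UNIV. L' i)"
  have L: "L \<ge> 0" "\<And>i. L' i \<le> L" unfolding L_def using L'(1)
    by (auto intro: sum_nonneg member_le_sum)
  obtain \<delta> where d: "\<delta> > 0" and hull: "\<And>w h. w \<in> Cset P \<Longrightarrow> h \<in> convex hull ((\<lambda>i. ?G i w) ` {i. ?g i w = 0}) \<Longrightarrow> \<delta> \<le> norm h"
    using active_gradients_hull_bound[OF g] by blast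
  \<comment> \<open>With the correction \<open>(K * r) *\<^sub>R e\<close>, \<open>L\<close> pays
    for the second-order Taylor error and the extra 1 makes the direction strictly inward.\<close>
  define K where "K = (L + 1) / \<delta>"
  have K: "K \<ge> 0" using L d by (simp add: K_def)
  have prox: "(p - w) \<bullet> (z - w) \<le> K * norm (p - w) * (norm (z - w))\<^sup>2"
    if w: "w \<in> projection_set p (Cset P)" and z: "z \<in> Cset P" and B: "w \<in> ?B" "z \<in> ?B" for p w z
  proof (cases "z = w")
    case True then show ?thesis by simp
  next
    case False
    have wC: "w \<in> Cset P" using w by (simp add: projection_set_def)
    obtain e where e: "norm e \<le> 1" "\<And>i. ?g i w = 0 \<Longrightarrow> \<delta> \<le> ?G i w \<bullet> e"
      using min_norm_direction[of "(\<lambda>i. ?G i w) ` {i. ?g i w = 0}" \<delta>] d hull[OF wC] by auto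
    define r where "r = (norm (z - w))\<^sup>2"
    have r: "r > 0" using False by (simp add: r_def)
    have "(p - w) \<bullet> ((z - w) + (K * r) *\<^sub>R e) \<le> 0"
    proof (rule proximal_normal_interior_direction[OF data w])
      fix i assume act: "?g i w = 0"
      have "?g i z \<ge> 0" using z by (simp add: Cset_def Cset_i_def)
      moreover have "L' i * r \<le> L * r" using L(2) r by (intro mult_right_mono) auto
      ultimately have "?G i w \<bullet> (z - w) \<ge> - (L * r)"
        using L'(2)[OF B, of i] act unfolding r_def[symmetric] by linarith
      moreover have "(K * r) * \<delta> \<le> (K * r) * (?G i w \<bullet> e)" using e(2)[OF act] K r by (intro mult_left_mono) auto
      moreover have "(K * r) * \<delta> = L * r + r" using d by (simp add: K_def field_simps)
      ultimately show "0 < ?G i w \<bullet> (z - w + (K * r) *\<^sub>R e)"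
        using r by (simp add: inner_add_right)
    qed
    then have "(p - w) \<bullet> (z - w) \<le> (K * r) * - ((p - w) \<bullet> e)" by (simp add: inner_add_right)
    also have "\<dots> \<le> (K * r) * norm (p - w)"
    proof (rule mult_left_mono)
      have "- ((p - w) \<bullet> e) \<le> \<bar>(p - w) \<bullet> e\<bar>" by simp
      also have "\<dots> \<le> norm (p - w) * norm e" by (rule Cauchy_Schwarz_ineq2)
      also have "\<dots> \<le> norm (p - w)" using e(1) by (simp add: mult_left_le)
      finally show "- ((p - w) \<bullet> e) \<le> norm (p - w)" .
    qed (use K r in auto)
    finally show ?thesis by (simp add: r_def mult.commute mult.left_commute)
  qed
  \<comment> \<open>The proximal inequality is positively homogeneous in the normal and its constant
    does not depend on the base point, so it passes to the limits that define the limiting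
    cone.\<close>
  have "v \<bullet> (z - w) \<le> K * norm v * (norm (z - w))\<^sup>2"
    if w: "w \<in> Cset P" and z: "z \<in> Cset P" and v: "v \<in> limiting_normal_cone (Cset P) w"
      and R: "norm w \<le> R" "norm z \<le> R" for v z w
  proof -
    from v w obtain x w' and \<alpha> :: "nat \<Rightarrow> real" where x: "x \<longlonglongrightarrow> w" and w': "\<And>k. w' k \<in> projection_set (x k) (Cset P)"
      and al: "\<And>k. 0 \<le> \<alpha> k" and lim: "(\<lambda>k. \<alpha> k *\<^sub>R (x k - w' k)) \<longlonglongrightarrow> v"
      unfolding limiting_normal_cone_def by auto
    have "(\<lambda>k. x k - w' k) \<longlonglongrightarrow> 0"
    proof (rule Lim_null_comparison)
      show "(\<lambda>k. norm (x k - w)) \<longlonglongrightarrow> 0" using x LIM_zero tendsto_norm_zero by blast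
      show "\<forall>\<^sub>F k in sequentially. norm (x k - w' k) \<le> norm (x k - w)"
        using w' w by (auto simp: projection_set_def dist_norm)
    qed
    from tendsto_diff[OF x this] have w'w: "w' \<longlonglongrightarrow> w" by simp
    have ev: "\<forall>\<^sub>F k in sequentially. norm (w' k) < R + 1"
      using order_tendstoD(2)[OF tendsto_norm[OF w'w], of "R + 1"] R by simp
    show ?thesis
    proof (rule tendsto_le[OF sequentially_bot])
      show "(\<lambda>k. (\<alpha> k *\<^sub>R (x k - w' k)) \<bullet> (z - w' k)) \<longlonglongrightarrow> v \<bullet> (z - w)"
        by (intro tendsto_intros lim w'w)
      show "(\<lambda>k. K * norm (\<alpha> k *\<^sub>R (x k - w' k)) * (norm (z - w' k))\<^sup>2) \<longlonglongrightarrow> K * norm v * (norm (z - w))\<^sup>2"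
        by (intro tendsto_intros lim w'w)
      show "\<forall>\<^sub>F k in sequentially. (\<alpha> k *\<^sub>R (x k - w' k)) \<bullet> (z - w' k)
          \<le> K * norm (\<alpha> k *\<^sub>R (x k - w' k)) * (norm (z - w' k))\<^sup>2"
        using ev
      proof eventually_elim
        case (elim k)
        have "(x k - w' k) \<bullet> (z - w' k) \<le> K * norm (x k - w' k) * (norm (z - w' k))\<^sup>2"
          by (rule prox[OF w' z]) (use elim R in auto)
        from mult_left_mono[OF this al[of k]] show ?case using al[of k]
          by (simp add: mult.assoc mult.left_commute)
      qed
    qed
  qed
  with K show ?thesis by blast
qed

section \<open>Functions in \<open>W\<^sup>1\<^sup>,\<^sup>2\<close>\<close>

lemma AE_lebesgue_on_iff:
  assumes "S \<in> sets lebesgue"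
  shows "(AE t in lebesgue_on S. P t) \<longleftrightarrow> (AE t in lebesgue. t \<in> S \<longrightarrow> P t)"
  using assms by (intro AE_restrict_space_iff) simp

lemma AE_lebesgue_on_not_negligible:
  assumes "S \<in> sets lebesgue" "negligible N"
  shows "AE t in lebesgue_on S. t \<in> S \<and> t \<notin> N"
proof -
  have "AE t in lebesgue. t \<notin> N"
    using AE_not_in[of N lebesgue] assms(2) by (simp add: negligible_iff_null_sets)
  then show ?thesis unfolding AE_lebesgue_on_iff[OF assms(1)] by eventually_elim simp
qed

lemma AE_lebesgue_on_subset:
  assumes "S \<in> sets lebesgue" "S' \<in> sets lebesgue" "S' \<subseteq> S" "AE t in lebesgue_on S. P t"
  shows "AE t in lebesgue_on S'. P t"
  using assms(4) unfolding AE_lebesgue_on_iff[OF assms(1)] AE_lebesgue_on_iff[OF assms(2)]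
  by eventually_elim (use assms(3) in blast)

lemma AE_lebesgue_on_imp_negligible:
  assumes "S \<in> sets lebesgue" "AE t in lebesgue_on S. P t"
  shows "negligible {t. \<not> (t \<in> S \<longrightarrow> P t)}"
  using assms(2) unfolding AE_lebesgue_on_iff[OF assms(1)]
  by (simp add: completion.AE_iff_null_sets negligible_iff_null_sets)

lemma borel_measurable_lebesgue_on_AE:
  fixes h k :: "'a::euclidean_space \<Rightarrow> 'b::euclidean_space"
  assumes S: "S \<in> sets lebesgue" and h: "h \<in> borel_measurable (lebesgue_on S)"
    and ae: "AE t in lebesgue_on S. h t = k t"
  shows "k \<in> borel_measurable (lebesgue_on S)"
proof -
  have S': "S \<inter> space lebesgue \<in> sets lebesgue" using S by simp
  have "(\<lambda>t. indicator S t *\<^sub>R h t) \<in> borel_measurable lebesgue"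
    using h by (simp only: borel_measurable_restrict_space_iff[OF S'])
  moreover have "AE t in lebesgue. indicator S t *\<^sub>R h t = indicator S t *\<^sub>R k t"
    using ae unfolding AE_lebesgue_on_iff[OF S] by eventually_elim (auto simp: indicator_def)
  ultimately show ?thesis
    unfolding borel_measurable_restrict_space_iff[OF S'] by (rule borel_measurable_AE)
qed

abbreviation L2_sq :: "real \<Rightarrow> (real \<Rightarrow> 'a::euclidean_space) \<Rightarrow> real" where
  "L2_sq T v \<equiv> \<integral>t. (norm (v t))\<^sup>2 \<partial>lebesgue_on {0..T}"

lemma L2_on_integrable:
  assumes "L2_on T v"
  shows "integrable (lebesgue_on {0..T}) v"
proof -
  interpret finite_measure "lebesgue_on {0..T}" by (rule finite_measure_lebesgue_on) simp
  have [measurable]: "v \<in> borel_measurable (lebesgue_on {0..T})" using assms by (simp add: L2_on_def)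
  have "integrable (lebesgue_on {0..T}) (\<lambda>t. norm (v t))"
    by (rule square_integrable_imp_integrable) (use assms in \<open>auto simp: L2_on_def\<close>)
  then show ?thesis by (simp add: integrable_norm_iff)
qed

lemma L2_on_integrable_on:
  assumes "L2_on T v" "0 \<le> s" "t \<le> T"
  shows "v integrable_on {s..t}"
proof -
  have "v integrable_on {0..T}" using L2_on_integrable[OF assms(1)] by (rule integrable_on_lebesgue_on) simp
  then show ?thesis by (rule integrable_subinterval_real) (use assms in auto)
qed

lemma L2_on_AE_cong:
  assumes "L2_on T v" "AE t in lebesgue_on {0..T}. v t = w t"
  shows "L2_on T w"
proof -
  have [measurable]: "w \<in> borel_measurable (lebesgue_on {0..T})"
    by (rule borel_measurable_lebesgue_on_AE[OF _ _ assms(2)]) (use assms in \<open>auto simp: L2_on_def\<close>)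
  moreover have "integrable (lebesgue_on {0..T}) (\<lambda>t. (norm (w t))\<^sup>2)"
    by (rule integrable_cong_AE_imp[where g = "\<lambda>t. (norm (v t))\<^sup>2"]) (use assms in \<open>auto simp: L2_on_def elim!: eventually_mono\<close>)
  ultimately show ?thesis by (simp add: L2_on_def)
qed

text \<open>\<open>velocity\<close> is a two-sided derivative and \<open>x\<close> is arbitrary
  outside \<open>[0, T]\<close>, so the endpoints join the null set where differentiation of the
  integral may fail.\<close>

lemma velocity_eq_density:
  fixes x :: "real \<Rightarrow> 'a::euclidean_space"
  assumes v: "L2_on T v" "\<And>t. t \<in> {0..T} \<Longrightarrow> x t = x 0 + integral {0..t} v"
  shows "AE t in lebesgue_on {0..T}. 0 < t \<and> t < T \<and> (x has_vector_derivative v t) (at t) \<and> velocity x t = v t"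
proof -
  define N where "N = insert 0 (insert T {t\<in>{0<..<T}. \<not> ((\<lambda>s. integral {0..s} v) has_vector_derivative v t) (at t)})"
  have "negligible {t\<in>{0<..<T}. \<not> ((\<lambda>s. integral {0..s} v) has_vector_derivative v t) (at t)}"
    by (intro negligible_indefinite_integral_not_differentiable L2_on_integrable_on[OF v(1)]) auto
  then have "negligible N" unfolding N_def by (simp only: negligible_insert)
  then have "AE t in lebesgue_on {0..T}. t \<in> {0..T} \<and> t \<notin> N"
    by (intro AE_lebesgue_on_not_negligible) simp
  then show ?thesis
  proof eventually_elim
    case (elim t)
    then have t: "0 < t" "t < T" "((\<lambda>s. integral {0..s} v) has_vector_derivative v t) (at t)"
      by (auto simp: N_def less_le)
    from t(3) have d: "((\<lambda>s. x 0 + integral {0..s} v) has_vector_derivative v t) (at t)"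
      using has_vector_derivative_add[OF has_vector_derivative_const] by fastforce
    have "(x has_vector_derivative v t) (at t)"
    proof (rule has_vector_derivative_transform_within_open[OF d, of "{0<..<T}"])
      show "x 0 + integral {0..y} v = x y" if "y \<in> {0<..<T}" for y
        by (rule v(2)[symmetric]) (use that in simp)
    qed (use t in auto)
    then show ?case using t by (simp add: velocity_def vector_derivative_at)
  qed
qed

text \<open>Replaces the unspecified density by the canonical representative
  \<open>velocity x\<close>, so that later arguments need not carry a density along.\<close>

lemma W12_on_velocity:
  fixes x :: "real \<Rightarrow> 'a::euclidean_space"
  assumes "W12_on T x"
  shows "AE t in lebesgue_on {0..T}. 0 < t \<and> t < T \<and> (x has_vector_derivative velocity x t) (at t)"
    and "L2_on T (velocity x)"
    and "\<And>t. t \<in> {0..T} \<Longrightarrow> x t = x 0 + integral {0..t} (velocity x)"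
proof -
  obtain v where v: "L2_on T v" "\<And>t. t \<in> {0..T} \<Longrightarrow> x t = x 0 + integral {0..t} v"
    using assms unfolding W12_on_def by blast
  have ae: "AE t in lebesgue_on {0..T}. 0 < t \<and> t < T \<and> (x has_vector_derivative v t) (at t) \<and> velocity x t = v t"
    by (rule velocity_eq_density[OF v(1)]) (rule v(2))
  show "AE t in lebesgue_on {0..T}. 0 < t \<and> t < T \<and> (x has_vector_derivative velocity x t) (at t)"
    using ae by eventually_elim simp
  show "L2_on T (velocity x)"
  proof (rule L2_on_AE_cong[OF v(1)])
    show "AE t in lebesgue_on {0..T}. v t = velocity x t" using ae by eventually_elim simp
  qed
  show "x t = x 0 + integral {0..t} (velocity x)" if t: "t \<in> {0..T}" for t
  proof -
    have "AE s in lebesgue_on {0..T}. velocity x s = v s" using ae by eventually_elim simp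
    then have neg: "negligible {s. \<not> (s \<in> {0..T} \<longrightarrow> velocity x s = v s)}"
      by (rule AE_lebesgue_on_imp_negligible[rotated]) simp
    have "integral {0..t} (velocity x) = integral {0..t} v"
      by (rule integral_spike[OF neg]) (use t in auto)
    then show ?thesis by (simp only: v(2)[OF t])
  qed
qed

lemma W12_on_continuous:
  assumes "W12_on T x"
  shows "continuous_on {0..T} x"
proof -
  have "continuous_on {0..T} (\<lambda>t. x 0 + integral {0..t} (velocity x))"
    by (intro continuous_intros indefinite_integral_continuous_1 L2_on_integrable_on[OF W12_on_velocity(2)[OF assms]]) auto
  then show ?thesis by (rule continuous_on_eq) (rule W12_on_velocity(3)[OF assms, symmetric])
qed

section \<open>Extension from \<open>[0, T]\<close> to a longer interval\<close>

lemma restrict_lebesgue_on: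
  fixes h :: "real \<Rightarrow> 'a::euclidean_space"
  assumes "T \<le> S"
  shows "integrable (lebesgue_on {0..S}) (\<lambda>t. if t \<le> T then h t else 0) \<longleftrightarrow> integrable (lebesgue_on {0..T}) h"
    and "(\<integral>t. (if t \<le> T then h t else 0) \<partial>lebesgue_on {0..S}) = (\<integral>t. h t \<partial>lebesgue_on {0..T})"
    and "(\<lambda>t. if t \<le> T then h t else 0) \<in> borel_measurable (lebesgue_on {0..S}) \<longleftrightarrow> h \<in> borel_measurable (lebesgue_on {0..T})"
proof -
  have eq: "(\<lambda>t. indicat_real {0..S} t *\<^sub>R (if t \<le> T then h t else 0)) = (\<lambda>t. indicat_real {0..T} t *\<^sub>R h t)"
    using assms by (auto simp: fun_eq_iff indicator_def)
  have S: "{0..S} \<inter> space lebesgue \<in> sets lebesgue" "{0..T} \<inter> space lebesgue \<in> sets lebesgue" by auto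
  show "integrable (lebesgue_on {0..S}) (\<lambda>t. if t \<le> T then h t else 0) \<longleftrightarrow> integrable (lebesgue_on {0..T}) h"
    unfolding integrable_restrict_space[OF S(1)] integrable_restrict_space[OF S(2)] eq ..
  show "(\<integral>t. (if t \<le> T then h t else 0) \<partial>lebesgue_on {0..S}) = (\<integral>t. h t \<partial>lebesgue_on {0..T})"
    unfolding integral_restrict_space[OF S(1)] integral_restrict_space[OF S(2)] eq ..
  show "(\<lambda>t. if t \<le> T then h t else 0) \<in> borel_measurable (lebesgue_on {0..S}) \<longleftrightarrow> h \<in> borel_measurable (lebesgue_on {0..T})"
    unfolding borel_measurable_restrict_space_iff[OF S(1)] borel_measurable_restrict_space_iff[OF S(2)] eq ..
qed

lemma L2_on_extend:
  assumes "L2_on T v" "T \<le> S"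
  shows "L2_on S (\<lambda>t. if t \<le> T then v t else 0)"
    and "(\<integral>t. (norm (if t \<le> T then v t else 0))\<^sup>2 \<partial>lebesgue_on {0..S}) = (\<integral>t. (norm (v t))\<^sup>2 \<partial>lebesgue_on {0..T})"
proof -
  have eq: "(\<lambda>t. (norm (if t \<le> T then v t else 0))\<^sup>2) = (\<lambda>t. if t \<le> T then (norm (v t))\<^sup>2 else 0)"
    by auto
  show "L2_on S (\<lambda>t. if t \<le> T then v t else 0)"
    using assms(1) unfolding L2_on_def eq restrict_lebesgue_on[OF assms(2)] .
  show "(\<integral>t. (norm (if t \<le> T then v t else 0))\<^sup>2 \<partial>lebesgue_on {0..S}) = (\<integral>t. (norm (v t))\<^sup>2 \<partial>lebesgue_on {0..T})"
    unfolding eq restrict_lebesgue_on[OF assms(2)] ..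
qed

lemma const_ext_eq_integral:
  fixes x :: "real \<Rightarrow> 'a::euclidean_space"
  assumes x: "W12_on T x" and T: "0 \<le> T" "0 \<le> t"
  shows "const_ext T x t = x 0 + integral {0..t} (\<lambda>s. if s \<le> T then velocity x s else 0)"
proof (cases "t \<le> T")
  case True
  have "integral {0..t} (\<lambda>s. if s \<le> T then velocity x s else 0) = integral {0..t} (velocity x)"
    using True by (intro Henstock_Kurzweil_Integration.integral_cong) auto
  moreover have "x t = x 0 + integral {0..t} (velocity x)" using True T by (intro W12_on_velocity(3)[OF x]) simp
  ultimately show ?thesis using True by (simp add: const_ext_def)
next
  case False
  let ?p = "\<lambda>s. if s \<le> T then velocity x s else 0"
  have "?p integrable_on {0..t}"
    by (rule L2_on_integrable_on[OF L2_on_extend(1)[OF W12_on_velocity(2)[OF x], of t]]) (use False in auto)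
  then have "integral {0..t} ?p = integral {0..T} ?p + integral {T..t} ?p"
    by (rule Henstock_Kurzweil_Integration.integral_combine[symmetric, rotated 2]) (use False T in auto)
  also have "integral {0..T} ?p = integral {0..T} (velocity x)"
    by (intro Henstock_Kurzweil_Integration.integral_cong) auto
  also have "integral {T..t} ?p = integral {T..t} (\<lambda>s. 0)"
    by (rule integral_spike[of "{T}"]) auto
  finally have "integral {0..t} ?p = integral {0..T} (velocity x)" by simp
  moreover have "x T = x 0 + integral {0..T} (velocity x)" using T by (intro W12_on_velocity(3)[OF x]) simp
  ultimately show ?thesis using False by (simp add: const_ext_def)
qed

text \<open>Differentiability is not assumed: both functions have the same derivatives at
  \<open>t\<close>, so the choice operator in \<open>vector_derivative\<close> returns the same
  value even where there is none.\<close>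

lemma velocity_const_ext:
  assumes "t < T"
  shows "velocity (const_ext T x) t = velocity x t"
  unfolding velocity_def vector_derivative_def
proof (rule arg_cong[where f=Eps], rule ext, rule iffI)
  fix D assume "(const_ext T x has_vector_derivative D) (at t)"
  then show "(x has_vector_derivative D) (at t)"
    by (rule has_vector_derivative_transform_within_open[of _ _ _ "{..<T}"]) (use assms in \<open>auto simp: const_ext_def\<close>)
next
  fix D assume "(x has_vector_derivative D) (at t)"
  then show "(const_ext T x has_vector_derivative D) (at t)"
    by (rule has_vector_derivative_transform_within_open[of _ _ _ "{..<T}"]) (use assms in \<open>auto simp: const_ext_def\<close>)
qed

lemma W12_norm_const_ext_bounds:
  fixes x :: "real \<Rightarrow> 'a::euclidean_space"
  assumes x: "W12_on T x" and T: "0 \<le> T" "T \<le> S" and K: "W12_norm S (const_ext T x) \<le> K"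
  shows "L2_sq T (velocity x) \<le> K\<^sup>2"
    and "L2_sq S (const_ext T x) \<le> K\<^sup>2"
proof -
  let ?p = "\<lambda>s. if s \<le> T then velocity x s else 0"
  \<comment> \<open>At \<open>T\<close> itself the extension may have a corner, so that point is
    left out.\<close>
  have *: "velocity (const_ext T x) t = ?p t" if t: "0 < t" "t \<noteq> T" for t
  proof (cases "t < T")
    case True
    then have "velocity (const_ext T x) t = velocity x t" by (rule velocity_const_ext)
    then show ?thesis using True by simp
  next
    case False
    have "(const_ext T x has_vector_derivative 0) (at t)"
      by (rule has_vector_derivative_transform_within_open[of "\<lambda>_. x T" _ _ "{T<..}"]) (use False t in \<open>auto simp: const_ext_def\<close>)
    then show ?thesis using False t by (simp add: velocity_def vector_derivative_at)
  qed
  have vel: "AE t in lebesgue_on {0..S}. velocity (const_ext T x) t = ?p t"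
  proof -
    have "AE t in lebesgue_on {0..S}. t \<in> {0..S} \<and> t \<notin> {0, T}"
      by (rule AE_lebesgue_on_not_negligible) auto
    then show ?thesis by eventually_elim (rule *, auto)
  qed
  have p: "L2_on S ?p" by (rule L2_on_extend[OF W12_on_velocity(2)[OF x] T(2)])
  have "AE t in lebesgue_on {0..S}. ?p t = velocity (const_ext T x) t" using vel by eventually_elim simp
  from L2_on_AE_cong[OF p this] have m: "velocity (const_ext T x) \<in> borel_measurable (lebesgue_on {0..S})"
    by (simp add: L2_on_def)
  have "L2_sq S (velocity (const_ext T x)) = L2_sq S ?p"
  proof (rule integral_cong_AE)
    show "AE t in lebesgue_on {0..S}. (norm (velocity (const_ext T x) t))\<^sup>2 = (norm (?p t))\<^sup>2"
      using vel by eventually_elim simp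
  qed (use m p in \<open>auto simp: L2_on_def\<close>)
  also have "\<dots> = L2_sq T (velocity x)"
    by (rule L2_on_extend[OF W12_on_velocity(2)[OF x] T(2)])
  finally have eq: "L2_sq S (velocity (const_ext T x)) = L2_sq T (velocity x)" .
  let ?A = "\<integral>t. (norm (const_ext T x t))\<^sup>2 \<partial>lebesgue_on {0..S}" and ?B = "\<integral>t. (norm (velocity x t))\<^sup>2 \<partial>lebesgue_on {0..T}"
  have nn: "?A \<ge> 0" "?B \<ge> 0" by auto
  have "sqrt (?A + ?B) \<le> K" using K unfolding W12_norm_def eq .
  then have "?A + ?B \<le> K\<^sup>2" using nn by (metis add_nonneg_nonneg real_sqrt_ge_zero power_mono real_sqrt_pow2)
  with nn show "?B \<le> K\<^sup>2" "?A \<le> K\<^sup>2" by linarith+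
qed

section \<open>Integral inequalities\<close>

text \<open>Young's inequality with a free weight. Integrating it and then choosing \<open>c\<close>
  takes the place of the Cauchy-Schwarz inequality for integrals.\<close>

lemma le_quadratic_AM_GM:
  assumes "0 < (c::real)"
  shows "y \<le> (c / 2) * y\<^sup>2 + 1 / (2 * c)"
proof -
  have "0 \<le> (c * y - 1)\<^sup>2" by simp
  then have "2 * (c * y) \<le> c * c * y\<^sup>2 + 1" by (simp add: power2_eq_square algebra_simps)
  then show ?thesis using assms by (simp add: field_simps power2_eq_square)
qed

lemma L2_integral_increment_bound:
  fixes p :: "real \<Rightarrow> 'a::euclidean_space"
  assumes p: "L2_on S p" and K: "L2_sq S p \<le> K\<^sup>2" "K > 0"
    and st: "0 \<le> s" "s \<le> t" "t \<le> S"
  shows "(\<lambda>r. norm (p r)) integrable_on {s..t}"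
    and "integral {s..t} (\<lambda>r. norm (p r)) \<le> K * sqrt (t - s)"
    and "norm (integral {0..t} p - integral {0..s} p) \<le> K * sqrt (t - s)"
proof -
  have i1: "(\<lambda>r. norm (p r)) integrable_on {0..S}"
    by (rule integrable_on_lebesgue_on) (use L2_on_integrable[OF p] in auto)
  then show int: "(\<lambda>r. norm (p r)) integrable_on {s..t}"
    by (rule integrable_subinterval_real) (use st in auto)
  have i2: "integrable (lebesgue_on {0..S}) (\<lambda>r. (norm (p r))\<^sup>2)" using p by (simp add: L2_on_def)
  have i3: "(\<lambda>r. (norm (p r))\<^sup>2) integrable_on {0..S}"
    by (rule integrable_on_lebesgue_on[OF i2]) simp
  then have i4: "(\<lambda>r. (norm (p r))\<^sup>2) integrable_on {s..t}"
    by (rule integrable_subinterval_real) (use st in auto)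
  have "integral {s..t} (\<lambda>r. (norm (p r))\<^sup>2) \<le> integral {0..S} (\<lambda>r. (norm (p r))\<^sup>2)"
    by (rule integral_subset_le[OF _ i4 i3]) (use st in auto)
  also have "\<dots> \<le> K\<^sup>2" using K(1) lebesgue_integral_eq_integral[OF i2] by simp
  finally have sq: "integral {s..t} (\<lambda>r. (norm (p r))\<^sup>2) \<le> K\<^sup>2" .
  show le: "integral {s..t} (\<lambda>r. norm (p r)) \<le> K * sqrt (t - s)"
  proof (cases "s = t")
    case True then show ?thesis by simp
  next
    case False
    \<comment> \<open>This weight balances the two integrated terms: each becomes at most
      \<open>K * sqrt (t - s) / 2\<close>.\<close>
    define c where "c = sqrt (t - s) / K"
    have c: "c > 0" using False st K by (simp add: c_def)
    have "norm (p r) \<le> (c / 2) * (norm (p r))\<^sup>2 + 1 / (2 * c)" for r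
      by (rule le_quadratic_AM_GM[OF c])
    note pw = this
    have "((\<lambda>r. (c / 2) * (norm (p r))\<^sup>2 + 1 / (2 * c)) has_integral
        (c / 2) * integral {s..t} (\<lambda>r. (norm (p r))\<^sup>2) + (t - s) *\<^sub>R (1 / (2 * c))) {s..t}"
      using has_integral_add[OF has_integral_mult_right[OF integrable_integral[OF i4]] has_integral_const_real, of "c / 2" "1 / (2 * c)"]
        st by simp
    from has_integral_le[OF integrable_integral[OF int] this pw]
    have "integral {s..t} (\<lambda>r. norm (p r)) \<le> (c / 2) * integral {s..t} (\<lambda>r. (norm (p r))\<^sup>2) + (t - s) / (2 * c)"
      by simp
    also have "\<dots> \<le> (c / 2) * K\<^sup>2 + (t - s) / (2 * c)" using sq c by (intro add_right_mono mult_left_mono) auto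
    also have "\<dots> = K * sqrt (t - s)"
    proof -
      define \<sigma> where "\<sigma> = sqrt (t - s)"
      have s2: "t - s = \<sigma> * \<sigma>" "\<sigma> > 0" using st False by (auto simp: \<sigma>_def)
      have "(\<sigma> * \<sigma>) / (2 * (\<sigma> / K)) = K * \<sigma> / 2" using s2(2) K(2) by (simp add: field_simps)
      moreover have "(\<sigma> / K / 2) * K\<^sup>2 = K * \<sigma> / 2" using K(2) by (simp add: power2_eq_square)
      ultimately show ?thesis unfolding c_def \<sigma>_def[symmetric] unfolding s2(1) by simp
    qed
    finally show ?thesis .
  qed
  have pi: "p integrable_on {0..t}" "p integrable_on {s..t}" using L2_on_integrable_on[OF p] st by auto
  have "integral {0..t} p - integral {0..s} p = integral {s..t} p"
    using Henstock_Kurzweil_Integration.integral_combine[OF st(1,2) pi(1)] by (simp add: algebra_simps)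
  moreover have "norm (integral {s..t} p) \<le> integral {s..t} (\<lambda>r. norm (p r))"
    by (rule integral_norm_bound_integral[OF pi(2) int]) simp
  ultimately show "norm (integral {0..t} p - integral {0..s} p) \<le> K * sqrt (t - s)" using le by simp
qed

lemma integral_gronwall:
  fixes \<phi> :: "real \<Rightarrow> real"
  assumes cont: "continuous_on {0..T} \<phi>" and B: "B \<ge> 0"
    and le: "\<And>t. t \<in> {0..T} \<Longrightarrow> \<phi> t \<le> C + B * integral {0..t} \<phi>" and t: "t \<in> {0..T}"
  shows "\<phi> t \<le> C * exp (B * t)"
proof -
  \<comment> \<open>The integrating factor: the derivative of \<open>G\<close> carries the factor
    \<open>\<phi> s - (C + B * integral {0..s} \<phi>)\<close>, which the hypothesis makes
    nonpositive, and \<open>G 0 = C\<close>.\<close>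
  define G where "G s = exp (- (B * s)) * (C + B * integral {0..s} \<phi>)" for s
  have int: "\<phi> integrable_on {0..T}" by (rule integrable_continuous_real[OF cont])
  have "G t \<le> G 0"
  proof (rule DERIV_nonpos_imp_decreasing_open[of 0 t G])
    show "0 \<le> t" using t by simp
    have "continuous_on {0..t} (\<lambda>s. integral {0..s} \<phi>)"
      by (rule indefinite_integral_continuous_1) (use t int in \<open>auto intro: integrable_subinterval_real\<close>)
    then show "continuous_on {0..t} G" unfolding G_def by (intro continuous_intros)
    fix s assume s: "0 < s" "s < t"
    then have sT: "s \<in> {0<..<T}" using t by auto
    have "((\<lambda>u. integral {0..u} \<phi>) has_vector_derivative \<phi> s) (at s within {0..T})"
      by (rule integral_has_vector_derivative[OF cont]) (use sT in auto)
    then have "((\<lambda>u. integral {0..u} \<phi>) has_vector_derivative \<phi> s) (at s within {0<..<T})"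
      by (rule has_vector_derivative_within_subset) auto
    then have d: "((\<lambda>u. integral {0..u} \<phi>) has_real_derivative \<phi> s) (at s)"
      unfolding at_within_open[OF sT open_greaterThanLessThan] has_real_derivative_iff_has_vector_derivative .
    have "(G has_real_derivative exp (- (B * s)) * (B * (\<phi> s - (C + B * integral {0..s} \<phi>)))) (at s)"
      unfolding G_def by (auto intro!: derivative_eq_intros d simp: algebra_simps)
    moreover have "exp (- (B * s)) * (B * (\<phi> s - (C + B * integral {0..s} \<phi>))) \<le> 0"
      using le[of s] sT B by (intro mult_nonneg_nonpos) auto
    ultimately show "\<exists>y. DERIV G s :> y \<and> y \<le> 0" by (intro exI conjI)
  qed
  then have "exp (- (B * t)) * (C + B * integral {0..t} \<phi>) \<le> C" by (simp add: G_def)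
  then have "C + B * integral {0..t} \<phi> \<le> C * exp (B * t)" by (simp add: exp_minus field_simps)
  with le[OF t] show ?thesis by linarith
qed

section \<open>Convergence of convex combinations in \<open>L\<^sup>2\<close>\<close>

lemma fatou_bound:
  fixes h :: "nat \<Rightarrow> 'a \<Rightarrow> real"
  assumes int: "\<And>n. integrable M (h n)" and nn: "\<And>n t. 0 \<le> h n t"
    and m: "k \<in> borel_measurable M" and lim: "AE t in M. (\<lambda>n. h n t) \<longlonglongrightarrow> k t"
    and B: "\<forall>\<^sub>F n in sequentially. (\<integral>t. h n t \<partial>M) \<le> B"
  shows "integrable M k" "(\<integral>t. k t \<partial>M) \<le> B"
proof -
  have [measurable]: "h n \<in> borel_measurable M" for n using int by auto
  have knn: "AE t in M. 0 \<le> k t"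
    using lim by eventually_elim (auto intro: LIMSEQ_le_const nn)
  obtain n where "(\<integral>t. h n t \<partial>M) \<le> B" using eventually_happens[OF B] by auto
  moreover have "0 \<le> (\<integral>t. h n t \<partial>M)" using nn by (simp add: integral_nonneg_AE)
  ultimately have B0: "0 \<le> B" by linarith
  have "(\<integral>\<^sup>+t. ennreal (k t) \<partial>M) = (\<integral>\<^sup>+t. liminf (\<lambda>n. ennreal (h n t)) \<partial>M)"
  proof (rule nn_integral_cong_AE)
    show "AE t in M. ennreal (k t) = liminf (\<lambda>n. ennreal (h n t))"
      using lim by eventually_elim (auto intro!: lim_imp_Liminf[symmetric])
  qed
  also have "\<dots> \<le> liminf (\<lambda>n. \<integral>\<^sup>+t. ennreal (h n t) \<partial>M)"
    by (rule nn_integral_liminf) measurable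
  also have "\<dots> = liminf (\<lambda>n. ennreal (\<integral>t. h n t \<partial>M))"
    by (simp add: nn_integral_eq_integral[OF int] nn)
  also have "\<dots> \<le> limsup (\<lambda>n. ennreal (\<integral>t. h n t \<partial>M))" by (rule Liminf_le_Limsup) simp
  also have "\<dots> \<le> ennreal B"
    by (rule Limsup_bounded) (use B in \<open>auto elim!: eventually_mono intro!: ennreal_leI\<close>)
  finally have le: "(\<integral>\<^sup>+t. ennreal (k t) \<partial>M) \<le> ennreal B" .
  show ik: "integrable M k"
    by (rule integrableI_nonneg[OF m knn]) (use le in \<open>auto simp: le_less_trans\<close>)
  show "(\<integral>t. k t \<partial>M) \<le> B"
    using le nn_integral_eq_integral[OF ik knn] B0 by simp
qed

lemma L2_on_add:
  fixes v w :: "real \<Rightarrow> 'a::euclidean_space"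
  assumes "L2_on S v" "L2_on S w"
  shows "L2_on S (\<lambda>t. v t + w t)"
proof -
  have [measurable]: "v \<in> borel_measurable (lebesgue_on {0..S})" "w \<in> borel_measurable (lebesgue_on {0..S})"
    using assms by (auto simp: L2_on_def)
  have "integrable (lebesgue_on {0..S}) (\<lambda>t. (norm (v t + w t))\<^sup>2)"
  proof (rule Bochner_Integration.integrable_bound)
    show "integrable (lebesgue_on {0..S}) (\<lambda>t. 2 * (norm (v t))\<^sup>2 + 2 * (norm (w t))\<^sup>2)"
      using assms by (simp add: L2_on_def)
    have "(norm (v t + w t))\<^sup>2 \<le> 2 * (norm (v t))\<^sup>2 + 2 * (norm (w t))\<^sup>2" for t
    proof -
      have "(norm (v t + w t))\<^sup>2 \<le> (norm (v t) + norm (w t))\<^sup>2"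
        by (intro power_mono norm_triangle_ineq norm_ge_zero)
      moreover have "0 \<le> (norm (v t) - norm (w t))\<^sup>2" by simp
      ultimately show ?thesis by (simp add: power2_eq_square algebra_simps)
    qed
    then show "AE t in lebesgue_on {0..S}. norm ((norm (v t + w t))\<^sup>2) \<le> norm (2 * (norm (v t))\<^sup>2 + 2 * (norm (w t))\<^sup>2)"
      by (intro AE_I2) (simp add: abs_of_nonneg)
  qed measurable
  then show ?thesis by (simp add: L2_on_def)
qed

lemma L2_on_scaleR:
  fixes v :: "real \<Rightarrow> 'a::euclidean_space"
  assumes "L2_on S v"
  shows "L2_on S (\<lambda>t. c *\<^sub>R v t)"
  using assms by (auto simp: L2_on_def power_mult_distrib)

lemma L2_on_sum:
  fixes v :: "'i \<Rightarrow> real \<Rightarrow> 'a::euclidean_space"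
  assumes "\<And>i. i \<in> I \<Longrightarrow> L2_on S (v i)"
  shows "L2_on S (\<lambda>t. \<Sum>i\<in>I. v i t)"
proof (cases "finite I")
  case True
  then show ?thesis using assms
  proof (induction I)
    case empty then show ?case by (simp add: L2_on_def)
  next
    case (insert i I) then show ?case by (simp add: L2_on_add)
  qed
next
  case False then show ?thesis by (simp add: L2_on_def)
qed

text \<open>Convex weights supported in the window from \<open>n\<close> to \<open>N\<close>, as in
  Mazur's lemma. Since the lower end moves to infinity with \<open>n\<close>, such averages keep the
  limit of any convergent sequence.\<close>

definition tail_weights :: "nat \<Rightarrow> nat \<Rightarrow> (nat \<Rightarrow> real) \<Rightarrow> bool" where
  "tail_weights n N \<theta> \<longleftrightarrow> (\<forall>k. 0 \<le> \<theta> k) \<and> (\<forall>k. k < n \<or> N < k \<longrightarrow> \<theta> k = 0) \<and> (\<Sum>k\<le>N. \<theta> k) = 1"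

lemma tail_weights_sum_tendsto:
  fixes c :: "nat \<Rightarrow> 'a::real_normed_vector"
  assumes \<theta>: "\<And>n. tail_weights n (N n) (\<theta> n)" and c: "c \<longlonglongrightarrow> c0"
  shows "(\<lambda>n. \<Sum>k\<le>N n. \<theta> n k *\<^sub>R c k) \<longlonglongrightarrow> c0"
proof (rule LIMSEQ_I)
  fix e :: real assume "e > 0"
  then obtain n0 where n0: "\<And>n. n \<ge> n0 \<Longrightarrow> norm (c n - c0) < e / 2" using LIMSEQ_D[OF c, of "e/2"] by auto
  have "norm ((\<Sum>k\<le>N n. \<theta> n k *\<^sub>R c k) - c0) < e" if n: "n \<ge> n0" for n
  proof -
    have t: "\<And>k. 0 \<le> \<theta> n k" "\<And>k. k < n \<Longrightarrow> \<theta> n k = 0" "(\<Sum>k\<le>N n. \<theta> n k) = 1"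
      using \<theta>[of n] by (auto simp: tail_weights_def)
    have "(\<Sum>k\<le>N n. \<theta> n k *\<^sub>R c k) - c0 = (\<Sum>k\<le>N n. \<theta> n k *\<^sub>R (c k - c0))"
      by (simp add: scaleR_diff_right sum_subtractf scaleR_sum_left[symmetric] t(3))
    also have "norm \<dots> \<le> (\<Sum>k\<le>N n. \<theta> n k * (e / 2))"
    proof (rule sum_norm_le)
      fix k show "norm (\<theta> n k *\<^sub>R (c k - c0)) \<le> \<theta> n k * (e / 2)"
      proof (cases "k < n")
        case True then show ?thesis using t(2) by simp
      next
        case False
        then have "norm (c k - c0) \<le> e / 2" using n0[of k] n by simp
        then show ?thesis using mult_left_mono[OF _ t(1)[of k]] t(1)[of k] by fastforce
      qed
    qed
    also have "\<dots> = e / 2" by (metis sum_distrib_right t(3) mult_1)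
    finally show ?thesis using \<open>e > 0\<close> by simp
  qed
  then show "\<exists>no. \<forall>n\<ge>no. norm ((\<Sum>k\<le>N n. \<theta> n k *\<^sub>R c k) - c0) < e" by blast
qed

lemma tail_weights_mono:
  assumes "tail_weights m N \<theta>" "n \<le> m"
  shows "tail_weights n N \<theta>"
  using assms by (auto simp: tail_weights_def)

text \<open>Padding with zero weights, so that two combinations can be averaged over a common index
  range.\<close>

lemma tail_weights_enlarge:
  fixes c :: "nat \<Rightarrow> 'a::real_vector"
  assumes "tail_weights n N \<theta>" "N \<le> N'"
  shows "tail_weights n N' \<theta>" "(\<Sum>k\<le>N'. \<theta> k *\<^sub>R c k) = (\<Sum>k\<le>N. \<theta> k *\<^sub>R c k)"
proof -
  have z: "\<And>k. k \<in> {..N'} - {..N} \<Longrightarrow> \<theta> k = 0" and s: "{..N} \<subseteq> {..N'}"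
    using assms by (auto simp: tail_weights_def)
  show "(\<Sum>k\<le>N'. \<theta> k *\<^sub>R c k) = (\<Sum>k\<le>N. \<theta> k *\<^sub>R c k)"
    by (rule sum.mono_neutral_right) (use z s in auto)
  have "(\<Sum>k\<le>N'. \<theta> k) = (\<Sum>k\<le>N. \<theta> k)"
    by (rule sum.mono_neutral_right) (use z s in auto)
  with assms show "tail_weights n N' \<theta>" by (auto simp: tail_weights_def)
qed

text \<open>The almost minimizers of the norm over the convex hulls of the tails form a Cauchy sequence, by
  the parallelogram identity.\<close>

lemma L2_bounded_convex_combinations_converge:
  fixes p :: "nat \<Rightarrow> real \<Rightarrow> 'a::euclidean_space"
  assumes p: "\<And>k. L2_on S (p k)" and K: "\<And>k. L2_sq S (p k) \<le> K"
    and S: "0 \<le> S"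
  shows "\<exists>N \<theta> w. (\<forall>n. tail_weights n (N n) (\<theta> n)) \<and> L2_on S w \<and>
     (AE t in lebesgue_on {0..S}. (\<lambda>n. \<Sum>k\<le>N n. \<theta> n k *\<^sub>R p k t) \<longlonglongrightarrow> w t) \<and>
     (\<forall>t\<in>{0..S}. (\<lambda>n. \<Sum>k\<le>N n. \<theta> n k *\<^sub>R integral {0..t} (p k)) \<longlonglongrightarrow> integral {0..t} w)"
proof -
  let ?M = "lebesgue_on {0..S}"
  interpret finite_measure ?M by (rule finite_measure_lebesgue_on) simp
  define \<iota> where "\<iota> n = inverse (real (Suc n))" for n
  have \<iota>: "0 < \<iota> n" "\<iota> n \<le> 1" for n by (auto simp: \<iota>_def inverse_le_1_iff)
  have \<iota>mono: "\<iota> m \<le> \<iota> n" if "n \<le> m" for n m unfolding \<iota>_def using that by (auto intro!: le_imp_inverse_le)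
  define Q where "Q q = (\<integral>t. (norm (q t))\<^sup>2 \<partial>?M)" for q :: "real \<Rightarrow> 'a"
  define comb where "comb N \<theta> t = (\<Sum>k\<le>N. \<theta> k *\<^sub>R p k t)" for N :: nat and \<theta> t
  define E where "E n = {comb N \<theta> | N \<theta>. tail_weights n N \<theta>}" for n
  \<comment> \<open>Squared distance of the origin from the convex hull of the n-th tail. The hulls
    shrink, so \<open>d\<close> increases; it is bounded by \<open>K\<close>, hence Cauchy.\<close>
  define d where "d n = Inf (Q ` E n)" for n
  have L2c: "L2_on S (comb N \<theta>)" for N \<theta> unfolding comb_def by (intro L2_on_sum L2_on_scaleR p)
  have Q0: "0 \<le> Q q" for q unfolding Q_def by simp
  have bdd: "bdd_below (Q ` E n)" for n using Q0 by (auto intro: bdd_belowI[of _ 0])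
  have pE: "p n \<in> E n" for n
  proof -
    have "comb n (\<lambda>k. if k = n then 1 else 0) = p n"
      by (simp add: comb_def fun_eq_iff if_distrib[of "\<lambda>r. r *\<^sub>R _"] cong: if_cong)
    moreover have "tail_weights n n (\<lambda>k. if k = n then 1 else 0)" by (simp add: tail_weights_def)
    ultimately show ?thesis unfolding E_def by (intro CollectI exI conjI) (rule sym, assumption+)
  qed
  have Emono: "E m \<subseteq> E n" if "n \<le> m" for n m using that tail_weights_mono unfolding E_def by blast
  have dle: "d n \<le> Q q" if "q \<in> E n" for n q unfolding d_def by (rule cInf_lower) (use that bdd in auto)
  have dmono: "d n \<le> d m" if "n \<le> m" for n m
    unfolding d_def
  proof (rule cInf_superset_mono)
    show "Q ` E m \<noteq> {}" using pE[of m] by blast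
  qed (use that Emono bdd in auto)
  have dK: "d n \<le> K" for n using dle[OF pE[of n]] K[of n] unfolding Q_def by linarith
  have d0: "0 \<le> d n" for n unfolding d_def by (rule cInf_greatest) (use Q0 pE[of n] in auto)
  have "convergent d"
    by (rule Bseq_mono_convergent) (use dK d0 dmono in \<open>auto intro!: BseqI'[of _ K] simp: abs_of_nonneg\<close>)
  then have cau: "Cauchy d" by (rule convergent_Cauchy)
  \<comment> \<open>The infimum need not be attained, hence the slack \<open>\<iota> n\<close>,
    which vanishes in the limit.\<close>
  have "\<exists>q. q \<in> E n \<and> Q q < d n + \<iota> n" for n
  proof -
    have "Inf (Q ` E n) < d n + \<iota> n" unfolding d_def using \<iota> by simp
    then show ?thesis using cInf_less_iff[OF _ bdd, of n] pE[of n] by blast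
  qed
  then obtain q where q: "\<And>n. q n \<in> E n" "\<And>n. Q (q n) < d n + \<iota> n" by metis
  have qL2: "L2_on S (q n)" for n using q(1)[of n] L2c unfolding E_def by auto
  have qQ: "Q (q n) \<le> K + 1" for n
  proof -
    show ?thesis using q(2)[of n] dK[of n] \<iota>(2)[of n] by linarith
  qed
  \<comment> \<open>For \<open>n \<le> m\<close> both functions are combinations from the n-th tail,
    so their midpoint competes in the infimum \<open>d n\<close>.\<close>
  have mid: "(\<lambda>t. (1/2) *\<^sub>R (q n t + q m t)) \<in> E n" if nm: "n \<le> m" for n m
  proof -
    obtain N \<theta> where 1: "q n = comb N \<theta>" "tail_weights n N \<theta>" using q(1)[of n] unfolding E_def by blast
    obtain N' \<theta>' where 2: "q m = comb N' \<theta>'" "tail_weights n N' \<theta>'"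
      using q(1)[of m] Emono[OF nm] unfolding E_def by blast
    let ?N = "max N N'"
    let ?t = "\<lambda>k. (1/2) * (\<theta> k + \<theta>' k)"
    note e1 = tail_weights_enlarge[OF 1(2) max.cobounded1[of N N']]
    note e2 = tail_weights_enlarge[OF 2(2) max.cobounded2[of N' N]]
    have "(\<lambda>t. (1/2) *\<^sub>R (q n t + q m t)) = comb ?N ?t"
    proof
      fix t
      have "comb ?N ?t t = (1/2) *\<^sub>R ((\<Sum>k\<le>?N. \<theta> k *\<^sub>R p k t) + (\<Sum>k\<le>?N. \<theta>' k *\<^sub>R p k t))"
        unfolding comb_def sum.distrib[symmetric] scaleR_sum_right
        by (intro sum.cong refl) (simp only: scaleR_add_left[symmetric] scaleR_scaleR distrib_left)
      then show "(1/2) *\<^sub>R (q n t + q m t) = comb ?N ?t t"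
        unfolding 1(1) 2(1) comb_def e1(2) e2(2) by simp
    qed
    moreover have "tail_weights n ?N ?t"
      using e1(1) e2(1) unfolding tail_weights_def
      by (auto simp: sum.distrib sum_divide_distrib[symmetric])
    ultimately show ?thesis unfolding E_def by blast
  qed
  \<comment> \<open>Parallelogram identity: twice each of the two almost minimal values, minus four
    times the value at the midpoint, which is at least \<open>d n\<close>.\<close>
  have dist: "Q (\<lambda>t. q n t - q m t) \<le> 2 * (d m - d n) + 2 * \<iota> n + 2 * \<iota> m"
    if nm: "n \<le> m" for n m
  proof -
    let ?mid = "\<lambda>t. (1/2) *\<^sub>R (q n t + q m t)"
    have "(norm (q n t - q m t))\<^sup>2 = 2 * (norm (q n t))\<^sup>2 + 2 * (norm (q m t))\<^sup>2 - 4 * (norm (?mid t))\<^sup>2" for t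
    proof -
      have "(norm (?mid t))\<^sup>2 = (norm (q n t + q m t))\<^sup>2 / 4"
        by (simp add: power_divide)
      then show ?thesis
        by (simp add: power2_norm_eq_inner inner_add_left inner_add_right inner_diff_left inner_diff_right inner_commute)
    qed
    moreover have "integrable ?M (\<lambda>t. (norm (q n t))\<^sup>2)" "integrable ?M (\<lambda>t. (norm (q m t))\<^sup>2)"
      "integrable ?M (\<lambda>t. (norm (?mid t))\<^sup>2)"
      using qL2 L2_on_scaleR[OF L2_on_add[OF qL2[of n] qL2[of m]]] by (simp_all only: L2_on_def)
    ultimately have "Q (\<lambda>t. q n t - q m t) = 2 * Q (q n) + 2 * Q (q m) - 4 * Q ?mid"
      unfolding Q_def by simp
    with dle[OF mid[OF nm]] q(2)[of n] q(2)[of m] show ?thesis by simp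
  qed
  have Qcau: "\<exists>n0. \<forall>n\<ge>n0. \<forall>m\<ge>n0. Q (\<lambda>t. q n t - q m t) < e" if e: "e > 0" for e
  proof -
    obtain n1 where n1: "\<And>n m. n \<ge> n1 \<Longrightarrow> m \<ge> n1 \<Longrightarrow> \<bar>d m - d n\<bar> < e / 8"
      using CauchyD[OF cau, of "e/8"] e by (auto simp: abs_minus_commute)
    obtain n2 where n2: "\<iota> n2 < e / 8" using reals_Archimedean[of "e/8"] e unfolding \<iota>_def by auto
    have *: "Q (\<lambda>t. q n t - q m t) < e" if "n \<ge> max n1 n2" "n \<le> m" for n m
    proof -
      have "\<iota> n \<le> \<iota> n2" "\<iota> m \<le> \<iota> n2"
        using that by (auto intro!: \<iota>mono)
      moreover have "d m - d n < e / 8" using that n1[of n m] abs_ge_self[of "d m - d n"] by linarith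
      moreover have arith: "Y < e" if "i \<le> k" "j \<le> k" "D < e / 8" "Y \<le> 2 * D + 2 * i + 2 * j" "k < e / 8"
        for Y D i j k :: real using that e by (simp add: field_simps)
      ultimately show ?thesis using dist[OF that(2)] n2 by (intro arith)
    qed
    have sym: "Q (\<lambda>t. q n t - q m t) = Q (\<lambda>t. q m t - q n t)" for n m
      unfolding Q_def by (simp add: norm_minus_commute)
    show ?thesis
    proof (intro exI[of _ "max n1 n2"] allI impI)
      fix n m assume "n \<ge> max n1 n2" "m \<ge> max n1 n2"
      then show "Q (\<lambda>t. q n t - q m t) < e" using *[of n m] *[of m n] sym[of n m] by (cases "n \<le> m") auto
    qed
  qed
  have diffL2: "L2_on S (\<lambda>t. q n t - q m t)" for n m
    using L2_on_add[OF qL2[of n] L2_on_scaleR[OF qL2[of m], of "-1"]] by simp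
  have L1cau: "\<exists>n0. \<forall>n\<ge>n0. \<forall>m\<ge>n0. (\<integral>t. norm (q n t - q m t) \<partial>?M) < e" if e: "e > 0" for e
  proof -
    \<comment> \<open>Chosen so that \<open>S / c < e\<close>. In the weighted Young inequality,
      integrated over \<open>[0, S]\<close>, the quadratic and the constant term then each stay
      below \<open>e / 2\<close>.\<close>
    define c where "c = S / e + 1"
    have c: "c > 0" "S / c < e" using S e by (auto simp: c_def field_simps add_pos_nonneg)
    obtain n0 where n0: "\<And>n m. n \<ge> n0 \<Longrightarrow> m \<ge> n0 \<Longrightarrow> Q (\<lambda>t. q n t - q m t) < e / c"
      using Qcau[of "e / c"] e c by auto
    have "(\<integral>t. norm (q n t - q m t) \<partial>?M) < e" if "n \<ge> n0" "m \<ge> n0" for n m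
    proof -
      let ?y = "\<lambda>t. q n t - q m t"
      have i1: "integrable ?M (\<lambda>t. norm (?y t))" using L2_on_integrable[OF diffL2] by simp
      have i2: "integrable ?M (\<lambda>t. (norm (?y t))\<^sup>2)" using diffL2 unfolding L2_on_def by blast
      have pw: "norm (?y t) \<le> (c / 2) * (norm (?y t))\<^sup>2 + 1 / (2 * c)" for t
        by (rule le_quadratic_AM_GM[OF c(1)])
      have "(\<integral>t. norm (?y t) \<partial>?M) \<le> (\<integral>t. (c / 2) * (norm (?y t))\<^sup>2 + 1 / (2 * c) \<partial>?M)"
        by (intro integral_mono i1 pw Bochner_Integration.integrable_add integrable_mult_right i2) simp
      also have "\<dots> = (c / 2) * Q ?y + S / (2 * c)"
        using i2 S by (simp add: Q_def measure_restrict_space)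
      also have "\<dots> < e"
      proof -
        have "(c / 2) * Q ?y < (c / 2) * (e / c)" using n0[OF that] c(1) by (intro mult_strict_left_mono) auto
        also have "\<dots> = e / 2" using c(1) by simp
        finally show ?thesis using c(2) by simp
      qed
      finally show ?thesis .
    qed
    then show ?thesis by blast
  qed
  obtain r where r: "strict_mono r" "AE t in ?M. Cauchy (\<lambda>i. q (r i) t)"
    using cauchy_L1_AE_cauchy_subseq[of ?M q, OF L2_on_integrable[OF qL2] L1cau] by blast
  define w where "w t = lim (\<lambda>i. q (r i) t)" for t
  have [measurable]: "q n \<in> borel_measurable ?M" for n using qL2 by (simp add: L2_on_def)
  have wm[measurable]: "w \<in> borel_measurable ?M" unfolding w_def by measurable
  have wlim: "AE t in ?M. (\<lambda>i. q (r i) t) \<longlonglongrightarrow> w t"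
    using r(2) unfolding w_def by eventually_elim (simp add: Cauchy_convergent_iff convergent_LIMSEQ_iff)
  have wL2: "L2_on S w"
  proof -
    have "integrable ?M (\<lambda>t. (norm (w t))\<^sup>2)"
    proof (rule fatou_bound)
      show "integrable ?M (\<lambda>t. (norm (q (r i) t))\<^sup>2)" for i using qL2 by (simp add: L2_on_def)
      show "AE t in ?M. (\<lambda>i. (norm (q (r i) t))\<^sup>2) \<longlonglongrightarrow> (norm (w t))\<^sup>2"
        using wlim by eventually_elim (intro tendsto_intros)
      show "\<forall>\<^sub>F i in sequentially. (\<integral>t. (norm (q (r i) t))\<^sup>2 \<partial>?M) \<le> K + 1"
        using qQ unfolding Q_def by (intro always_eventually) blast
    qed auto
    then show ?thesis by (simp add: L2_on_def)
  qed
  \<comment> \<open>Convergence in mean is needed besides convergence almost everywhere, because it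
    controls the primitives at every \<open>t\<close>.\<close>
  have L1: "(\<lambda>i. \<integral>t. norm (q (r i) t - w t) \<partial>?M) \<longlonglongrightarrow> 0"
  proof (rule LIMSEQ_I)
    fix e :: real assume "e > 0"
    then obtain n0 where n0: "\<And>n m. n \<ge> n0 \<Longrightarrow> m \<ge> n0 \<Longrightarrow> (\<integral>t. norm (q n t - q m t) \<partial>?M) < e / 2"
      using L1cau[of "e / 2"] by auto
    have "(\<integral>t. norm (q (r i) t - w t) \<partial>?M) \<le> e / 2" if "i \<ge> n0" for i
    proof (rule fatou_bound(2))
      have "r i \<ge> n0" using seq_suble[OF r(1), of i] that by linarith
      show "integrable ?M (\<lambda>t. norm (q (r i) t - q (r j) t))" for j using L2_on_integrable[OF diffL2] by simp
      show "AE t in ?M. (\<lambda>j. norm (q (r i) t - q (r j) t)) \<longlonglongrightarrow> norm (q (r i) t - w t)"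
        using wlim by eventually_elim (intro tendsto_intros)
      have "(\<integral>t. norm (q (r i) t - q (r j) t) \<partial>?M) \<le> e / 2" if "j \<ge> n0" for j
        using n0[of "r i" "r j"] \<open>r i \<ge> n0\<close> seq_suble[OF r(1), of j] that by fastforce
      then show "\<forall>\<^sub>F j in sequentially. (\<integral>t. norm (q (r i) t - q (r j) t) \<partial>?M) \<le> e / 2"
        unfolding eventually_sequentially by blast
    qed auto
    then show "\<exists>no. \<forall>i\<ge>no. norm ((\<integral>t. norm (q (r i) t - w t) \<partial>?M) - 0) < e"
      using \<open>e > 0\<close> by (intro exI[of _ n0]) fastforce
  qed
  \<comment> \<open>Passing to the subsequence costs nothing: \<open>r i\<close> is at least
    \<open>i\<close>, so its tail is contained in the i-th one.\<close>
  have "q (r i) \<in> E i" for i using q(1)[of "r i"] Emono[OF seq_suble[OF r(1), of i]] by blast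
  then have "\<forall>i. \<exists>N \<theta>. q (r i) = comb N \<theta> \<and> tail_weights i N \<theta>" unfolding E_def by blast
  then obtain N \<theta> where N: "\<And>i. q (r i) = comb (N i) (\<theta> i)" "\<And>i. tail_weights i (N i) (\<theta> i)" by metis
  have "(\<lambda>i. \<Sum>k\<le>N i. \<theta> i k *\<^sub>R integral {0..t} (p k)) \<longlonglongrightarrow> integral {0..t} w" if t: "t \<in> {0..S}" for t
  proof -
    have pint: "p k integrable_on {0..t}" for k by (rule L2_on_integrable_on[OF p]) (use t in auto)
    have eq: "integral {0..t} (q (r i)) = (\<Sum>k\<le>N i. \<theta> i k *\<^sub>R integral {0..t} (p k))" for i
      unfolding N comb_def using pint
      by (subst integral_sum) (auto intro!: integrable_cmul)
    have "(\<lambda>i. integral {0..t} (q (r i)) - integral {0..t} w) \<longlonglongrightarrow> 0"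
    proof (rule Lim_null_comparison[OF _ L1], intro always_eventually allI)
      fix i
      have df: "L2_on S (\<lambda>t. q (r i) t - w t)"
        using L2_on_add[OF qL2[of "r i"] L2_on_scaleR[OF wL2, of "-1"]] by simp
      have i1: "integrable ?M (\<lambda>t. norm (q (r i) t - w t))" using L2_on_integrable[OF df] by simp
      have i2: "(\<lambda>t. norm (q (r i) t - w t)) integrable_on {0..S}" by (rule integrable_on_lebesgue_on[OF i1]) simp
      have i3: "(\<lambda>t. norm (q (r i) t - w t)) integrable_on {0..t}"
        using i2 by (rule integrable_subinterval_real) (use t in auto)
      have "integral {0..t} (q (r i)) - integral {0..t} w = integral {0..t} (\<lambda>t. q (r i) t - w t)"
        by (rule Henstock_Kurzweil_Integration.integral_diff[symmetric]) (use t in \<open>auto intro!: L2_on_integrable_on[OF qL2] L2_on_integrable_on[OF wL2]\<close>)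
      also have "norm \<dots> \<le> integral {0..t} (\<lambda>t. norm (q (r i) t - w t))"
        by (rule integral_norm_bound_integral[OF _ i3]) (use t in \<open>auto intro!: L2_on_integrable_on[OF df]\<close>)
      also have "\<dots> \<le> integral {0..S} (\<lambda>t. norm (q (r i) t - w t))"
        by (rule integral_subset_le[OF _ i3 i2]) (use t in auto)
      also have "\<dots> = (\<integral>t. norm (q (r i) t - w t) \<partial>?M)"
        by (rule lebesgue_integral_eq_integral[OF i1, symmetric]) simp
      finally show "norm (integral {0..t} (q (r i)) - integral {0..t} w) \<le> (\<integral>t. norm (q (r i) t - w t) \<partial>?M)" .
    qed
    then show ?thesis unfolding eq by (rule LIM_zero_cancel)
  qed
  moreover have "AE t in ?M. (\<lambda>n. \<Sum>k\<le>N n. \<theta> n k *\<^sub>R p k t) \<longlonglongrightarrow> w t"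
    using wlim unfolding N comb_def .
  ultimately show ?thesis using N(2) wL2 by blast
qed

section \<open>Helly selection\<close>

text \<open>Capping the partition points at \<open>T\<close> changes no value of the constant
  extension. The bound therefore holds for every \<open>t\<close>, also beyond \<open>T'\<close>,
  and Helly's argument can run on the whole half-line.\<close>

lemma total_variation_const_ext_le:
  fixes a :: "real \<Rightarrow> 'a::real_normed_vector"
  assumes T: "0 \<le> T" "T \<le> T'"
  shows "total_variation t (const_ext T a) \<le> total_variation T' (const_ext T a)"
  unfolding total_variation_def
proof (rule SUP_least, clarsimp)
  fix N :: nat and s :: "nat \<Rightarrow> real"
  assume s: "mono_on {..N} s" "s ` {..N} \<subseteq> {0..t}"
  let ?s = "\<lambda>i. min (s i) T"
  let ?A = "{(N :: nat, s :: nat \<Rightarrow> real). mono_on {..N} s \<and> s ` {..N} \<subseteq> {0..T'}}"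
  let ?F = "\<lambda>(N, s). ereal (\<Sum>i<N. norm (const_ext T a (s (Suc i)) - const_ext T a (s i)))"
  have "mono_on {..N} ?s" using s(1) by (force simp: mono_on_def)
  moreover have "?s ` {..N} \<subseteq> {0..T'}" using s(2) T by (auto simp: min_def)
  ultimately have "(N, ?s) \<in> ?A" by simp
  then have "?F (N, ?s) \<le> (SUP p\<in>?A. ?F p)" by (rule SUP_upper)
  moreover have "const_ext T a (?s i) = const_ext T a (s i)" for i by (simp add: const_ext_def)
  ultimately show "ereal (\<Sum>i<N. norm (const_ext T a (s (Suc i)) - const_ext T a (s i))) \<le> (SUP p\<in>?A. ?F p)"
    by simp
qed

lemma total_variation_increment:
  fixes b :: "real \<Rightarrow> 'a::real_normed_vector"
  assumes st: "0 \<le> s" "s \<le> t" and fin: "total_variation t b \<le> ereal \<mu>"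
  shows "total_variation s b \<le> ereal (\<mu> - norm (b t - b s))"
  unfolding total_variation_def
proof (rule SUP_least, clarsimp)
  fix N :: nat and \<sigma> :: "nat \<Rightarrow> real"
  assume s: "mono_on {..N} \<sigma>" "\<sigma> ` {..N} \<subseteq> {0..s}"
  \<comment> \<open>Two nodes are appended, first \<open>s\<close> and then \<open>t\<close>: the
    given partition need not end at \<open>s\<close>, and the increment from \<open>s\<close> to
    \<open>t\<close> must appear as a separate summand.\<close>
  let ?s = "\<lambda>i. if i \<le> N then \<sigma> i else if i = Suc N then s else t"
  let ?A = "{(N :: nat, s :: nat \<Rightarrow> real). mono_on {..N} s \<and> s ` {..N} \<subseteq> {0..t}}"
  let ?F = "\<lambda>(N, s). ereal (\<Sum>i<N. norm (b (s (Suc i)) - b (s i)))"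
  have le: "\<sigma> i \<in> {0..s}" if "i \<le> N" for i using s(2) that by blast
  have "mono_on {..Suc (Suc N)} ?s"
  proof (rule mono_onI)
    fix i j :: nat assume "i \<le> j"
    then show "?s i \<le> ?s j" using s(1) le[of i] st by (auto simp: mono_on_def)
  qed
  moreover have "?s i \<in> {0..t}" for i using le[of i] st by auto
  ultimately have "(Suc (Suc N), ?s) \<in> ?A" by blast
  then have "?F (Suc (Suc N), ?s) \<le> total_variation t b" unfolding total_variation_def by (rule SUP_upper)
  with fin have "?F (Suc (Suc N), ?s) \<le> ereal \<mu>" by (rule order_trans[rotated])
  then have "(\<Sum>i<Suc (Suc N). norm (b (?s (Suc i)) - b (?s i))) \<le> \<mu>" by simp
  moreover have "(\<Sum>i<N. norm (b (?s (Suc i)) - b (?s i))) = (\<Sum>i<N. norm (b (\<sigma> (Suc i)) - b (\<sigma> i)))"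
    by (intro sum.cong) auto
  ultimately have "(\<Sum>i<N. norm (b (\<sigma> (Suc i)) - b (\<sigma> i))) + norm (b s - b (\<sigma> N)) + norm (b t - b s) \<le> \<mu>"
    by simp
  then show "(\<Sum>i<N. norm (b (\<sigma> (Suc i)) - b (\<sigma> i))) \<le> \<mu> - norm (b t - b s)"
    using norm_ge_zero[of "b s - b (\<sigma> N)"] by linarith
qed

lemma total_variation_nonneg: "0 \<le> t \<Longrightarrow> 0 \<le> total_variation t b"
  unfolding total_variation_def
  by (rule SUP_upper2[of "(0, \<lambda>_. 0)"]) (auto simp: mono_on_def)

text \<open>Helly's argument uses only some bounded function whose growth dominates the increments;
  the variation is turned into such a real-valued function, which avoids subtraction of extended
  reals.\<close>

lemma variation_function_exists:
  fixes a :: "real \<Rightarrow> 'a::real_normed_vector"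
  assumes T: "0 \<le> T" "T \<le> T'" and tv: "total_variation T' (const_ext T a) \<le> ereal \<mu>"
  shows "\<exists>V. (\<forall>s t. 0 \<le> s \<longrightarrow> s \<le> t \<longrightarrow> V s + norm (const_ext T a t - const_ext T a s) \<le> V t) \<and>
    (\<forall>t\<ge>0. 0 \<le> V t \<and> V t \<le> \<mu>)"
proof -
  let ?b = "const_ext T a"
  define V where "V t = real_of_ereal (total_variation t ?b)" for t
  have le: "total_variation t ?b \<le> ereal \<mu>" for t
    using total_variation_const_ext_le[OF T, of t a] tv by (rule order_trans)
  have V: "total_variation t ?b = ereal (V t)" if "0 \<le> t" for t
    using total_variation_nonneg[OF that, of ?b] le[of t] unfolding V_def
    by (cases "total_variation t ?b") auto
  have "V s + norm (?b t - ?b s) \<le> V t" if st: "0 \<le> s" "s \<le> t" for s t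
    using total_variation_increment[OF st, of ?b "V t"] V[of s] V[of t] st by simp
  moreover have "0 \<le> V t \<and> V t \<le> \<mu>" if "0 \<le> t" for t
    using total_variation_nonneg[OF that, of ?b] le[of t] V[OF that] by simp
  ultimately show ?thesis by blast
qed

text \<open>Convergence is obtained on the rationals and propagates to every continuity point of the limiting
  variation function.\<close>

lemma helly_selection_vector:
  fixes a :: "nat \<Rightarrow> real \<Rightarrow> 'a::euclidean_space" and V :: "nat \<Rightarrow> real \<Rightarrow> real"
  assumes inc: "\<And>k s t. 0 \<le> s \<Longrightarrow> s \<le> t \<Longrightarrow> V k s + norm (a k t - a k s) \<le> V k t"
    and V: "\<And>k t. 0 \<le> t \<Longrightarrow> 0 \<le> V k t \<and> V k t \<le> \<mu>"
    and a0: "\<And>k. norm (a k 0) \<le> B"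
  shows "\<exists>r a' N. strict_mono r \<and> countable N \<and> (\<forall>t>0. t \<notin> N \<longrightarrow> (\<lambda>k. a (r k) t) \<longlonglongrightarrow> a' t)"
proof -
  let ?D = "\<rat> \<inter> {0::real..}"
  have anorm: "norm (a k t) \<le> B + \<mu>" if t: "0 \<le> t" for k t
  proof -
    have "norm (a k t) \<le> norm (a k 0) + norm (a k t - a k 0)" by (rule norm_triangle_sub)
    then show ?thesis using inc[of 0 t k] V[of 0 k] V[OF t, of k] a0[of k] t by simp
  qed
  \<comment> \<open>Controls and variation functions are paired, so that a single diagonal
    extraction serves both on the nonnegative rationals.\<close>
  have "countable ?D" by (simp add: countable_rat)
  moreover have "norm (V k t, a k t) \<le> \<mu> + (B + \<mu>)" if "t \<in> ?D" for k t
    using norm_Pair_le[of "V k t" "a k t"] V[of t k] anorm[of t k] that by simp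
  ultimately obtain r :: "nat \<Rightarrow> nat" where r: "strict_mono r"
    and conv: "\<And>q. q \<in> ?D \<Longrightarrow> \<exists>l. (\<lambda>n. (V (r n) q, a (r n) q)) \<longlonglongrightarrow> l"
    using function_convergent_subsequence[of ?D "\<lambda>k t. (V k t, a k t)" "\<mu> + (B + \<mu>)"] by blast
  define Vi where "Vi q = lim (\<lambda>n. V (r n) q)" for q
  have Vi: "(\<lambda>n. V (r n) q) \<longlonglongrightarrow> Vi q" if qD: "q \<in> ?D" for q
  proof -
    obtain l where "(\<lambda>n. (V (r n) q, a (r n) q)) \<longlonglongrightarrow> l" using conv[OF qD] by blast
    from tendsto_fst[OF this] have "(\<lambda>n. V (r n) q) \<longlonglongrightarrow> fst l" by simp
    then show ?thesis unfolding Vi_def by (simp add: limI)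
  qed
  have ca: "\<exists>l. (\<lambda>n. a (r n) q) \<longlonglongrightarrow> l" if "q \<in> ?D" for q
  proof -
    obtain l where "(\<lambda>n. (V (r n) q, a (r n) q)) \<longlonglongrightarrow> l" using conv[OF \<open>q \<in> ?D\<close>] by blast
    from tendsto_snd[OF this] show ?thesis by auto
  qed
  have mono: "V k s \<le> V k t" if "0 \<le> s" "s \<le> t" for k s t
    using inc[OF that, of k] norm_ge_zero[of "a k t - a k s"] by linarith
  have Vimono: "Vi q \<le> Vi q'" if "q \<in> ?D" "q' \<in> ?D" "q \<le> q'" for q q'
    by (rule LIMSEQ_le[OF Vi[OF that(1)] Vi[OF that(2)]]) (use that mono in auto)
  have Vib: "0 \<le> Vi q \<and> Vi q \<le> \<mu>" if "q \<in> ?D" for q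
    using LIMSEQ_le_const[OF Vi[OF that], of 0] LIMSEQ_le_const2[OF Vi[OF that], of \<mu>] V that by auto
  \<comment> \<open>Extends the rational limits to a monotone function on the line, whose
    discontinuities are countable. The inserted 0 handles negative \<open>t\<close>, where no index
    qualifies, and is harmless because \<open>Vi\<close> is nonnegative.\<close>
  define W where "W t = Sup (insert 0 (Vi ` {q\<in>?D. q \<le> t}))" for t
  have bdd: "bdd_above (insert 0 (Vi ` {q\<in>?D. q \<le> t}))" for t
    using Vib by (auto intro!: bdd_aboveI[of _ \<mu>])
  have Wmono: "mono W"
    unfolding W_def by (intro monoI cSup_subset_mono bdd) auto
  have WVi: "W q = Vi q" if "q \<in> ?D" for q
    unfolding W_def
  proof (rule antisym)
    show "Sup (insert 0 (Vi ` {q' \<in> ?D. q' \<le> q})) \<le> Vi q"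
      by (rule cSup_least) (use that Vib Vimono in auto)
    show "Vi q \<le> Sup (insert 0 (Vi ` {q' \<in> ?D. q' \<le> q}))"
      by (rule cSup_upper[OF _ bdd]) (use that in auto)
  qed
  define N where "N = {t. \<not> isCont W t}"
  have cN: "countable N" unfolding N_def by (rule mono_ctble_discont[OF Wmono])
  have "convergent (\<lambda>k. a (r k) t)" if t: "t > 0" "t \<notin> N" for t
  proof (rule Cauchy_convergent, rule CauchyI)
    fix e :: real assume e: "e > 0"
    have "isCont W t" using t by (simp add: N_def)
    then obtain d where d: "d > 0" "\<And>s. \<bar>s - t\<bar> < d \<Longrightarrow> \<bar>W s - W t\<bar> < e / 16"
      unfolding continuous_at_eps_delta dist_real_def by (meson e divide_pos_pos zero_less_numeral)
    \<comment> \<open>Rationals on both sides of \<open>t\<close>: the oscillation of a control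
      between \<open>q\<close> and \<open>t\<close> is at most the growth of its variation from
      \<open>q\<close> to \<open>q'\<close>, that is, a gap of e/8 plus two approximation errors of
      e/16.\<close>
    obtain q where q: "q \<in> \<rat>" "max 0 (t - d) < q" "q < t" using Rats_dense_in_real[of "max 0 (t - d)" t] t d by auto
    obtain q' where q': "q' \<in> \<rat>" "t < q'" "q' < t + d" using Rats_dense_in_real[of t "t + d"] d by auto
    have qD: "q \<in> ?D" "q' \<in> ?D" using q q' t by auto
    have "\<bar>q - t\<bar> < d" "\<bar>q' - t\<bar> < d" using q q' by auto
    then have "\<bar>W q - W t\<bar> < e / 16" "\<bar>W q' - W t\<bar> < e / 16" using d(2)[of q] d(2)[of q'] by blast+
    then have gap: "Vi q' - Vi q < e / 8"
      using WVi[OF qD(1)] WVi[OF qD(2)] abs_ge_minus_self[of "W q - W t"] abs_ge_self[of "W q' - W t"] by linarith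
    obtain n1 where n1: "\<And>n. n \<ge> n1 \<Longrightarrow> \<bar>V (r n) q - Vi q\<bar> < e / 16"
      using LIMSEQ_D[OF Vi[OF qD(1)], of "e/16"] e by auto
    obtain n2 where n2: "\<And>n. n \<ge> n2 \<Longrightarrow> \<bar>V (r n) q' - Vi q'\<bar> < e / 16"
      using LIMSEQ_D[OF Vi[OF qD(2)], of "e/16"] e by auto
    obtain l where "(\<lambda>n. a (r n) q) \<longlonglongrightarrow> l" using ca[OF qD(1)] by blast
    then have "Cauchy (\<lambda>n. a (r n) q)" by (rule LIMSEQ_imp_Cauchy)
    then obtain n3 where n3: "\<And>m n. m \<ge> n3 \<Longrightarrow> n \<ge> n3 \<Longrightarrow> norm (a (r m) q - a (r n) q) < e / 4"
      using CauchyD[of "\<lambda>n. a (r n) q" "e/4"] e by auto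
    have osc: "norm (a (r n) t - a (r n) q) < e / 4" if "n \<ge> max n1 n2" for n
    proof -
      have "norm (a (r n) t - a (r n) q) \<le> V (r n) t - V (r n) q" using inc[of q t "r n"] q by auto
      also have "\<dots> \<le> V (r n) q' - V (r n) q" using mono[of t q' "r n"] t q' by auto
      also have "\<dots> < e / 4"
        using gap n1[of n] n2[of n] that abs_ge_minus_self[of "V (r n) q - Vi q"] abs_ge_self[of "V (r n) q' - Vi q'"]
        by linarith
      finally show ?thesis .
    qed
    show "\<exists>M. \<forall>m\<ge>M. \<forall>n\<ge>M. norm (a (r m) t - a (r n) t) < e"
    proof (intro exI[of _ "max n3 (max n1 n2)"] allI impI)
      fix m n assume "m \<ge> max n3 (max n1 n2)" "n \<ge> max n3 (max n1 n2)"
      then have "norm (a (r m) t - a (r m) q) < e / 4" "norm (a (r n) t - a (r n) q) < e / 4"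
        "norm (a (r m) q - a (r n) q) < e / 4" using osc n3 by auto
      moreover have "norm ((a (r m) t - a (r m) q) + (a (r m) q - a (r n) q) - (a (r n) t - a (r n) q))
          \<le> norm (a (r m) t - a (r m) q) + norm (a (r m) q - a (r n) q) + norm (a (r n) t - a (r n) q)"
        by (rule order_trans[OF norm_triangle_ineq4 add_right_mono[OF norm_triangle_ineq]])
      then have "norm (a (r m) t - a (r n) t) \<le> norm (a (r m) t - a (r m) q) + norm (a (r m) q - a (r n) q) + norm (a (r n) t - a (r n) q)"
        by simp
      ultimately show "norm (a (r m) t - a (r n) t) < e" using e by linarith
    qed
  qed
  then have "\<forall>t>0. t \<notin> N \<longrightarrow> (\<lambda>k. a (r k) t) \<longlonglongrightarrow> lim (\<lambda>k. a (r k) t)"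
    by (simp add: convergent_LIMSEQ_iff)
  then show ?thesis
    by (intro exI[of _ r] exI[of _ "\<lambda>t. lim (\<lambda>k. a (r k) t)"] exI[of _ N] conjI r cN)
qed

text \<open>A set of full measure meets every nondegenerate interval. \<open>0 < T\<close> matters:
  a single point is null, and the hypothesis would then say nothing.\<close>

lemma AE_lebesgue_on_dense:
  fixes T t d :: real
  assumes ae: "AE s in lebesgue_on {0..T}. Q s" and T: "0 < T" "t \<in> {0..T}" and d: "d > 0"
  shows "\<exists>s\<in>{0..T}. \<bar>s - t\<bar> < d \<and> Q s"
proof (rule ccontr)
  assume nex: "\<not> ?thesis"
  let ?I = "{max 0 (t - d / 2)..min T (t + d / 2)}"
  have "negligible {s. \<not> (s \<in> {0..T} \<longrightarrow> Q s)}"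
    by (rule AE_lebesgue_on_imp_negligible[OF _ ae]) simp
  moreover have "?I \<subseteq> {s. \<not> (s \<in> {0..T} \<longrightarrow> Q s)}" using nex d by (auto simp: abs_if)
  ultimately have "negligible ?I" by (rule negligible_subset)
  moreover have "max 0 (t - d / 2) < min T (t + d / 2)" using T d by auto
  ultimately show False using negligible_interval(1)[of "max 0 (t - d / 2)" "min T (t + d / 2)"] by auto
qed

section \<open>A priori estimates\<close>

text \<open>The growth constant in \<open>assumption_f\<close> refers to the moving sets of one
  control. Lipschitz continuity and compactness of the control set give a single constant for all
  states, usable along the whole minimizing sequence.\<close>

lemma f_linear_growth:
  assumes "assumption_f P T u" "assumption_A P"
  shows "\<exists>M>0. \<forall>x. \<forall>a\<in>sweeping_problem.A P. norm (sweeping_problem.f P x a) \<le> M * (1 + norm x)"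
proof -
  let ?f = "sweeping_problem.f P"
  obtain L where L: "L > 0" "\<And>x1 x2 a1 a2. norm (?f x1 a1 - ?f x2 a2) \<le> L * (norm (x1 - x2) + norm (a1 - a2))"
  proof -
    assume that: "\<And>L. L > 0 \<Longrightarrow> (\<And>x1 x2 a1 a2. norm (?f x1 a1 - ?f x2 a2) \<le> L * (norm (x1 - x2) + norm (a1 - a2))) \<Longrightarrow> thesis"
    from assms(1) have "\<exists>L>0. \<forall>x1 x2 a1 a2. norm (?f x1 a1 - ?f x2 a2) \<le> L * (norm (x1 - x2) + norm (a1 - a2))"
      unfolding assumption_f_def by (rule conjunct1)
    then show thesis by (elim exE conjE) (rule that, assumption, simp)
  qed
  have "bounded (sweeping_problem.A P)"
    using assms(2) compact_imp_bounded unfolding assumption_A_def by blast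
  then obtain B where B: "\<And>a. a \<in> sweeping_problem.A P \<Longrightarrow> norm a \<le> B"
    unfolding bounded_iff by blast
  define M where "M = norm (?f 0 0) + L * (\<bar>B\<bar> + 1)"
  have "M > 0" unfolding M_def using L(1) by (intro add_nonneg_pos mult_pos_pos) auto
  moreover have "norm (?f x a) \<le> M * (1 + norm x)" if a: "a \<in> sweeping_problem.A P" for x a
  proof -
    have "norm (?f x a) \<le> norm (?f 0 0) + norm (?f x a - ?f 0 0)" by (rule norm_triangle_sub)
    also have "\<dots> \<le> norm (?f 0 0) + L * (norm x + norm a)" using L(2)[of x a 0 0] by simp
    also have "\<dots> \<le> norm (?f 0 0) * (1 + norm x) + (L * (\<bar>B\<bar> + 1)) * (1 + norm x)"
    proof (rule add_mono)
      show "norm (?f 0 0) \<le> norm (?f 0 0) * (1 + norm x)" by (simp add: algebra_simps)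
      have "norm x + norm a \<le> norm x + \<bar>B\<bar>" using B[OF a] by linarith
      also have "\<dots> \<le> (\<bar>B\<bar> + 1) * (1 + norm x)" by (simp add: algebra_simps)
      finally show "L * (norm x + norm a) \<le> (L * (\<bar>B\<bar> + 1)) * (1 + norm x)"
        using L(1) by (simp add: mult.assoc)
    qed
    also have "\<dots> = M * (1 + norm x)" by (simp add: M_def algebra_simps)
    finally show ?thesis .
  qed
  ultimately show ?thesis by blast
qed

lemma Fmap_normal:
  assumes "- v \<in> Fmap P x u a"
  shows "sweeping_problem.f P x a - v \<in> limiting_normal_cone (Cset P) (x - u)" "x - u \<in> Cset P"
proof -
  obtain w where w: "- v = w - sweeping_problem.f P x a" "w \<in> limiting_normal_cone (Cset P) (x - u)"
    using assms unfolding Fmap_def by blast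
  then have "sweeping_problem.f P x a - v = w" by (metis add_uminus_conv_diff diff_add_cancel add.commute)
  with w show "sweeping_problem.f P x a - v \<in> limiting_normal_cone (Cset P) (x - u)" by simp
  show "x - u \<in> Cset P" using w(2) by (simp add: limiting_normal_cone_def split: if_splits)
qed

lemma continuous_AE_closed:
  fixes y :: "real \<Rightarrow> 'a::metric_space"
  assumes y: "continuous_on {0..T} y" and C: "closed C" and ae: "AE t in lebesgue_on {0..T}. y t \<in> C"
    and T: "0 < T" "t \<in> {0..T}"
  shows "y t \<in> C"
proof -
  have "y t \<in> closure C"
    unfolding closure_approachable
  proof (intro allI impI)
    fix e :: real assume "e > 0"
    then obtain d where d: "d > 0" "\<And>s. s \<in> {0..T} \<Longrightarrow> dist s t < d \<Longrightarrow> dist (y s) (y t) < e"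
      using y T(2) unfolding continuous_on_iff by meson
    obtain s where "s \<in> {0..T}" "\<bar>s - t\<bar> < d" "y s \<in> C" using AE_lebesgue_on_dense[OF ae T d(1)] by blast
    then show "\<exists>c\<in>C. dist c (y t) < e" using d(2)[of s] by (auto simp: dist_real_def)
  qed
  with C show ?thesis by simp
qed

lemma feasible_in_Cset:
  assumes data: "problem_data P" and feas: "feasible P x u a T" and t: "t \<in> {0..T}"
  shows "x t - u t \<in> Cset P"
proof (cases "T = 0")
  \<comment> \<open>On a degenerate horizon the inclusion almost everywhere is vacuous; membership
    comes from the initial condition.\<close>
  case True
  then have "t = 0" using t by simp
  then show ?thesis using feas by (auto simp: feasible_def moving_set_def)
next
  case False
  then have T: "0 < T" using feas by (simp add: feasible_def)
  have x: "W12_on T x" and u: "W12_on T u" and ae: "AE t in lebesgue_on {0..T}. - velocity x t \<in> Fmap P (x t) (u t) (a t)"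
    using feas by (auto simp: feasible_def)
  show ?thesis
  proof (rule continuous_AE_closed[OF _ closed_Cset[OF data] _ T t])
    show "continuous_on {0..T} (\<lambda>t. x t - u t)" by (intro continuous_intros W12_on_continuous x u)
    show "AE t in lebesgue_on {0..T}. x t - u t \<in> Cset P"
      using ae by eventually_elim (rule Fmap_normal)
  qed
qed

text \<open>The normal component is orthogonal to the velocity of \<open>x - u\<close>: by prox-regularity the function
  \<open>\<phi>\<close> in the proof has a maximum at \<open>t\<close>.\<close>

lemma feasible_velocity_bound:
  assumes data: "problem_data P" and g: "assumption_g P" and feas: "feasible P x u a T"
  shows "AE t in lebesgue_on {0..T}. norm (sweeping_problem.f P (x t) (a t) - velocity x t)
     \<le> norm (sweeping_problem.f P (x t) (a t) - velocity u t)"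
proof -
  have x: "W12_on T x" and u: "W12_on T u" and ae: "AE t in lebesgue_on {0..T}. - velocity x t \<in> Fmap P (x t) (u t) (a t)"
    using feas by (auto simp: feasible_def)
  let ?y = "\<lambda>t. x t - u t"
  have "continuous_on {0..T} ?y" by (intro continuous_intros W12_on_continuous x u)
  then have "bounded (?y ` {0..T})" by (intro compact_imp_bounded compact_continuous_image) auto
  then obtain R where R: "\<And>t. t \<in> {0..T} \<Longrightarrow> norm (?y t) \<le> R" unfolding bounded_iff by blast
  obtain K where K: "K \<ge> 0" "\<And>w z v. w \<in> Cset P \<Longrightarrow> z \<in> Cset P \<Longrightarrow> v \<in> limiting_normal_cone (Cset P) w \<Longrightarrow>
     norm w \<le> R \<Longrightarrow> norm z \<le> R \<Longrightarrow> v \<bullet> (z - w) \<le> K * norm v * (norm (z - w))\<^sup>2"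
    using Cset_prox_regular[OF data g, of R] by blast
  show ?thesis using ae W12_on_velocity(1)[OF x] W12_on_velocity(1)[OF u]
  proof eventually_elim
    case (elim t)
    define v where "v = sweeping_problem.f P (x t) (a t) - velocity x t"
    have v: "v \<in> limiting_normal_cone (Cset P) (?y t)" and yC: "?y t \<in> Cset P"
      using Fmap_normal[OF elim(1)] unfolding v_def by auto
    have t: "0 < t" "t < T" using elim by auto
    let ?y' = "velocity x t - velocity u t"
    have "(?y has_vector_derivative ?y') (at t)" by (intro has_vector_derivative_diff) (use elim in auto)
    then have dy: "(?y has_derivative (\<lambda>h. h *\<^sub>R ?y')) (at t)" by (simp add: has_vector_derivative_def)
    \<comment> \<open>The quadratic penalty has zero derivative at \<open>t\<close>, so
      \<open>\<phi>\<close> has derivative \<open>v \<bullet> ?y'\<close> there, while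
      prox-regularity makes \<open>\<phi>\<close> nonpositive on \<open>[0, T]\<close> and
      \<open>\<phi> t\<close> is 0.\<close>
    define \<phi> where "\<phi> s = v \<bullet> (?y s - ?y t) - (K * norm v) * ((?y s - ?y t) \<bullet> (?y s - ?y t))" for s
    have "(\<phi> has_derivative (\<lambda>h. h * (v \<bullet> ?y'))) (at t)"
      unfolding \<phi>_def
      by (rule has_derivative_eq_rhs, (rule derivative_intros dy)+) (simp add: fun_eq_iff)
    then have "(\<phi> has_real_derivative v \<bullet> ?y') (at t)"
      unfolding has_field_derivative_def by (simp add: mult.commute[of _ "v \<bullet> ?y'"])
    moreover have "0 < min t (T - t)" using t by simp
    moreover have "\<phi> s \<le> \<phi> t" if "\<bar>t - s\<bar> < min t (T - t)" for s
    proof -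
      have s: "s \<in> {0..T}" using that by auto
      have "v \<bullet> (?y s - ?y t) \<le> K * norm v * (norm (?y s - ?y t))\<^sup>2"
        by (rule K(2)[OF yC feasible_in_Cset[OF data feas s] v]) (use R[of t] R[OF s] t in auto)
      then show ?thesis by (simp add: \<phi>_def power2_norm_eq_inner)
    qed
    ultimately have 0: "v \<bullet> ?y' = 0" using DERIV_local_max[of \<phi>] by blast
    \<comment> \<open>\<open>v\<close> is the difference of \<open>f - u'\<close> and
      \<open>(x - u)'\<close>; pairing with \<open>v\<close> removes the second part.\<close>
    have "v \<bullet> v = v \<bullet> (sweeping_problem.f P (x t) (a t) - velocity u t) - v \<bullet> ?y'"
      by (simp add: inner_diff_right v_def)
    also have "\<dots> \<le> norm v * norm (sweeping_problem.f P (x t) (a t) - velocity u t)"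
      using 0 norm_cauchy_schwarz[of v "sweeping_problem.f P (x t) (a t) - velocity u t"] by simp
    finally have "norm v * norm v \<le> norm v * norm (sweeping_problem.f P (x t) (a t) - velocity u t)"
      by (simp add: dot_square_norm power2_eq_square)
    then have "norm v \<le> norm (sweeping_problem.f P (x t) (a t) - velocity u t)"
      by (cases "v = 0") auto
    then show ?case by (simp only: v_def)
  qed
qed

text \<open>Integrating the velocity bound with linear growth of \<open>f\<close> gives a Gronwall
  inequality with rate \<open>2 * M\<close>; the term \<open>K * sqrt S\<close> bounds the integral
  of the norm of \<open>u'\<close>. Using \<open>S\<close> in place of \<open>T\<close> makes
  \<open>R\<close> common to all trajectories with horizon at most \<open>S\<close>.\<close>

lemma feasible_uniform_bounds:
  assumes data: "problem_data P" and g: "assumption_g P" and feas: "feasible P x u a T"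
    and M: "M > 0" "\<And>x a. a \<in> sweeping_problem.A P \<Longrightarrow> norm (sweeping_problem.f P x a) \<le> M * (1 + norm x)"
    and K: "K > 0" "L2_sq T (velocity u) \<le> K\<^sup>2" and TS: "T \<le> S"
    and R: "R = (norm (sweeping_problem.x0 P) + 2 * M * S + K * sqrt S) * exp (2 * M * S)"
  shows "\<And>t. t \<in> {0..T} \<Longrightarrow> norm (x t) \<le> R"
    and "AE t in lebesgue_on {0..T}. norm (velocity x t) \<le> 2 * (M * (1 + R)) + norm (velocity u t)"
    and "AE t in lebesgue_on {0..T}. norm (sweeping_problem.f P (x t) (a t)) \<le> M * (1 + R)"
    and "L2_sq T (velocity x) \<le> 8 * (M * (1 + R))\<^sup>2 * S + 2 * K\<^sup>2"
proof -
  let ?f = "sweeping_problem.f P"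
  have x: "W12_on T x" and u: "W12_on T u" and T0: "0 \<le> T" and aA: "AE t in lebesgue_on {0..T}. a t \<in> sweeping_problem.A P"
    and x0: "x 0 = sweeping_problem.x0 P"
    using feas by (auto simp: feasible_def)
  have S0: "0 \<le> S" using T0 TS by linarith
  have xv: "L2_on T (velocity x)" and uv: "L2_on T (velocity u)" using W12_on_velocity(2) x u by auto
  have vel: "AE t in lebesgue_on {0..T}. norm (velocity x t) \<le> 2 * (M * (1 + norm (x t))) + norm (velocity u t)"
    using feasible_velocity_bound[OF data g feas] aA
  proof eventually_elim
    case (elim t)
    have "norm (velocity x t) = norm (?f (x t) (a t) - (?f (x t) (a t) - velocity x t))" by simp
    also have "\<dots> \<le> norm (?f (x t) (a t)) + norm (?f (x t) (a t) - velocity x t)" by (rule norm_triangle_ineq4)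
    also have "\<dots> \<le> norm (?f (x t) (a t)) + (norm (?f (x t) (a t)) + norm (velocity u t))"
      using elim(1) norm_triangle_ineq4[of "?f (x t) (a t)" "velocity u t"] by linarith
    finally show ?case using M(2)[OF elim(2), of "x t"] by linarith
  qed
  have xc: "continuous_on {0..T} (\<lambda>t. norm (x t))" by (intro continuous_intros W12_on_continuous x)
  have "norm (x t) \<le> (norm (x 0) + 2 * M * S + K * sqrt S) + (2 * M) * integral {0..t} (\<lambda>t. norm (x t))"
    if t: "t \<in> {0..T}" for t
  proof -
    have ix: "(\<lambda>t. norm (x t)) integrable_on {0..t}"
      by (rule integrable_continuous_real) (use xc t in \<open>auto intro: continuous_on_subset\<close>)
    have iv: "(\<lambda>r. norm (velocity u r)) integrable_on {0..t}"
      by (rule L2_integral_increment_bound(1)[OF uv K(2,1)]) (use t in auto)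
    have iw: "velocity x integrable_on {0..t}" by (rule L2_on_integrable_on[OF xv]) (use t in auto)
    have ineq: "norm (integral {0..t} (velocity x)) \<le> integral {0..t} (\<lambda>r. 2 * M + (2 * M) * norm (x r) + norm (velocity u r))"
    proof -
      let ?h = "\<lambda>r. 2 * M + (2 * M) * norm (x r) + norm (velocity u r)"
      have ih: "?h integrable_on {0..t}"
        by (intro integrable_add integrable_const_ivl iv integrable_on_mult_right ix)
      have "AE r in lebesgue_on {0..T}. norm (velocity x r) \<le> ?h r"
        using vel by eventually_elim (simp add: algebra_simps)
      then have neg: "negligible {r. \<not> (r \<in> {0..T} \<longrightarrow> norm (velocity x r) \<le> ?h r)}"
        by (rule AE_lebesgue_on_imp_negligible[rotated]) simp
      let ?N = "{r. \<not> (r \<in> {0..T} \<longrightarrow> norm (velocity x r) \<le> ?h r)}"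
      \<comment> \<open>The norm estimate for gauge integrals asks for a bound at every point, so
        the velocity is set to zero on the exceptional null set.\<close>
      let ?w = "\<lambda>r. if r \<in> ?N then 0 else velocity x r"
      have eq: "integral {0..t} (velocity x) = integral {0..t} ?w"
        by (rule integral_spike[OF neg]) auto
      have iw': "?w integrable_on {0..t}"
        by (rule integrable_spike[OF iw neg]) auto
      show ?thesis unfolding eq
      proof (rule integral_norm_bound_integral[OF iw' ih])
        fix r assume "r \<in> {0..t}"
        moreover have "0 \<le> ?h r" using M by simp
        ultimately show "norm (?w r) \<le> ?h r" using t by auto
      qed
    qed
    also have "\<dots> = 2 * M * t + (2 * M) * integral {0..t} (\<lambda>t. norm (x t)) + integral {0..t} (\<lambda>r. norm (velocity u r))"
    proof -
      have "((\<lambda>r. 2 * M + (2 * M) * norm (x r) + norm (velocity u r)) has_integral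
          (t - 0) *\<^sub>R (2 * M) + (2 * M) * integral {0..t} (\<lambda>t. norm (x t)) + integral {0..t} (\<lambda>r. norm (velocity u r))) {0..t}"
        using has_integral_add[OF has_integral_add[OF has_integral_const_real has_integral_mult_right[OF integrable_integral[OF ix]]]
            integrable_integral[OF iv], of "2 * M" "2 * M"] t by simp
      then show ?thesis by (simp add: integral_unique)
    qed
    also have "\<dots> \<le> 2 * M * S + (2 * M) * integral {0..t} (\<lambda>t. norm (x t)) + K * sqrt S"
    proof -
      have "integral {0..t} (\<lambda>r. norm (velocity u r)) \<le> K * sqrt (t - 0)"
        by (rule L2_integral_increment_bound(2)[OF uv K(2,1)]) (use t in auto)
      also have "\<dots> \<le> K * sqrt S" using t TS K(1) by simp
      finally have "integral {0..t} (\<lambda>r. norm (velocity u r)) \<le> K * sqrt S" .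
      moreover have "2 * M * t \<le> 2 * M * S" using t TS M by simp
      ultimately show ?thesis by linarith
    qed
    finally have "norm (integral {0..t} (velocity x)) \<le> 2 * M * S + (2 * M) * integral {0..t} (\<lambda>t. norm (x t)) + K * sqrt S" .
    moreover have "norm (x t) \<le> norm (x 0) + norm (integral {0..t} (velocity x))"
      unfolding W12_on_velocity(3)[OF x t] by (rule norm_triangle_ineq)
    ultimately show ?thesis by linarith
  qed
  note gr = integral_gronwall[OF xc _ this]
  show xR: "norm (x t) \<le> R" if t: "t \<in> {0..T}" for t
  proof -
    have "norm (x t) \<le> (norm (x 0) + 2 * M * S + K * sqrt S) * exp (2 * M * t)"
      by (rule gr) (use M t in auto)
    also have "\<dots> \<le> R" unfolding R x0
    proof (rule mult_left_mono)
      show "exp (2 * M * t) \<le> exp (2 * M * S)" using t TS M by simp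
      show "0 \<le> norm (sweeping_problem.x0 P) + 2 * M * S + K * sqrt S" using M K S0 by simp
    qed
    finally show ?thesis .
  qed
  have M1: "M * (1 + norm (x t)) \<le> M * (1 + R)" if "t \<in> {0..T}" for t using xR[OF that] M by simp
  have inT: "AE t in lebesgue_on {0..T}. t \<in> {0..T}" by (rule AE_I2) simp
  show velR: "AE t in lebesgue_on {0..T}. norm (velocity x t) \<le> 2 * (M * (1 + R)) + norm (velocity u t)"
    using vel inT
  proof eventually_elim
    case (elim t) show ?case using elim(1) M1[OF elim(2)] by linarith
  qed
  show "AE t in lebesgue_on {0..T}. norm (?f (x t) (a t)) \<le> M * (1 + R)"
    using aA inT
  proof eventually_elim
    case (elim t) show ?case using M(2)[OF elim(1), of "x t"] M1[OF elim(2)] by linarith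
  qed
  have "norm (x 0) \<le> R" using xR[of 0] T0 by simp
  then have R0: "0 \<le> R" using norm_ge_zero[of "x 0"] by linarith
  define b where "b = M * (1 + R)"
  have b0: "0 \<le> b" using M R0 by (simp add: b_def)
  have iu2: "integrable (lebesgue_on {0..T}) (\<lambda>t. (norm (velocity u t))\<^sup>2)" using uv by (simp add: L2_on_def)
  have fin: "finite_measure (lebesgue_on {0..T})" by (rule finite_measure_lebesgue_on) simp
  have "L2_sq T (velocity x) \<le> (\<integral>t. 8 * b\<^sup>2 + 2 * (norm (velocity u t))\<^sup>2 \<partial>lebesgue_on {0..T})"
  proof (rule integral_mono_AE)
    show "integrable (lebesgue_on {0..T}) (\<lambda>t. (norm (velocity x t))\<^sup>2)" using xv by (simp add: L2_on_def)
    show "integrable (lebesgue_on {0..T}) (\<lambda>t. 8 * b\<^sup>2 + 2 * (norm (velocity u t))\<^sup>2)"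
      by (intro Bochner_Integration.integrable_add integrable_mult_right iu2 finite_measure.integrable_const[OF fin])
    show "AE t in lebesgue_on {0..T}. (norm (velocity x t))\<^sup>2 \<le> 8 * b\<^sup>2 + 2 * (norm (velocity u t))\<^sup>2"
      using velR
    proof eventually_elim
      case (elim t)
      then have "(norm (velocity x t))\<^sup>2 \<le> (2 * b + norm (velocity u t))\<^sup>2" unfolding b_def by (intro power_mono) auto
      moreover have "0 \<le> (2 * b - norm (velocity u t))\<^sup>2" by simp
      ultimately show ?case by (simp add: power2_eq_square algebra_simps)
    qed
  qed
  also have "\<dots> = 8 * b\<^sup>2 * T + 2 * L2_sq T (velocity u)"
  proof -
    have "(\<integral>t. 8 * b\<^sup>2 \<partial>lebesgue_on {0..T}) = 8 * b\<^sup>2 * T" using T0 by (simp add: measure_restrict_space)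
    then show ?thesis
      using iu2 finite_measure.integrable_const[OF fin, of "8 * b\<^sup>2"] by (subst Bochner_Integration.integral_add) auto
  qed
  also have "\<dots> \<le> 8 * b\<^sup>2 * S + 2 * K\<^sup>2"
    using TS K(2) by (intro add_mono mult_left_mono) auto
  finally show "L2_sq T (velocity x) \<le> 8 * (M * (1 + R))\<^sup>2 * S + 2 * K\<^sup>2"
    by (simp only: b_def)
qed

section \<open>Stability of square integrability\<close>

lemma borel_measurable_lebesgue_on_subset:
  fixes h :: "real \<Rightarrow> 'a::euclidean_space"
  assumes h: "h \<in> borel_measurable (lebesgue_on {0..S})" and T: "T \<le> S"
  shows "h \<in> borel_measurable (lebesgue_on {0..T})"
proof -
  have I: "{0..S} \<inter> space lebesgue \<in> sets lebesgue" "{0..T} \<inter> space lebesgue \<in> sets lebesgue" by auto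
  have "(\<lambda>t. indicator {0..S} t *\<^sub>R h t) \<in> borel_measurable lebesgue"
    using h by (simp only: borel_measurable_restrict_space_iff[OF I(1)])
  then have "(\<lambda>t. indicat_real {0..T} t *\<^sub>R (indicat_real {0..S} t *\<^sub>R h t)) \<in> borel_measurable lebesgue"
    by (rule borel_measurable_scaleR[OF borel_measurable_indicator, rotated]) simp
  moreover have "(\<lambda>t. indicat_real {0..T} t *\<^sub>R (indicat_real {0..S} t *\<^sub>R h t)) = (\<lambda>t. indicat_real {0..T} t *\<^sub>R h t)"
    using T by (auto simp: fun_eq_iff indicator_def)
  ultimately show ?thesis by (simp only: borel_measurable_restrict_space_iff[OF I(2)])
qed

lemma L2_on_subset:
  assumes "L2_on S v" "T \<le> S"
  shows "L2_on T v"
  unfolding L2_on_def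
proof
  show "v \<in> borel_measurable (lebesgue_on {0..T})"
    by (rule borel_measurable_lebesgue_on_subset[OF _ assms(2)]) (use assms in \<open>simp add: L2_on_def\<close>)
  show "integrable (lebesgue_on {0..T}) (\<lambda>t. (norm (v t))\<^sup>2)"
    by (rule Equivalence_Lebesgue_Henstock_Integration.integrable_subinterval[of 0 S]) (use assms in \<open>auto simp: L2_on_def\<close>)
qed

lemma L2_on_bounded_linear:
  fixes v :: "real \<Rightarrow> 'a::euclidean_space" and \<pi> :: "'a \<Rightarrow> 'b::euclidean_space"
  assumes \<pi>: "bounded_linear \<pi>" and v: "L2_on S v"
  shows "L2_on S (\<lambda>t. \<pi> (v t))"
proof -
  have [measurable]: "v \<in> borel_measurable (lebesgue_on {0..S})" using v by (simp add: L2_on_def)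
  have m: "(\<lambda>t. \<pi> (v t)) \<in> borel_measurable (lebesgue_on {0..S})"
    using measurable_compose[OF _ borel_measurable_continuous_onI[OF linear_continuous_on[OF \<pi>]], of v] by simp
  obtain K where K: "\<And>x. norm (\<pi> x) \<le> norm x * K" using bounded_linear.bounded[OF \<pi>] by blast
  have "integrable (lebesgue_on {0..S}) (\<lambda>t. (norm (\<pi> (v t)))\<^sup>2)"
  proof (rule Bochner_Integration.integrable_bound)
    show "integrable (lebesgue_on {0..S}) (\<lambda>t. K\<^sup>2 * (norm (v t))\<^sup>2)" using v by (simp add: L2_on_def)
    have "(norm (\<pi> x))\<^sup>2 \<le> K\<^sup>2 * (norm x)\<^sup>2" for x
      using power_mono[OF K[of x] norm_ge_zero, of 2] by (simp add: power_mult_distrib mult.commute)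
    then show "AE t in lebesgue_on {0..S}. norm ((norm (\<pi> (v t)))\<^sup>2) \<le> norm (K\<^sup>2 * (norm (v t))\<^sup>2)"
      by (intro AE_I2) simp
  qed (use m in measurable)
  with m show ?thesis by (simp add: L2_on_def)
qed

lemma L2_on_Pair:
  fixes v :: "real \<Rightarrow> 'a::euclidean_space" and w :: "real \<Rightarrow> 'b::euclidean_space"
  assumes "L2_on S v" "L2_on S w"
  shows "L2_on S (\<lambda>t. (v t, w t))"
    and "(\<integral>t. (norm (v t, w t))\<^sup>2 \<partial>lebesgue_on {0..S}) = L2_sq S v + L2_sq S w"
proof -
  have eq: "(norm (v t, w t))\<^sup>2 = (norm (v t))\<^sup>2 + (norm (w t))\<^sup>2" for t by (simp add: norm_Pair)
  have "(\<lambda>t. (v t, w t)) \<in> borel_measurable (lebesgue_on {0..S})"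
    using assms by (intro borel_measurable_Pair) (auto simp: L2_on_def)
  then show "L2_on S (\<lambda>t. (v t, w t))" using assms by (simp add: L2_on_def eq)
  show "(\<integral>t. (norm (v t, w t))\<^sup>2 \<partial>lebesgue_on {0..S}) = L2_sq S v + L2_sq S w"
    using assms by (simp add: L2_on_def eq)
qed

lemma L2_on_norm:
  assumes "L2_on S v"
  shows "L2_on S (\<lambda>t. norm (v t))"
  using assms by (auto simp: L2_on_def)

section \<open>Convex combinations of normals\<close>

text \<open>The \<open>s k\<close> may be unbounded and need not converge. It suffices that their
  weighted sums are eventually bounded, since \<open>c k - c0\<close> is uniformly small on the
  tails.\<close>

lemma tail_weights_sum_product:
  fixes c :: "nat \<Rightarrow> real" and s :: "nat \<Rightarrow> real"
  assumes \<theta>: "\<And>n. tail_weights n (N n) (\<theta> n)" and c: "c \<longlonglongrightarrow> c0" and s: "\<And>k. 0 \<le> s k"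
    and lim: "(\<lambda>n. \<Sum>k\<le>N n. \<theta> n k * s k) \<longlonglongrightarrow> \<sigma>"
  shows "(\<lambda>n. \<Sum>k\<le>N n. \<theta> n k * (s k * c k)) \<longlonglongrightarrow> \<sigma> * c0"
proof -
  have "(\<lambda>n. \<Sum>k\<le>N n. \<theta> n k * (s k * (c k - c0))) \<longlonglongrightarrow> 0"
  proof (rule LIMSEQ_I)
    fix e :: real assume e: "e > 0"
    define B where "B = \<bar>\<sigma>\<bar> + 1"
    have B: "B > 0" "\<sigma> < B" using abs_ge_self[of \<sigma>] unfolding B_def by linarith+
    obtain n1 where n1: "\<And>n. n \<ge> n1 \<Longrightarrow> (\<Sum>k\<le>N n. \<theta> n k * s k) < B"
      using order_tendstoD(2)[OF lim B(2)] unfolding eventually_sequentially by blast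
    have "e / (2 * B) > 0" using e B by simp
    then obtain n2 where n2: "\<And>n. n \<ge> n2 \<Longrightarrow> norm (c n - c0) < e / (2 * B)" using LIMSEQ_D[OF c] by blast
    have "norm (\<Sum>k\<le>N n. \<theta> n k * (s k * (c k - c0))) < e" if n: "n \<ge> max n1 n2" for n
    proof -
      have t: "\<And>k. 0 \<le> \<theta> n k" "\<And>k. k < n \<Longrightarrow> \<theta> n k = 0" using \<theta>[of n] by (auto simp: tail_weights_def)
      have "norm (\<Sum>k\<le>N n. \<theta> n k * (s k * (c k - c0))) \<le> (\<Sum>k\<le>N n. (\<theta> n k * s k) * (e / (2 * B)))"
      proof (rule sum_norm_le)
        fix k
        show "norm (\<theta> n k * (s k * (c k - c0))) \<le> (\<theta> n k * s k) * (e / (2 * B))"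
        proof (cases "k < n")
          case True then show ?thesis using t(2) by simp
        next
          case False
          then have "norm (c k - c0) \<le> e / (2 * B)" using n2[of k] n by simp
          then have "(\<theta> n k * s k) * norm (c k - c0) \<le> (\<theta> n k * s k) * (e / (2 * B))"
            using t(1)[of k] s[of k] by (intro mult_left_mono) auto
          then show ?thesis using t(1)[of k] s[of k] by (simp add: abs_mult mult.assoc)
        qed
      qed
      also have "\<dots> = (\<Sum>k\<le>N n. \<theta> n k * s k) * (e / (2 * B))" by (rule sum_distrib_right[symmetric])
      also have "\<dots> \<le> B * (e / (2 * B))" using n1[of n] n e B by (intro mult_right_mono) auto
      also have "\<dots> < e" using B e by simp
      finally show ?thesis .
    qed
    then show "\<exists>no. \<forall>n\<ge>no. norm ((\<Sum>k\<le>N n. \<theta> n k * (s k * (c k - c0))) - 0) < e"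
      by (intro exI[of _ "max n1 n2"]) simp
  qed
  moreover have "(\<Sum>k\<le>N n. \<theta> n k * (s k * (c k - c0))) + (\<Sum>k\<le>N n. \<theta> n k * s k) * c0
      = (\<Sum>k\<le>N n. \<theta> n k * (s k * c k))" for n
    unfolding sum_distrib_right sum.distrib[symmetric] by (intro sum.cong) (auto simp: algebra_simps)
  ultimately show ?thesis using tendsto_add[OF _ tendsto_mult_right[OF lim, of c0]] by fastforce
qed

text \<open>Pointwise closure: prox-regularity turns the normal cone inclusion into inequalities which are
  linear in the normals and in an upper bound for their norms, hence survive convex combinations.\<close>

lemma limiting_normal_cone_convex_combinations:
  fixes C :: "'a::euclidean_space set" and v y :: "nat \<Rightarrow> 'a"
  assumes \<theta>: "\<And>n. tail_weights n (N n) (\<theta> n)" and C: "closed C"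
    and prox: "\<And>w z v. w \<in> C \<Longrightarrow> z \<in> C \<Longrightarrow> v \<in> limiting_normal_cone C w \<Longrightarrow>
      norm w \<le> R \<Longrightarrow> norm z \<le> R \<Longrightarrow> v \<bullet> (z - w) \<le> K * norm v * (norm (z - w))\<^sup>2"
    and K: "0 \<le> K"
    and y: "y \<longlonglongrightarrow> y0" "norm y0 \<le> R - 1"
    and ev: "\<forall>\<^sub>F k in sequentially. y k \<in> C \<and> norm (y k) \<le> R \<and> v k \<in> limiting_normal_cone C (y k) \<and> norm (v k) \<le> s k"
    and s: "\<And>k. 0 \<le> s k" "(\<lambda>n. \<Sum>k\<le>N n. \<theta> n k * s k) \<longlonglongrightarrow> \<sigma>"
    and v: "(\<lambda>n. \<Sum>k\<le>N n. \<theta> n k *\<^sub>R v k) \<longlonglongrightarrow> v0"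
  shows "v0 \<in> limiting_normal_cone C y0"
proof -
  obtain k0 where k0: "\<And>k. k \<ge> k0 \<Longrightarrow> y k \<in> C \<and> norm (y k) \<le> R \<and> v k \<in> limiting_normal_cone C (y k) \<and> norm (v k) \<le> s k"
    using ev unfolding eventually_sequentially by blast
  have y0: "y0 \<in> C"
    by (rule Lim_in_closed_set[OF C _ sequentially_bot y(1)]) (use ev in \<open>auto elim: eventually_mono\<close>)
  have \<sigma>: "0 \<le> \<sigma>"
    by (rule LIMSEQ_le_const[OF s(2)]) (use \<theta> s(1) in \<open>auto simp: tail_weights_def intro!: sum_nonneg mult_nonneg_nonneg\<close>)
  show ?thesis
  proof (rule limiting_normal_cone_of_quadratic_bound[OF y0])
    fix z assume z: "z \<in> C" and zy: "norm (z - y0) \<le> 1"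
    have zR: "norm z \<le> R" using norm_triangle_sub[of z y0] zy y(2) by linarith
    \<comment> \<open>The first summand comes from prox-regularity at \<open>y k\<close>, the second
      from moving the base point of the inequality to \<open>y0\<close>. Both are multiplied by the
      norm bound \<open>s k\<close>.\<close>
    define c where "c k = K * (norm (z - y k))\<^sup>2 + norm (y k - y0)" for k
    have "c \<longlonglongrightarrow> K * (norm (z - y0))\<^sup>2 + norm (y0 - y0)"
      unfolding c_def by (intro tendsto_intros y)
    then have c: "c \<longlonglongrightarrow> K * (norm (z - y0))\<^sup>2" by simp
    have term_le: "v k \<bullet> (z - y0) \<le> s k * c k" if "k \<ge> k0" for k
    proof -
      note k = k0[OF that]
      have "v k \<bullet> (z - y0) = v k \<bullet> (z - y k) + v k \<bullet> (y k - y0)" by (simp add: inner_diff_right)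
      also have "v k \<bullet> (z - y k) \<le> K * norm (v k) * (norm (z - y k))\<^sup>2" by (rule prox) (use k z zR in auto)
      also have "K * norm (v k) * (norm (z - y k))\<^sup>2 \<le> K * s k * (norm (z - y k))\<^sup>2"
        using k K by (intro mult_right_mono mult_left_mono) auto
      also have "v k \<bullet> (y k - y0) \<le> norm (v k) * norm (y k - y0)" by (rule norm_cauchy_schwarz)
      also have "\<dots> \<le> s k * norm (y k - y0)" using k by (intro mult_right_mono) auto
      finally show ?thesis by (simp add: c_def algebra_simps)
    qed
    have "v0 \<bullet> (z - y0) \<le> \<sigma> * (K * (norm (z - y0))\<^sup>2)"
    proof (rule LIMSEQ_le)
      show "(\<lambda>n. (\<Sum>k\<le>N n. \<theta> n k *\<^sub>R v k) \<bullet> (z - y0)) \<longlonglongrightarrow> v0 \<bullet> (z - y0)"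
        by (intro tendsto_intros v)
      show "(\<lambda>n. \<Sum>k\<le>N n. \<theta> n k * (s k * c k)) \<longlonglongrightarrow> \<sigma> * (K * (norm (z - y0))\<^sup>2)"
        by (rule tail_weights_sum_product[OF \<theta> c s])
      have "(\<Sum>k\<le>N n. \<theta> n k *\<^sub>R v k) \<bullet> (z - y0) \<le> (\<Sum>k\<le>N n. \<theta> n k * (s k * c k))" if "n \<ge> k0" for n
        unfolding inner_sum_left
      proof (rule sum_mono)
        fix k
        have t: "0 \<le> \<theta> n k" "k < n \<Longrightarrow> \<theta> n k = 0" using \<theta>[of n] by (auto simp: tail_weights_def)
        show "\<theta> n k *\<^sub>R v k \<bullet> (z - y0) \<le> \<theta> n k * (s k * c k)"
          using t term_le[of k] that by (cases "k < n") (auto intro!: mult_left_mono)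
      qed
      then show "\<exists>n0. \<forall>n\<ge>n0. (\<Sum>k\<le>N n. \<theta> n k *\<^sub>R v k) \<bullet> (z - y0) \<le> (\<Sum>k\<le>N n. \<theta> n k * (s k * c k))" by blast
    qed
    then show "v0 \<bullet> (z - y0) \<le> (\<sigma> * K) * (norm (z - y0))\<^sup>2" by (simp add: mult.assoc)
  qed (use \<sigma> K in auto)
qed

section \<open>Closure of the feasible set\<close>

text \<open>Identifies the density of the limit: the averaged increments of \<open>Y\<close>
  converge both to the increment of \<open>y\<close> and to the integral of \<open>\<pi>\<close>
  applied to \<open>w\<close>. The map \<open>\<pi>\<close> selects one component of a tuple
  averaged with common weights.\<close>

lemma tail_weights_integral_limit:
  fixes p :: "nat \<Rightarrow> real \<Rightarrow> 'a::euclidean_space" and \<pi> :: "'a \<Rightarrow> 'b::euclidean_space"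
  assumes \<theta>: "\<And>n. tail_weights n (N n) (\<theta> n)" and \<pi>: "bounded_linear \<pi>"
    and p: "\<And>k. L2_on S (p k)" and w: "L2_on S w" and t: "t \<in> {0..S}"
    and lim: "(\<lambda>n. \<Sum>k\<le>N n. \<theta> n k *\<^sub>R integral {0..t} (p k)) \<longlonglongrightarrow> integral {0..t} w"
    and Y: "\<And>k. Y k t = Y k 0 + integral {0..t} (\<lambda>s. \<pi> (p k s))"
    and Ylim: "(\<lambda>k. Y k t) \<longlonglongrightarrow> y t" "(\<lambda>k. Y k 0) \<longlonglongrightarrow> y 0"
  shows "y t = y 0 + integral {0..t} (\<lambda>s. \<pi> (w s))"
proof -
  interpret bounded_linear \<pi> by fact
  have lin: "\<pi> (integral {0..t} h) = integral {0..t} (\<lambda>s. \<pi> (h s))" if "L2_on S h" for h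
    using integral_linear[OF L2_on_integrable_on[OF that, of 0 t] \<pi>] t by (simp add: o_def)
  have "(\<lambda>n. \<pi> (\<Sum>k\<le>N n. \<theta> n k *\<^sub>R integral {0..t} (p k))) \<longlonglongrightarrow> \<pi> (integral {0..t} w)"
    by (rule tendsto[OF lim])
  moreover have "\<pi> (\<Sum>k\<le>N n. \<theta> n k *\<^sub>R integral {0..t} (p k)) = (\<Sum>k\<le>N n. \<theta> n k *\<^sub>R (Y k t - Y k 0))" for n
    unfolding sum scaleR using Y by (intro sum.cong refl) (simp add: lin[OF p])
  ultimately have "(\<lambda>n. \<Sum>k\<le>N n. \<theta> n k *\<^sub>R (Y k t - Y k 0)) \<longlonglongrightarrow> \<pi> (integral {0..t} w)" by simp
  moreover have "(\<lambda>n. \<Sum>k\<le>N n. \<theta> n k *\<^sub>R (Y k t - Y k 0)) \<longlonglongrightarrow> y t - y 0"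
    by (rule tail_weights_sum_tendsto[OF \<theta>]) (intro tendsto_intros Ylim)
  ultimately have "\<pi> (integral {0..t} w) = y t - y 0" by (rule LIMSEQ_unique)
  then show ?thesis by (simp add: lin[OF w])
qed

lemma AE_lebesgue_on_extend:
  assumes "AE t in lebesgue_on {0..T}. Q t"
  shows "AE t in lebesgue_on {0..S::real}. t \<le> T \<longrightarrow> Q t"
proof -
  have "AE t in lebesgue. t \<in> {0..T} \<longrightarrow> Q t" using assms by (subst (asm) AE_lebesgue_on_iff) auto
  then have "AE t in lebesgue. t \<in> {0..S} \<longrightarrow> t \<le> T \<longrightarrow> Q t" by eventually_elim simp
  then show ?thesis by (subst AE_lebesgue_on_iff) auto
qed

lemma f_tendsto:
  assumes "assumption_f P T u" "x \<longlonglongrightarrow> x0" "a \<longlonglongrightarrow> a0"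
  shows "(\<lambda>k. sweeping_problem.f P (x k) (a k)) \<longlonglongrightarrow> sweeping_problem.f P x0 a0"
proof -
  let ?f = "sweeping_problem.f P"
  have "\<exists>L>0. \<forall>x1 x2 a1 a2. norm (?f x1 a1 - ?f x2 a2) \<le> L * (norm (x1 - x2) + norm (a1 - a2))"
    using assms(1) unfolding assumption_f_def by (rule conjunct1)
  then obtain L where L: "\<forall>x1 x2 a1 a2. norm (?f x1 a1 - ?f x2 a2) \<le> L * (norm (x1 - x2) + norm (a1 - a2))"
    by (elim exE conjE)
  have "(\<lambda>k. L * (norm (x k - x0) + norm (a k - a0))) \<longlonglongrightarrow> L * (norm (x0 - x0) + norm (a0 - a0))"
    by (intro tendsto_intros assms)
  then have "(\<lambda>k. L * (norm (x k - x0) + norm (a k - a0))) \<longlonglongrightarrow> 0" by simp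
  then have "(\<lambda>k. ?f (x k) (a k) - ?f x0 a0) \<longlonglongrightarrow> 0"
    by (rule Lim_null_comparison[rotated]) (use L in simp)
  then show ?thesis by (rule LIM_zero_cancel)
qed

lemma closed_Uset:
  assumes "problem_data P"
  shows "closed (Uset P)"
proof -
  have "C1_fun (sweeping_problem.nu P)" using assms by (simp add: problem_data_def)
  then have "continuous_on UNIV (sweeping_problem.nu P)"
    unfolding C1_fun_def by (meson continuous_at_imp_continuous_on differentiable_imp_continuous_within)
  then show ?thesis
    unfolding Uset_def Uset_i_def by (intro closed_INT ballI closed_Collect_le continuous_intros)
qed

text \<open>The evaluation time moves with \<open>k\<close>, so pointwise convergence is not enough;
  uniform convergence at \<open>T k\<close> is combined with continuity of the limit.\<close>

lemma const_ext_endpoint_tendsto: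
  fixes x :: "nat \<Rightarrow> real \<Rightarrow> 'a::real_normed_vector"
  assumes lim: "uniform_limit {0..S} (\<lambda>k. const_ext (T k) (x k)) X sequentially"
    and X: "continuous_on {0..S} X" and T: "T \<longlonglongrightarrow> Ts" and TS: "\<And>k. T k \<in> {0..S}"
  shows "(\<lambda>k. x k (T k)) \<longlonglongrightarrow> X Ts"
proof -
  have Ts: "Ts \<in> {0..S}"
    by (rule Lim_in_closed_set[OF closed_atLeastAtMost _ sequentially_bot T]) (simp only: TS eventually_True)
  have "(\<lambda>k. X (T k)) \<longlonglongrightarrow> X Ts"
    by (rule continuous_on_tendsto_compose[OF X T Ts]) (simp only: TS eventually_True)
  have *: "(\<lambda>k. x k (T k) - X (T k)) \<longlonglongrightarrow> 0"
  proof (rule LIMSEQ_I)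
    fix e :: real assume "e > 0"
    from uniform_limitD[OF lim this] obtain n where
      n: "\<And>k t. k \<ge> n \<Longrightarrow> t \<in> {0..S} \<Longrightarrow> dist (const_ext (T k) (x k) t) (X t) < e"
      unfolding eventually_sequentially by blast
    have "norm (x k (T k) - X (T k) - 0) < e" if "k \<ge> n" for k
      using n[OF that TS, of k] by (simp add: dist_norm const_ext_def)
    then show "\<exists>no. \<forall>k\<ge>no. norm (x k (T k) - X (T k) - 0) < e" by blast
  qed
  from tendsto_add[OF * \<open>(\<lambda>k. X (T k)) \<longlonglongrightarrow> X Ts\<close>] show ?thesis by simp
qed

lemma feasible_limit:
  fixes P :: "('n::finite, 'd::finite, 'm::finite, 's::finite) sweeping_problem"
    and x u :: "nat \<Rightarrow> real \<Rightarrow> real ^ 'n" and a :: "nat \<Rightarrow> real \<Rightarrow> real ^ 'd" and T :: "nat \<Rightarrow> real"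
  assumes data: "problem_data P" and g: "assumption_g P" and A: "assumption_A P" and f: "assumption_f P T' u'"
    and Xi: "closed (sweeping_problem.Xi_x P)" "closed (sweeping_problem.Xi_T P)"
    and feas: "\<And>k. feasible P (x k) (u k) (a k) (T k)"
    and TS: "\<And>k. T k \<le> S" and Tlim: "T \<longlonglongrightarrow> Ts"
    and Xlim: "uniform_limit {0..S} (\<lambda>k. const_ext (T k) (x k)) X sequentially"
    and Ulim: "uniform_limit {0..S} (\<lambda>k. const_ext (T k) (u k)) U sequentially"
    and alim: "AE t in lebesgue_on {0..S}. (\<lambda>k. const_ext (T k) (a k) t) \<longlonglongrightarrow> Al t"
    and F: "\<And>k. AE t in lebesgue_on {0..T k}. norm (sweeping_problem.f P (x k t) (a k t)) \<le> F"
    and bx: "\<And>k. L2_sq (T k) (velocity (x k)) \<le> B"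
    and bu: "\<And>k. L2_sq (T k) (velocity (u k)) \<le> B"
  shows "feasible P X U Al Ts"
proof -
  let ?f = "sweeping_problem.f P" and ?A = "sweeping_problem.A P"
  have x: "W12_on (T k) (x k)" and u: "W12_on (T k) (u k)" and a: "L2_on (T k) (a k)" and T0: "0 \<le> T k" for k
    using feas[of k] by (auto simp: feasible_def)
  have Ts0: "0 \<le> Ts" by (rule LIMSEQ_le_const[OF Tlim]) (use T0 in auto)
  have TsS: "Ts \<le> S" by (rule LIMSEQ_le_const2[OF Tlim]) (use TS in auto)
  have S0: "0 \<le> S" using Ts0 TsS by linarith
  let ?Xk = "\<lambda>k. const_ext (T k) (x k)" and ?Uk = "\<lambda>k. const_ext (T k) (u k)" and ?ak = "\<lambda>k. const_ext (T k) (a k)"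
  have Xpt: "(\<lambda>k. ?Xk k t) \<longlonglongrightarrow> X t" and Upt: "(\<lambda>k. ?Uk k t) \<longlonglongrightarrow> U t" if "t \<in> {0..S}" for t
    using tendsto_uniform_limitI[OF Xlim that] tendsto_uniform_limitI[OF Ulim that] by auto
  define xd where "xd k t = (if t \<le> T k then velocity (x k) t else 0)" for k t
  define ud where "ud k t = (if t \<le> T k then velocity (u k) t else 0)" for k t
  have xdL2: "L2_on S (xd k)" and udL2: "L2_on S (ud k)" for k
    unfolding xd_def ud_def using L2_on_extend(1)[OF W12_on_velocity(2) TS] x u by auto
  have xdB: "L2_sq S (xd k) \<le> B" for k
    unfolding xd_def L2_on_extend(2)[OF W12_on_velocity(2)[OF x] TS] by (rule bx)
  have udB: "L2_sq S (ud k) \<le> B" for k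
    unfolding ud_def L2_on_extend(2)[OF W12_on_velocity(2)[OF u] TS] by (rule bu)
  \<comment> \<open>The norm of the state velocity is averaged as a third component. Its limit may
    exceed the norm of the limiting velocity, but it gives a finite bound for the averaged norms at
    almost every time.\<close>
  define p where "p k t = (xd k t, ud k t, norm (xd k t))" for k t
  have pL2: "L2_on S (p k)" for k
    unfolding p_def by (intro L2_on_Pair(1) L2_on_norm xdL2 udL2)
  have pB: "L2_sq S (p k) \<le> B + (B + B)" for k
    unfolding p_def L2_on_Pair(2)[OF xdL2 L2_on_Pair(1)[OF udL2 L2_on_norm[OF xdL2]]]
      L2_on_Pair(2)[OF udL2 L2_on_norm[OF xdL2]] real_norm_def abs_norm_cancel
    by (intro add_mono xdB udB)
  have "\<exists>N \<theta> w. (\<forall>n. tail_weights n (N n) (\<theta> n)) \<and> L2_on S w \<and>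
     (AE t in lebesgue_on {0..S}. (\<lambda>n. \<Sum>k\<le>N n. \<theta> n k *\<^sub>R p k t) \<longlonglongrightarrow> w t) \<and>
     (\<forall>t\<in>{0..S}. (\<lambda>n. \<Sum>k\<le>N n. \<theta> n k *\<^sub>R integral {0..t} (p k)) \<longlonglongrightarrow> integral {0..t} w)"
    by (rule L2_bounded_convex_combinations_converge) (rule pL2, rule pB, rule S0)
  then obtain N \<theta> w where \<theta>: "\<And>n. tail_weights n (N n) (\<theta> n)" and wL2: "L2_on S w"
    and wae: "AE t in lebesgue_on {0..S}. (\<lambda>n. \<Sum>k\<le>N n. \<theta> n k *\<^sub>R p k t) \<longlonglongrightarrow> w t"
    and wint: "\<And>t. t \<in> {0..S} \<Longrightarrow> (\<lambda>n. \<Sum>k\<le>N n. \<theta> n k *\<^sub>R integral {0..t} (p k)) \<longlonglongrightarrow> integral {0..t} w"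
    by (elim exE conjE) (rule that, erule spec, assumption, assumption, erule (1) bspec)
  have bl1: "bounded_linear (fst :: (real^'n) \<times> (real^'n) \<times> real \<Rightarrow> real^'n)"
    and bl2: "bounded_linear (\<lambda>z :: (real^'n) \<times> (real^'n) \<times> real. fst (snd z))"
    by (auto intro!: bounded_linear_intros)
  have Xw: "X t = X 0 + integral {0..t} (\<lambda>s. fst (w s))" if t: "t \<in> {0..S}" for t
  proof (rule tail_weights_integral_limit[OF \<theta> bl1 pL2 wL2 t wint[OF t], where Y = ?Xk])
    show "?Xk k t = ?Xk k 0 + integral {0..t} (\<lambda>s. fst (p k s))" for k
      using const_ext_eq_integral[OF x T0, of t k] t T0[of k] by (simp add: p_def xd_def const_ext_def)
  qed (use Xpt t S0 in auto)
  have Uw: "U t = U 0 + integral {0..t} (\<lambda>s. fst (snd (w s)))" if t: "t \<in> {0..S}" for t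
  proof (rule tail_weights_integral_limit[OF \<theta> bl2 pL2 wL2 t wint[OF t], where Y = ?Uk])
    show "?Uk k t = ?Uk k 0 + integral {0..t} (\<lambda>s. fst (snd (p k s)))" for k
      using const_ext_eq_integral[OF u T0, of t k] t T0[of k] by (simp add: p_def ud_def const_ext_def)
  qed (use Upt t S0 in auto)
  have w1: "L2_on S (\<lambda>t. fst (w t))" and w2: "L2_on S (\<lambda>t. fst (snd (w t)))"
    using L2_on_bounded_linear[OF bl1 wL2] L2_on_bounded_linear[OF bl2 wL2] by auto
  \<comment> \<open>Stated for all \<open>R \<le> S\<close>: feasibility concerns
    \<open>[0, Ts]\<close>, while convergence of the endpoints needs continuity of \<open>X\<close>
    on \<open>[0, S]\<close>.\<close>
  have WX: "W12_on R X" and WU: "W12_on R U" if "R \<le> S" for R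
    unfolding W12_on_def using L2_on_subset[OF w1 that] L2_on_subset[OF w2 that] Xw Uw that
    by (meson atLeastAtMost_iff order_trans)+
  have sub: "AE t in lebesgue_on {0..Ts}. Q t" if "AE t in lebesgue_on {0..S}. Q t" for Q
    by (rule AE_lebesgue_on_subset[OF _ _ _ that]) (use TsS in auto)
  \<comment> \<open>Bundling the conditions that hold almost everywhere leaves one null set for all
    \<open>k\<close>, so the limit can be taken at a fixed time.\<close>
  define good where "good k t \<longleftrightarrow> - velocity (x k) t \<in> Fmap P (x k t) (u k t) (a k t) \<and> u k t \<in> Uset P \<and> a k t \<in> ?A \<and>
      norm (?f (x k t) (a k t)) \<le> F" for k t
  have "AE t in lebesgue_on {0..T k}. good k t" for k
    unfolding good_def using feas[of k] F[of k] by (auto simp: feasible_def)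
  then have goodk: "AE t in lebesgue_on {0..S}. \<forall>k. t \<le> T k \<longrightarrow> good k t"
    unfolding AE_all_countable by (intro allI AE_lebesgue_on_extend)
  have velX: "AE t in lebesgue_on {0..Ts}. 0 < t \<and> t < Ts \<and> velocity X t = fst (w t)"
  proof -
    have "AE t in lebesgue_on {0..Ts}. 0 < t \<and> t < Ts \<and> (X has_vector_derivative fst (w t)) (at t) \<and> velocity X t = fst (w t)"
      by (rule velocity_eq_density[OF L2_on_subset[OF w1 TsS]]) (rule Xw, use TsS in auto)
    then show ?thesis by eventually_elim simp
  qed
  \<comment> \<open>Strictly before \<open>Ts\<close> the extensions eventually coincide with the
    original functions; \<open>Ts\<close> itself is discarded as a null set.\<close>
  have evT: "\<forall>\<^sub>F k in sequentially. t < T k" if "t < Ts" for t using order_tendstoD(1)[OF Tlim that] .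
  have Acl: "closed ?A" and Abd: "bounded ?A" using A compact_imp_closed compact_imp_bounded by (auto simp: assumption_A_def)
  have aeA: "AE t in lebesgue_on {0..Ts}. Al t \<in> ?A"
    using sub[OF alim] sub[OF goodk] velX
  proof eventually_elim
    case (elim t)
    have "\<forall>\<^sub>F k in sequentially. ?ak k t \<in> ?A"
      using evT[of t] elim by (auto simp: const_ext_def good_def elim: eventually_mono)
    then show ?case by (rule Lim_in_closed_set[OF Acl _ sequentially_bot elim(1)])
  qed
  have aeU: "AE t in lebesgue_on {0..Ts}. U t \<in> Uset P"
    using sub[OF goodk] velX
  proof eventually_elim
    case (elim t)
    have "\<forall>\<^sub>F k in sequentially. ?Uk k t \<in> Uset P"
      using evT[of t] elim by (auto simp: const_ext_def good_def elim: eventually_mono)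
    moreover have "t \<in> {0..S}" using elim TsS by auto
    ultimately show ?case by (intro Lim_in_closed_set[OF closed_Uset[OF data] _ sequentially_bot Upt])
  qed
  have aeF: "AE t in lebesgue_on {0..Ts}. - velocity X t \<in> Fmap P (X t) (U t) (Al t)"
    using sub[OF alim] sub[OF goodk] sub[OF wae] velX
  proof eventually_elim
    case (elim t)
    then have t: "0 < t" "t < Ts" "t \<in> {0..S}" using TsS by auto
    let ?ylim = "X t - U t"
    let ?v = "\<lambda>k. ?f (?Xk k t) (?ak k t) - xd k t"
    \<comment> \<open>Dominates the norm of the normal \<open>?v k\<close> and is linear in the
      averaged component. The absolute value keeps it nonnegative for every
      \<open>k\<close>.\<close>
    let ?s = "\<lambda>k. \<bar>F\<bar> + norm (xd k t)"
    let ?y = "\<lambda>k. ?Xk k t - ?Uk k t"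
    obtain K where K: "K \<ge> 0" "\<And>w z v. w \<in> Cset P \<Longrightarrow> z \<in> Cset P \<Longrightarrow> v \<in> limiting_normal_cone (Cset P) w \<Longrightarrow>
       norm w \<le> norm ?ylim + 1 \<Longrightarrow> norm z \<le> norm ?ylim + 1 \<Longrightarrow> v \<bullet> (z - w) \<le> K * norm v * (norm (z - w))\<^sup>2"
      using Cset_prox_regular[OF data g, of "norm ?ylim + 1"] by blast
    have ylim: "?y \<longlonglongrightarrow> ?ylim" by (intro tendsto_intros Xpt Upt t)
    have ev1: "\<forall>\<^sub>F k in sequentially. norm (?y k) < norm ?ylim + 1"
      using order_tendstoD(2)[OF tendsto_norm[OF ylim], of "norm ?ylim + 1"] by simp
    have q1: "(\<lambda>n. \<Sum>k\<le>N n. \<theta> n k *\<^sub>R xd k t) \<longlonglongrightarrow> fst (w t)"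
      using tendsto_fst[OF elim(3)] by (simp add: p_def fst_sum)
    have q3: "(\<lambda>n. \<Sum>k\<le>N n. \<theta> n k * norm (xd k t)) \<longlonglongrightarrow> snd (snd (w t))"
      using tendsto_snd[OF tendsto_snd[OF elim(3)]] by (simp add: p_def snd_sum)
    have "?f (X t) (Al t) - fst (w t) \<in> limiting_normal_cone (Cset P) ?ylim"
    proof (rule limiting_normal_cone_convex_combinations[OF \<theta> closed_Cset[OF data] K(2,1) ylim])
      show "\<forall>\<^sub>F k in sequentially. ?y k \<in> Cset P \<and> norm (?y k) \<le> norm ?ylim + 1 \<and>
          ?v k \<in> limiting_normal_cone (Cset P) (?y k) \<and> norm (?v k) \<le> ?s k"
        using ev1 evT[OF t(2)]
      proof eventually_elim
        case (elim k)
        then have gk: "good k t" and k: "?Xk k t = x k t" "?Uk k t = u k t" "?ak k t = a k t" "xd k t = velocity (x k) t"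
          using \<open>\<forall>k. t \<le> T k \<longrightarrow> good k t\<close> by (auto simp: const_ext_def xd_def)
        have n: "?f (x k t) (a k t) - velocity (x k) t \<in> limiting_normal_cone (Cset P) (x k t - u k t)" "x k t - u k t \<in> Cset P"
          using gk Fmap_normal unfolding good_def by blast+
        have "norm (?f (x k t) (a k t) - velocity (x k) t) \<le> norm (?f (x k t) (a k t)) + norm (velocity (x k) t)"
          by (rule norm_triangle_ineq4)
        moreover have "norm (?f (x k t) (a k t)) \<le> F" using gk by (simp add: good_def)
        ultimately have "norm (?f (x k t) (a k t) - velocity (x k) t) \<le> \<bar>F\<bar> + norm (velocity (x k) t)"
          using abs_ge_self[of F] by linarith
        then show ?case using n elim(1) unfolding k by simp
      qed
      have "(\<lambda>n. (\<Sum>k\<le>N n. \<theta> n k *\<^sub>R \<bar>F\<bar>) + (\<Sum>k\<le>N n. \<theta> n k * norm (xd k t))) \<longlonglongrightarrow> \<bar>F\<bar> + snd (snd (w t))"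
        by (intro tendsto_add q3 tail_weights_sum_tendsto[OF \<theta>] tendsto_const)
      then show "(\<lambda>n. \<Sum>k\<le>N n. \<theta> n k * ?s k) \<longlonglongrightarrow> \<bar>F\<bar> + snd (snd (w t))"
        by (simp add: distrib_left sum.distrib)
      \<comment> \<open>The values of \<open>f\<close> converge outright, since states and controls
        converge at this time; averaging is needed only for the velocities.\<close>
      have "(\<lambda>n. (\<Sum>k\<le>N n. \<theta> n k *\<^sub>R ?f (?Xk k t) (?ak k t)) - (\<Sum>k\<le>N n. \<theta> n k *\<^sub>R xd k t)) \<longlonglongrightarrow> ?f (X t) (Al t) - fst (w t)"
        by (intro tendsto_diff q1 tail_weights_sum_tendsto[OF \<theta>] f_tendsto[OF f] Xpt t elim)
      then show "(\<lambda>n. \<Sum>k\<le>N n. \<theta> n k *\<^sub>R ?v k) \<longlonglongrightarrow> ?f (X t) (Al t) - fst (w t)"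
        by (simp add: scaleR_diff_right sum_subtractf)
    qed auto
    moreover have "- velocity X t = (?f (X t) (Al t) - fst (w t)) - ?f (X t) (Al t)" using elim by simp
    ultimately show ?case unfolding Fmap_def by blast
  qed
  have AlL2: "L2_on Ts Al"
  proof -
    \<comment> \<open>The zero extensions are measurable on the common interval, and before
      \<open>Ts\<close> they eventually agree with the constant extensions.\<close>
    let ?h = "\<lambda>k t. if t \<le> T k then a k t else 0"
    have [measurable]: "?h k \<in> borel_measurable (lebesgue_on {0..S})" for k
      using restrict_lebesgue_on(3)[OF TS[of k], of "a k"] a[of k] by (simp add: L2_on_def)
    have "(\<lambda>t. lim (\<lambda>k. ?h k t)) \<in> borel_measurable (lebesgue_on {0..S})" by measurable
    then have m1: "(\<lambda>t. lim (\<lambda>k. ?h k t)) \<in> borel_measurable (lebesgue_on {0..Ts})"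
      by (rule borel_measurable_lebesgue_on_subset[OF _ TsS])
    have "AE t in lebesgue_on {0..Ts}. lim (\<lambda>k. ?h k t) = Al t"
      using sub[OF alim] velX
    proof eventually_elim
      case (elim t)
      have "\<forall>\<^sub>F k in sequentially. ?ak k t = ?h k t" using evT[of t] elim by (auto simp: const_ext_def elim: eventually_mono)
      from Lim_transform_eventually[OF elim(1) this] show ?case by (rule limI)
    qed
    from borel_measurable_lebesgue_on_AE[OF _ m1 this]
    have [measurable]: "Al \<in> borel_measurable (lebesgue_on {0..Ts})" by simp
    obtain b where b: "\<And>c. c \<in> ?A \<Longrightarrow> norm c \<le> b" using Abd unfolding bounded_iff by blast
    have "integrable (lebesgue_on {0..Ts}) (\<lambda>t. (norm (Al t))\<^sup>2)"
    proof (rule finite_measure.integrable_const_bound)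
      show "finite_measure (lebesgue_on {0..Ts})" by (rule finite_measure_lebesgue_on) simp
      show "AE t in lebesgue_on {0..Ts}. norm ((norm (Al t))\<^sup>2) \<le> b\<^sup>2"
        using aeA by eventually_elim (auto intro!: power_mono b)
    qed measurable
    then show ?thesis by (simp add: L2_on_def)
  qed
  have x0: "X 0 = sweeping_problem.x0 P"
  proof -
    have "?Xk k 0 = sweeping_problem.x0 P" for k using feas[of k] T0[of k] by (auto simp: feasible_def const_ext_def)
    then show ?thesis using Xpt[of 0] S0 LIMSEQ_unique[OF _ tendsto_const] by fastforce
  qed
  have mv: "sweeping_problem.x0 P \<in> moving_set P (U 0)"
  proof -
    have "?Xk k 0 - ?Uk k 0 \<in> Cset P" for k
      using feasible_in_Cset[OF data feas, of 0 k] T0[of k] by (simp add: const_ext_def)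
    moreover have "(\<lambda>k. ?Xk k 0 - ?Uk k 0) \<longlonglongrightarrow> X 0 - U 0" by (intro tendsto_intros Xpt Upt) (use S0 in auto)
    ultimately have "X 0 - U 0 \<in> Cset P"
      by (intro Lim_in_closed_set[OF closed_Cset[OF data] _ sequentially_bot]) auto
    then show ?thesis unfolding moving_set_def x0[symmetric] by (intro image_eqI[of _ _ "X 0 - U 0"]) auto
  qed
  have XT: "X Ts \<in> sweeping_problem.Xi_x P"
  proof -
    have "(\<lambda>k. x k (T k)) \<longlonglongrightarrow> X Ts"
      using const_ext_endpoint_tendsto[OF Xlim W12_on_continuous[OF WX[OF order_refl]] Tlim] T0 TS by auto
    moreover have "x k (T k) \<in> sweeping_problem.Xi_x P" for k using feas[of k] by (simp add: feasible_def)
    ultimately show ?thesis by (intro Lim_in_closed_set[OF Xi(1) _ sequentially_bot]) auto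
  qed
  have TT: "Ts \<in> sweeping_problem.Xi_T P"
    by (rule Lim_in_closed_set[OF Xi(2) _ sequentially_bot Tlim]) (use feas in \<open>auto simp: feasible_def\<close>)
  show ?thesis unfolding feasible_def
    using Ts0 WX[OF TsS] WU[OF TsS] AlL2 aeF aeU aeA x0 mv XT TT by simp
qed

section \<open>Lower semicontinuity of the cost\<close>

text \<open>\<open>lsc_on\<close> refers to punctured neighbourhoods, so terms of the sequence equal
  to \<open>q\<close> are covered by \<open>c < h q\<close> instead.\<close>

lemma lsc_on_eventually_less:
  assumes lsc: "lsc_on D h" and q: "q \<in> D" and y: "\<And>n. y n \<in> D" "y \<longlonglongrightarrow> q" and c: "c < h q"
  shows "\<forall>\<^sub>F n in sequentially. c < h (y n)"
proof -
  have "c < Liminf (at q within D) h" using lsc q c unfolding lsc_on_def by (meson less_le_trans)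
  then have "\<forall>\<^sub>F z in at q within D. c < h z" by (rule less_LiminfD)
  then have "\<forall>\<^sub>F z in nhds q. z \<noteq> q \<longrightarrow> z \<in> D \<longrightarrow> c < h z" by (simp add: eventually_at_filter)
  then have "\<forall>\<^sub>F n in sequentially. y n \<noteq> q \<longrightarrow> y n \<in> D \<longrightarrow> c < h (y n)"
    using y(2) by (rule eventually_compose_filterlim)
  then show ?thesis
  proof eventually_elim
    case (elim n) then show ?case using y(1)[of n] c by (cases "y n = q") auto
  qed
qed

lemma lsc_on_le_liminf:
  assumes "lsc_on D h" "q \<in> D" "\<And>n. y n \<in> D" "y \<longlonglongrightarrow> q"
  shows "h q \<le> liminf (\<lambda>n. h (y n))"
  unfolding le_Liminf_iff using lsc_on_eventually_less[OF assms] by blast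

lemma lsc_on_compact_bounded_below:
  fixes h :: "'a::metric_space \<Rightarrow> ereal"
  assumes lsc: "lsc_on D h" and Q: "compact Q" "Q \<subseteq> D" and h: "\<And>q. q \<in> D \<Longrightarrow> h q \<noteq> - \<infinity>"
  shows "\<exists>b\<ge>0. \<forall>q\<in>Q. ereal (- b) \<le> h q"
proof (rule ccontr)
  assume nex: "\<not> ?thesis"
  have "\<exists>q\<in>Q. h q < ereal (- real n)" for n :: nat
    using nex by (metis not_le of_nat_0_le_iff)
  then obtain y where y: "\<And>n. y n \<in> Q" "\<And>n. h (y n) < ereal (- real n)" by metis
  obtain q r where q: "q \<in> Q" "strict_mono r" "(y \<circ> r) \<longlonglongrightarrow> q"
    using Q(1) y(1) unfolding compact_def by meson
  have qD: "q \<in> D" using q(1) Q(2) by blast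
  then have "- \<infinity> < h q" using h[of q] by simp
  then obtain c :: real where c: "ereal c < h q" using ereal_dense2 by blast
  have "\<forall>\<^sub>F n in sequentially. ereal c < h ((y \<circ> r) n)"
    by (rule lsc_on_eventually_less[OF lsc qD _ q(3) c]) (use y Q in auto)
  then obtain n0 where n0: "\<And>n. n \<ge> n0 \<Longrightarrow> ereal c < h (y (r n))" unfolding eventually_sequentially by auto
  obtain m :: nat where m: "- c \<le> real m" using real_arch_simple by blast
  let ?n = "max n0 m"
  have "ereal c < ereal (- real (r ?n))" using n0[of ?n] y(2)[of "r ?n"] by (metis less_trans max.cobounded1)
  then have "real (r ?n) < - c" by simp
  moreover have "real m \<le> real (r ?n)" using seq_suble[OF q(2), of ?n] by (simp add: max_def split: if_splits)
  ultimately show False using m by linarith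
qed

lemma convex_epigraph_bounded_above_constant:
  fixes E :: "'v::real_vector \<Rightarrow> ereal"
  assumes conv: "convex {(p, r :: real). E p \<le> ereal r}" and ub: "\<And>p. E p \<le> ereal c" and lb: "\<And>p. E p \<noteq> - \<infinity>"
  shows "E p = E q"
proof -
  have fin: "\<exists>e. E p = ereal e" for p using ub[of p] lb[of p] by (cases "E p") auto
  have le: "E p \<le> E q" for p q
  proof -
    obtain e where e: "E q = ereal e" using fin by blast
    obtain e' where e': "E p = ereal e'" using fin by blast
    have "e' \<le> (1 - l) * e + l * c" if l01: "0 < l" "l < 1" for l
    proof -
      \<comment> \<open>The point on the ray from \<open>q\<close> through \<open>p\<close> for
        which \<open>p\<close> divides the segment from \<open>q\<close> to \<open>z\<close> in the
        ratio \<open>l\<close>. As \<open>l\<close> tends to 0 the upper bound at \<open>z\<close>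
        enters with vanishing weight.\<close>
      define z where "z = q + (1 / l) *\<^sub>R (p - q)"
      have "(1 - l) *\<^sub>R (q, e) + l *\<^sub>R (z, c) \<in> {(p, r). E p \<le> ereal r}"
        by (rule convexD[OF conv]) (use e ub l01 in auto)
      moreover have "(1 - l) *\<^sub>R q + l *\<^sub>R z = p"
        using l01 by (simp add: z_def scaleR_add_right scaleR_left_diff_distrib)
      ultimately show ?thesis using e' by simp
    qed
    then have "\<forall>\<^sub>F l in at_right 0. e' \<le> (1 - l) * e + l * c"
      unfolding eventually_at_right_field by (intro exI[of _ 1]) auto
    moreover have "((\<lambda>l. (1 - l) * e + l * c) \<longlongrightarrow> (1 - 0) * e + 0 * c) (at_right 0)"
      by (intro tendsto_intros)
    ultimately have "e' \<le> e"
      using tendsto_lowerbound[of "\<lambda>l. (1 - l) * e + l * c" e "at_right 0" e'] by simp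
    then show ?thesis using e e' by simp
  qed
  show ?thesis by (rule antisym[OF le le])
qed

text \<open>At a fixed time the majorant bounds the cost for all velocities at once, so constancy
  follows time by time; the zero velocity serves as reference.\<close>

lemma ell_independent_of_velocities:
  fixes P :: "('n::finite, 'd::finite, 'm::finite, 's::finite) sweeping_problem"
  assumes data: "problem_data P" and conv: "convex_in_velocities P T" and maj: "majorized_by_summable P T"
  shows "AE t in lebesgue_on {0..T}. \<forall>x u a v w. sweeping_problem.ell P t (x, u, a, v, w) = sweeping_problem.ell P t (x, u, a, 0, 0)"
proof -
  obtain \<theta> :: "real \<Rightarrow> real" where "AE t in lebesgue_on {0..T}. \<forall>z. sweeping_problem.ell P t z \<le> ereal (\<theta> t)"
    using maj unfolding majorized_by_summable_def by blast
  moreover have "AE t in lebesgue_on {0..T}. t \<in> {0..T}" by (rule AE_I2) simp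
  ultimately show ?thesis
  proof eventually_elim
    case (elim t)
    show ?case
    proof (intro allI)
      fix x u :: "real^'n" and a :: "real^'d" and v w :: "real^'n"
      let ?E = "\<lambda>p. sweeping_problem.ell P t (x, u, a, fst p, snd p)"
      have "{(p, r :: real). ?E p \<le> ereal r} = {((v, w), r :: real). sweeping_problem.ell P t (x, u, a, v, w) \<le> ereal r}"
        by auto
      then have "convex {(p, r :: real). ?E p \<le> ereal r}"
        using conv elim(2) by (simp add: convex_in_velocities_def)
      then have "?E (v, w) = ?E (0, 0)"
        by (rule convex_epigraph_bounded_above_constant[where c = "\<theta> t"]) (use elim data in \<open>auto simp: problem_data_def\<close>)
      then show "sweeping_problem.ell P t (x, u, a, v, w) = sweeping_problem.ell P t (x, u, a, 0, 0)" by simp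
    qed
  qed
qed

text \<open>Both parts of a summable integrand have finite integral, so the difference never takes
  the form of infinity minus infinity.\<close>

lemma ereal_integral_eq_integral:
  assumes "summable_fun T h"
  shows "ereal_integral T h = ereal (\<integral>t. real_of_ereal (h t) \<partial>lebesgue_on {0..T})"
proof -
  let ?M = "lebesgue_on {0..T}" and ?r = "\<lambda>t. real_of_ereal (h t)"
  have fin: "AE t in ?M. \<bar>h t\<bar> \<noteq> \<infinity>" and int: "integrable ?M ?r"
    using assms by (auto simp: summable_fun_def)
  have 1: "(\<integral>\<^sup>+t. e2ennreal (h t) \<partial>?M) = (\<integral>\<^sup>+t. ennreal (?r t) \<partial>?M)"
    by (rule nn_integral_cong_AE) (use fin in eventually_elim, auto simp: ennreal.rep_eq simp flip: e2ennreal_ereal)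
  have 2: "(\<integral>\<^sup>+t. e2ennreal (- h t) \<partial>?M) = (\<integral>\<^sup>+t. ennreal (- ?r t) \<partial>?M)"
    by (rule nn_integral_cong_AE) (use fin in eventually_elim, auto simp: ennreal.rep_eq simp flip: e2ennreal_ereal)
  have f1: "(\<integral>\<^sup>+t. ennreal (?r t) \<partial>?M) \<noteq> \<infinity>" and f2: "(\<integral>\<^sup>+t. ennreal (- ?r t) \<partial>?M) \<noteq> \<infinity>"
    using int unfolding real_integrable_def by auto
  have e: "enn2ereal z = ereal (enn2real z)" if "z \<noteq> \<infinity>" for z
    using that by (cases z) auto
  show ?thesis
    unfolding ereal_integral_def 1 2 e[OF f1] e[OF f2] real_lebesgue_integral_def[OF int] by simp
qed

lemma summable_fun_running_cost:
  assumes cost: "assumption_cost P T'" and feas: "feasible P x u a T" and T: "T \<le> T'"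
  shows "summable_fun T (running_cost P x u a)"
proof -
  let ?h = "running_cost P (const_ext T x) (const_ext T u) (const_ext T a)"
  have s: "summable_fun T' ?h" using cost feas unfolding assumption_cost_def by blast
  have "AE t in lebesgue_on {0..T}. t \<in> {0..T} \<and> t \<notin> {T}" by (rule AE_lebesgue_on_not_negligible) auto
  then have eq: "AE t in lebesgue_on {0..T}. ?h t = running_cost P x u a t"
    by eventually_elim (auto simp: running_cost_def velocity_const_ext const_ext_def)
  have fin: "AE t in lebesgue_on {0..T}. \<bar>?h t\<bar> \<noteq> \<infinity>"
    by (rule AE_lebesgue_on_subset[of "{0..T'}"]) (use s T in \<open>auto simp: summable_fun_def\<close>)
  have int: "integrable (lebesgue_on {0..T}) (\<lambda>t. real_of_ereal (?h t))"
    by (rule Equivalence_Lebesgue_Henstock_Integration.integrable_subinterval[of 0 T']) (use s T in \<open>auto simp: summable_fun_def\<close>)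
  have eqr: "AE t in lebesgue_on {0..T}. real_of_ereal (?h t) = real_of_ereal (running_cost P x u a t)"
    using eq by eventually_elim simp
  have "(\<lambda>t. real_of_ereal (running_cost P x u a t)) \<in> borel_measurable (lebesgue_on {0..T})"
    by (rule borel_measurable_lebesgue_on_AE[OF _ _ eqr]) (use int in auto)
  then have "integrable (lebesgue_on {0..T}) (\<lambda>t. real_of_ereal (running_cost P x u a t))"
    by (rule integrable_cong_AE_imp[OF int _ eqr])
  moreover have "AE t in lebesgue_on {0..T}. \<bar>running_cost P x u a t\<bar> \<noteq> \<infinity>"
    using fin eq by eventually_elim simp
  ultimately show ?thesis by (simp add: summable_fun_def)
qed

text \<open>Adding \<open>b\<close> makes the integrands nonnegative, so extension by zero to
  \<open>[0, S]\<close> preserves the lower bound and Fatou's lemma applies. The shift contributes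
  \<open>b * T k\<close>, which converges.\<close>

lemma integral_lower_semicontinuous_variable_interval:
  fixes h :: "nat \<Rightarrow> real \<Rightarrow> real"
  assumes int: "\<And>k. integrable (lebesgue_on {0..T k}) (h k)" and kint: "integrable (lebesgue_on {0..Ts}) h0"
    and lb: "\<And>k. AE t in lebesgue_on {0..T k}. - b \<le> h k t" and lb0: "AE t in lebesgue_on {0..Ts}. - b \<le> h0 t"
    and T: "\<And>k. 0 \<le> T k" "\<And>k. T k \<le> S" "T \<longlonglongrightarrow> Ts" and b: "0 \<le> b"
    and lim: "AE t in lebesgue_on {0..Ts}. ereal (h0 t) \<le> liminf (\<lambda>k. ereal (h k t))"
    and c: "c < (\<integral>t. h0 t \<partial>lebesgue_on {0..Ts})"
  shows "\<forall>\<^sub>F k in sequentially. c < (\<integral>t. h k t \<partial>lebesgue_on {0..T k})"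
proof -
  let ?M = "lebesgue_on {0..S}"
  have Ts: "0 \<le> Ts" "Ts \<le> S" using LIMSEQ_le_const[OF T(3), of 0] LIMSEQ_le_const2[OF T(3), of S] T by auto
  have key: "integrable ?M (\<lambda>t. if t \<le> R then k t + b else 0)"
      "(\<integral>t. (if t \<le> R then k t + b else 0) \<partial>?M) = (\<integral>t. k t \<partial>lebesgue_on {0..R}) + b * R"
      "AE t in ?M. 0 \<le> (if t \<le> R then k t + b else 0)"
    if k: "integrable (lebesgue_on {0..R}) k" "AE t in lebesgue_on {0..R}. - b \<le> k t" and R: "0 \<le> R" "R \<le> S" for R k
  proof -
    have fin: "integrable (lebesgue_on {0..R}) (\<lambda>t. b)"
      by (rule finite_measure.integrable_const[OF finite_measure_lebesgue_on]) simp
    have i: "integrable (lebesgue_on {0..R}) (\<lambda>t. k t + b)" by (rule Bochner_Integration.integrable_add[OF k(1) fin])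
    then show "integrable ?M (\<lambda>t. if t \<le> R then k t + b else 0)" by (simp only: restrict_lebesgue_on(1)[OF R(2)])
    have "(\<integral>t. k t + b \<partial>lebesgue_on {0..R}) = (\<integral>t. k t \<partial>lebesgue_on {0..R}) + b * R"
      using R(1) by (subst Bochner_Integration.integral_add[OF k(1) fin]) (simp add: measure_restrict_space)
    then show "(\<integral>t. (if t \<le> R then k t + b else 0) \<partial>?M) = (\<integral>t. k t \<partial>lebesgue_on {0..R}) + b * R"
      by (simp only: restrict_lebesgue_on(2)[OF R(2)])
    have "AE t in lebesgue. t \<in> {0..R} \<longrightarrow> - b \<le> k t" using k(2) by (subst (asm) AE_lebesgue_on_iff) auto
    then have "AE t in lebesgue. t \<in> {0..S} \<longrightarrow> 0 \<le> (if t \<le> R then k t + b else 0)" by eventually_elim auto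
    then show "AE t in ?M. 0 \<le> (if t \<le> R then k t + b else 0)" by (subst AE_lebesgue_on_iff) auto
  qed
  let ?H = "\<lambda>k t. if t \<le> T k then h k t + b else 0" and ?G = "\<lambda>t. if t \<le> Ts then h0 t + b else 0"
  let ?I = "\<lambda>k. \<integral>t. h k t \<partial>lebesgue_on {0..T k}" and ?J = "\<integral>t. h0 t \<partial>lebesgue_on {0..Ts}"
  note H = key[OF int lb T(1,2)] and H0 = key[OF kint lb0 Ts]
  have Hn: "(\<integral>\<^sup>+t. ennreal (?H k t) \<partial>?M) = ennreal (?I k + b * T k)" for k
    using nn_integral_eq_integral[OF H(1,3)] H(2) by simp
  have H0n: "(\<integral>\<^sup>+t. ennreal (?G t) \<partial>?M) = ennreal (?J + b * Ts)"
    using nn_integral_eq_integral[OF H0(1,3)] H0(2) by simp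
  have nn: "0 \<le> ?I k + b * T k" for k using integral_nonneg_AE[OF H(3)] H(2) by simp
  \<comment> \<open>After \<open>Ts\<close> the limiting integrand is zero; before \<open>Ts\<close>
    the horizon eventually exceeds \<open>t\<close>, so the cut-off is inactive.\<close>
  have le: "AE t in ?M. ennreal (?G t) \<le> liminf (\<lambda>k. ennreal (?H k t))"
  proof -
    have "AE t in lebesgue. t \<in> {0..Ts} \<longrightarrow> ereal (h0 t) \<le> liminf (\<lambda>k. ereal (h k t))"
      using lim by (subst (asm) AE_lebesgue_on_iff) auto
    moreover have "AE t in lebesgue. t \<noteq> Ts" using AE_not_in[of "{Ts}" lebesgue] by auto
    ultimately have "AE t in lebesgue. t \<in> {0..S} \<longrightarrow> ennreal (?G t) \<le> liminf (\<lambda>k. ennreal (?H k t))"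
    proof eventually_elim
      case (elim t)
      show ?case
      proof
        assume tS: "t \<in> {0..S}"
        show "ennreal (?G t) \<le> liminf (\<lambda>k. ennreal (?H k t))"
        proof (cases "t \<le> Ts")
          case False then show ?thesis by simp
        next
          case True
          then have t: "t < Ts" "ereal (h0 t) \<le> liminf (\<lambda>k. ereal (h k t))" using elim tS by auto
          have evT: "\<forall>\<^sub>F k in sequentially. t < T k" by (rule order_tendstoD(1)[OF T(3) t(1)])
          show ?thesis unfolding le_Liminf_iff
          proof (intro allI impI)
            fix y assume y: "y < ennreal (?G t)"
            then have "y \<noteq> \<infinity>" by auto
            then obtain r where r: "y = ennreal r" "0 \<le> r" by (cases y) auto
            have "r < h0 t + b" using y r True by (simp add: ennreal_less_iff)
            then have "ereal (r - b) < ereal (h0 t)" by simp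
            then have "ereal (r - b) < liminf (\<lambda>k. ereal (h k t))" using t(2) by (rule less_le_trans)
            then have "\<forall>\<^sub>F k in sequentially. ereal (r - b) < ereal (h k t)" by (rule less_LiminfD)
            then show "\<forall>\<^sub>F k in sequentially. y < ennreal (?H k t)"
              using evT
            proof eventually_elim
              case (elim k)
              then have "r < h k t + b" by simp
              then show ?case using elim r by (simp add: ennreal_less_iff)
            qed
          qed
        qed
      qed
    qed
    then show ?thesis by (subst AE_lebesgue_on_iff) auto
  qed
  have "ennreal (?J + b * Ts) \<le> (\<integral>\<^sup>+t. liminf (\<lambda>k. ennreal (?H k t)) \<partial>?M)"
    unfolding H0n[symmetric] by (rule nn_integral_mono_AE[OF le])
  also have "\<dots> \<le> liminf (\<lambda>k. \<integral>\<^sup>+t. ennreal (?H k t) \<partial>?M)"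
    by (rule nn_integral_liminf) (use borel_measurable_integrable[OF H(1)] in measurable)
  finally have fat: "ennreal (?J + b * Ts) \<le> liminf (\<lambda>k. ennreal (?I k + b * T k))" unfolding Hn .
  \<comment> \<open>Half of the gap above \<open>c\<close> is reserved for the error in
    \<open>b * T k\<close>.\<close>
  define e where "e = (?J - c) / 2"
  have e: "e > 0" "c + e < ?J" using c by (auto simp: e_def field_simps)
  have "(\<lambda>k. b * T k) \<longlonglongrightarrow> b * Ts" by (intro tendsto_intros T)
  then have ev1: "\<forall>\<^sub>F k in sequentially. b * T k < b * Ts + e" by (rule order_tendstoD) (use e in simp)
  \<comment> \<open>The negative case is separate because \<open>ennreal\<close> truncates negative
    numbers; there the nonnegativity of the shifted integrals suffices.\<close>
  have ev2: "\<forall>\<^sub>F k in sequentially. c + e + b * Ts < ?I k + b * T k"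
  proof (cases "c + e + b * Ts < 0")
    case True then show ?thesis using nn by (intro always_eventually allI) (rule less_le_trans)
  next
    case False
    then have "ennreal (c + e + b * Ts) < ennreal (?J + b * Ts)" using e by (simp add: ennreal_less_iff)
    then have "ennreal (c + e + b * Ts) < liminf (\<lambda>k. ennreal (?I k + b * T k))" using fat by (rule less_le_trans)
    then have "\<forall>\<^sub>F k in sequentially. ennreal (c + e + b * Ts) < ennreal (?I k + b * T k)" by (rule less_LiminfD)
    then show ?thesis by (rule eventually_mono) (use False in \<open>simp add: ennreal_less_iff\<close>)
  qed
  show ?thesis using ev1 ev2 by eventually_elim linarith
qed

lemma J_lower_semicontinuous:
  fixes P :: "('n::finite, 'd::finite, 'm::finite, 's::finite) sweeping_problem"
    and x u :: "nat \<Rightarrow> real \<Rightarrow> real ^ 'n" and a :: "nat \<Rightarrow> real \<Rightarrow> real ^ 'd" and T :: "nat \<Rightarrow> real"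
  assumes data: "problem_data P" and A: "assumption_A P" and eps: "\<epsilon> > 0"
    and cv: "\<And>k. convex_in_velocities P (T k + \<epsilon>)" and mj: "\<And>k. majorized_by_summable P (T k + \<epsilon>)"
    and cost: "\<And>k. assumption_cost P (T k + \<epsilon>)"
    and feas: "\<And>k. feasible P (x k) (u k) (a k) (T k)" and feas0: "feasible P X U Al Ts"
    and TS: "\<And>k. T k \<le> S" and Tlim: "T \<longlonglongrightarrow> Ts"
    and Xlim: "\<And>t. t \<in> {0..S} \<Longrightarrow> (\<lambda>k. const_ext (T k) (x k) t) \<longlonglongrightarrow> X t"
    and Ulim: "\<And>t. t \<in> {0..S} \<Longrightarrow> (\<lambda>k. const_ext (T k) (u k) t) \<longlonglongrightarrow> U t"
    and alim: "AE t in lebesgue_on {0..S}. (\<lambda>k. const_ext (T k) (a k) t) \<longlonglongrightarrow> Al t"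
    and xR: "\<And>k t. t \<in> {0..T k} \<Longrightarrow> norm (x k t) \<le> R" and uR: "\<And>k t. t \<in> {0..T k} \<Longrightarrow> norm (u k t) \<le> R"
    and xT: "(\<lambda>k. x k (T k)) \<longlonglongrightarrow> X Ts"
    and c: "ereal c < J P X U Al Ts"
  shows "\<forall>\<^sub>F k in sequentially. ereal c < J P (x k) (u k) (a k) (T k)"
proof -
  let ?ell = "sweeping_problem.ell P" and ?phi = "sweeping_problem.phi P" and ?A = "sweeping_problem.A P"
  let ?D = "{0::real..} \<times> (UNIV :: ((real ^ 'n) \<times> (real ^ 'n) \<times> (real ^ 'd) \<times> (real ^ 'n) \<times> (real ^ 'n)) set)"
  \<comment> \<open>Time belongs to the compact set, so joint lower semicontinuity gives a bound
    uniform in \<open>t\<close>. Velocities are frozen at 0, as no pointwise bound on them is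
    available.\<close>
  let ?Q = "{0..S} \<times> cball (0 :: real ^ 'n) R \<times> cball (0 :: real ^ 'n) R \<times> ?A \<times> {0 :: real ^ 'n} \<times> {0 :: real ^ 'n}"
  have T0: "0 \<le> T k" for k using feas[of k] by (simp add: feasible_def)
  have Ts0: "0 \<le> Ts" using feas0 by (simp add: feasible_def)
  have TsS: "Ts \<le> S" by (rule LIMSEQ_le_const2[OF Tlim]) (use TS in auto)
  have lscD: "lsc_on ?D (\<lambda>(t, z). ?ell t z)" and lscphi: "lsc_on UNIV ?phi"
    and phiM: "\<And>y. ?phi y \<noteq> - \<infinity>" and ellM: "\<And>t z. t \<ge> 0 \<Longrightarrow> ?ell t z \<noteq> - \<infinity>"
    using data unfolding problem_data_def by blast+
  have "compact ?Q" using A by (intro compact_Times) (auto simp: assumption_A_def)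
  then have "\<exists>b\<ge>0. \<forall>q\<in>?Q. ereal (- b) \<le> (case q of (t, z) \<Rightarrow> ?ell t z)"
    by (rule lsc_on_compact_bounded_below[OF lscD]) (use ellM in auto)
  then obtain b where b: "b \<ge> 0" "\<And>q. q \<in> ?Q \<Longrightarrow> ereal (- b) \<le> (case q of (t, z) \<Rightarrow> ?ell t z)"
    by blast
  have lbQ: "ereal (- b) \<le> ?ell t (y, w, d, 0, 0)" if "t \<in> {0..S}" "norm y \<le> R" "norm w \<le> R" "d \<in> ?A" for t y w d
    using b(2)[of "(t, y, w, d, 0, 0)"] that by simp
  have indep: "AE t in lebesgue_on {0..R'}. \<forall>x u a v w. ?ell t (x, u, a, v, w) = ?ell t (x, u, a, 0, 0)"
    if "R' \<le> T k + \<epsilon>" for R' k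
    by (rule AE_lebesgue_on_subset[OF _ _ _ ell_independent_of_velocities[OF data cv[of k] mj[of k]]]) (use that in auto)
  have indepk: "AE t in lebesgue_on {0..T k}. \<forall>x u a v w. ?ell t (x, u, a, v, w) = ?ell t (x, u, a, 0, 0)" for k
    by (rule indep[of _ k]) (use eps in simp)
  \<comment> \<open>A horizon \<open>T k1\<close> may lie below \<open>Ts\<close>, but for some
    \<open>k1\<close> the enlarged one reaches it; the cost assumptions for that index apply on
    \<open>[0, Ts]\<close>.\<close>
  have "Ts - \<epsilon> < Ts" using eps by simp
  from order_tendstoD(1)[OF Tlim this] obtain k1 where "Ts - \<epsilon> < T k1"
    unfolding eventually_sequentially by blast
  then have k1: "Ts \<le> T k1 + \<epsilon>" by simp
  let ?r = "\<lambda>k. running_cost P (x k) (u k) (a k)" and ?rl = "running_cost P X U Al"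
  let ?h = "\<lambda>k t. real_of_ereal (?r k t)" and ?hl = "\<lambda>t. real_of_ereal (?rl t)"
  have sum: "summable_fun (T k) (?r k)" for k
    by (rule summable_fun_running_cost[OF cost[of k] feas]) (use eps in simp)
  have suml: "summable_fun Ts ?rl"
    by (rule summable_fun_running_cost[OF cost[of k1] feas0 k1])
  have fin: "AE t in lebesgue_on {0..T k}. \<bar>?r k t\<bar> \<noteq> \<infinity>" for k using sum by (simp add: summable_fun_def)
  have finl: "AE t in lebesgue_on {0..Ts}. \<bar>?rl t\<bar> \<noteq> \<infinity>" using suml by (simp add: summable_fun_def)
  have inI: "AE t in lebesgue_on {0..R'}. t \<in> {0..R'}" for R' :: real by (rule AE_I2) simp
  have aA: "AE t in lebesgue_on {0..T k}. a k t \<in> ?A" for k using feas[of k] by (simp add: feasible_def)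
  have aAl: "AE t in lebesgue_on {0..Ts}. Al t \<in> ?A" using feas0 by (simp add: feasible_def)
  have extR: "norm (const_ext (T k) (x k) t) \<le> R" "norm (const_ext (T k) (u k) t) \<le> R" if "0 \<le> t" for k t
    using xR[of t k] xR[of "T k" k] uR[of t k] uR[of "T k" k] T0[of k] that by (auto simp: const_ext_def)
  have XR: "norm (X t) \<le> R" "norm (U t) \<le> R" if "t \<in> {0..S}" for t
    using LIMSEQ_le_const2[OF tendsto_norm[OF Xlim[OF that]], of R] LIMSEQ_le_const2[OF tendsto_norm[OF Ulim[OF that]], of R]
      extR that by auto
  have lb: "AE t in lebesgue_on {0..T k}. - b \<le> ?h k t" for k
    using indepk[of k] fin[of k] inI[of "T k"] aA[of k]
  proof eventually_elim
    case (elim t)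
    have "ereal (- b) \<le> ?ell t (x k t, u k t, a k t, 0, 0)"
      by (rule lbQ) (use elim xR[of t k] uR[of t k] TS[of k] in auto)
    then have "ereal (- b) \<le> ?r k t" using elim(1) unfolding running_cost_def by metis
    then show ?case using elim(2) by (cases "?r k t") auto
  qed
  have lbl: "AE t in lebesgue_on {0..Ts}. - b \<le> ?hl t"
    using indep[OF k1] finl inI[of Ts] aAl
  proof eventually_elim
    case (elim t)
    then have tS: "t \<in> {0..S}" using TsS by auto
    have "ereal (- b) \<le> ?ell t (X t, U t, Al t, 0, 0)"
      by (rule lbQ) (use elim XR[OF tS] tS in auto)
    then have "ereal (- b) \<le> ?rl t" using elim(1) unfolding running_cost_def by metis
    then show ?case using elim(2) by (cases "?rl t") auto
  qed
  have sub: "AE t in lebesgue_on {0..Ts}. Q t" if "AE t in lebesgue_on {0..S}. Q t" for Q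
    by (rule AE_lebesgue_on_subset[OF _ _ _ that]) (use TsS in auto)
  have fink: "AE t in lebesgue_on {0..S}. \<forall>k. t \<le> T k \<longrightarrow> \<bar>?r k t\<bar> \<noteq> \<infinity>"
    unfolding AE_all_countable by (intro allI AE_lebesgue_on_extend fin)
  have "AE t in lebesgue_on {0..Ts}. t \<in> {0..Ts} \<and> t \<notin> {Ts}" by (rule AE_lebesgue_on_not_negligible) auto
  then have lim: "AE t in lebesgue_on {0..Ts}. ereal (?hl t) \<le> liminf (\<lambda>k. ereal (?h k t))"
    using indep[OF k1] finl sub[OF alim] sub[OF fink]
  proof eventually_elim
    case (elim t)
    then have t: "t \<in> {0..S}" "t < Ts" "0 \<le> t" using TsS by auto
    let ?z = "\<lambda>k. (t, const_ext (T k) (x k) t, const_ext (T k) (u k) t, const_ext (T k) (a k) t, 0, 0)"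
    have "?z \<longlonglongrightarrow> (t, X t, U t, Al t, 0, 0)"
      by (intro tendsto_Pair tendsto_const Xlim Ulim t elim)
    from lsc_on_le_liminf[OF lscD _ _ this] t
    have "?ell t (X t, U t, Al t, 0, 0) \<le> liminf (\<lambda>k. ?ell t (const_ext (T k) (x k) t, const_ext (T k) (u k) t, const_ext (T k) (a k) t, 0, 0))"
      by simp
    also have "\<dots> = liminf (\<lambda>k. ereal (?h k t))"
    proof (rule Liminf_eq)
      show "\<forall>\<^sub>F k in sequentially. ?ell t (const_ext (T k) (x k) t, const_ext (T k) (u k) t, const_ext (T k) (a k) t, 0, 0) = ereal (?h k t)"
        using order_tendstoD(1)[OF Tlim t(2)]
      proof eventually_elim
        case (elim k)
        have "?ell t (x k t, u k t, a k t, 0, 0) = ?r k t"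
          using \<open>\<forall>x u a v w. ?ell t (x, u, a, v, w) = ?ell t (x, u, a, 0, 0)\<close> unfolding running_cost_def by metis
        moreover have "\<bar>?r k t\<bar> \<noteq> \<infinity>" using \<open>\<forall>k. t \<le> T k \<longrightarrow> \<bar>?r k t\<bar> \<noteq> \<infinity>\<close> elim by simp
        ultimately show ?case using elim by (simp add: const_ext_def ereal_real)
      qed
    qed
    finally have "?ell t (X t, U t, Al t, 0, 0) \<le> liminf (\<lambda>k. ereal (?h k t))" .
    moreover have "?ell t (X t, U t, Al t, 0, 0) = ?rl t" using elim(2) unfolding running_cost_def by metis
    ultimately show ?case using elim(3) by (simp add: ereal_real)
  qed
  let ?I = "\<lambda>k. \<integral>t. ?h k t \<partial>lebesgue_on {0..T k}" and ?Il = "\<integral>t. ?hl t \<partial>lebesgue_on {0..Ts}"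
  have Jl: "J P X U Al Ts = ?phi (X Ts, ennreal Ts) + ereal ?Il"
    unfolding J_def ereal_integral_eq_integral[OF suml] ..
  have Jk: "J P (x k) (u k) (a k) (T k) = ?phi (x k (T k), ennreal (T k)) + ereal (?I k)" for k
    unfolding J_def ereal_integral_eq_integral[OF sum] ..
  \<comment> \<open>Splits the level \<open>c\<close> between terminal and running cost. The
    terminal cost may be infinite, so a real level \<open>m\<close> strictly below it is
    used.\<close>
  have "\<exists>m. c - ?Il < m \<and> ereal m < ?phi (X Ts, ennreal Ts)"
  proof (cases "?phi (X Ts, ennreal Ts)")
    case (real r)
    then have "c - ?Il < r" using c unfolding Jl by simp
    then obtain m where "c - ?Il < m" "m < r" using dense by blast
    then show ?thesis using real by auto
  next
    case PInf
    then show ?thesis by (intro exI[of _ "c - ?Il + 1"]) simp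
  next
    case MInf then show ?thesis using phiM by simp
  qed
  then obtain m where m: "c - m < ?Il" "ereal m < ?phi (X Ts, ennreal Ts)" by (auto simp: algebra_simps)
  have ev1: "\<forall>\<^sub>F k in sequentially. ereal m < ?phi (x k (T k), ennreal (T k))"
    by (rule lsc_on_eventually_less[OF lscphi _ _ _ m(2)]) (auto intro!: tendsto_Pair xT tendsto_ennrealI Tlim)
  have ev2: "\<forall>\<^sub>F k in sequentially. c - m < ?I k"
    by (rule integral_lower_semicontinuous_variable_interval[OF _ _ lb lbl T0 TS Tlim b(1) lim m(1)])
       (use sum suml in \<open>auto simp: summable_fun_def\<close>)
  show ?thesis using ev1 ev2
  proof eventually_elim
    case (elim k)
    have "ereal c < ereal m + ereal (?I k)" using elim(2) by simp
    also have "\<dots> \<le> ?phi (x k (T k), ennreal (T k)) + ereal (?I k)" using elim(1) by (intro add_right_mono) simp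
    finally show ?case unfolding Jk .
  qed
qed

section \<open>Equicontinuity and uniform bounds\<close>

lemma const_ext_holder:
  fixes x :: "real \<Rightarrow> 'a::euclidean_space"
  assumes x: "W12_on T x" and T: "0 \<le> T" "T \<le> S" and C: "L2_sq T (velocity x) \<le> C\<^sup>2" "C > 0"
    and st: "s \<in> {0..S}" "t \<in> {0..S}"
  shows "norm (const_ext T x t - const_ext T x s) \<le> C * sqrt \<bar>t - s\<bar>"
proof -
  let ?p = "\<lambda>s. if s \<le> T then velocity x s else 0"
  have p: "L2_on S ?p" and pC: "L2_sq S ?p \<le> C\<^sup>2"
    using L2_on_extend[OF W12_on_velocity(2)[OF x] T(2)] C(1) by auto
  have *: "norm (const_ext T x t - const_ext T x s) \<le> C * sqrt (t - s)" if "s \<le> t" "s \<in> {0..S}" "t \<in> {0..S}" for s t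
    using L2_integral_increment_bound(3)[OF p pC C(2), of s t] that
      const_ext_eq_integral[OF x T(1), of t] const_ext_eq_integral[OF x T(1), of s] by simp
  show ?thesis
  proof (cases "s \<le> t")
    case True then show ?thesis using *[OF True st] by simp
  next
    case False then show ?thesis using *[of t s] st by (simp add: norm_minus_commute abs_minus_commute)
  qed
qed

lemma const_ext_continuous:
  fixes x :: "real \<Rightarrow> 'a::euclidean_space"
  assumes x: "W12_on T x" and T: "0 \<le> T"
  shows "continuous_on {0..S} (const_ext T x)"
proof -
  have "continuous_on {0..S} (\<lambda>s. x (min s T))"
    by (rule continuous_on_compose2[OF W12_on_continuous[OF x]]) (use T in \<open>auto intro!: continuous_intros\<close>)
  moreover have "(\<lambda>s. x (min s T)) = const_ext T x" by (auto simp: const_ext_def min_def fun_eq_iff)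
  ultimately show ?thesis by metis
qed

text \<open>No initial value of the control \<open>u\<close> is prescribed, so its size must come
  from the L2 norm: it controls the function at one point, and the Hoelder estimate spreads this to
  the interval.\<close>

lemma const_ext_sup_bound:
  fixes x :: "real \<Rightarrow> 'a::euclidean_space"
  assumes x: "W12_on T x" and T: "0 \<le> T" and eps: "0 < \<epsilon>" and K: "W12_norm (T + \<epsilon>) (const_ext T x) \<le> K" "K > 0"
    and t: "t \<in> {0..T + \<epsilon>}"
  shows "norm (const_ext T x t) \<le> sqrt (2 * K\<^sup>2 / \<epsilon>) + K * sqrt (T + \<epsilon>)"
proof -
  let ?S = "T + \<epsilon>" and ?X = "const_ext T x"
  have S: "T \<le> ?S" "0 \<le> ?S" using eps T by auto
  note bd = W12_norm_const_ext_bounds[OF x T S(1) K(1)]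
  note hol = const_ext_holder[OF x T S(1) bd(1) K(2)]
  \<comment> \<open>Otherwise the squared norm would integrate to at least
    \<open>2 * K\<^sup>2\<close> over an interval of length at least \<open>\<epsilon>\<close>,
    contradicting the bound \<open>K\<^sup>2\<close>.\<close>
  have "\<exists>s\<in>{0..?S}. (norm (?X s))\<^sup>2 \<le> 2 * K\<^sup>2 / \<epsilon>"
  proof (rule ccontr)
    assume "\<not> ?thesis"
    then have big: "2 * K\<^sup>2 / \<epsilon> \<le> (norm (?X s))\<^sup>2" if "s \<in> {0..?S}" for s using that by force
    have "continuous_on {0..?S} ?X" by (rule const_ext_continuous[OF x T])
    then have "continuous_on {0..?S} (\<lambda>s. (norm (?X s))\<^sup>2)" by (intro continuous_intros)
    then have i: "integrable (lebesgue_on {0..?S}) (\<lambda>s. (norm (?X s))\<^sup>2)" by (rule continuous_imp_integrable_real)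
    have "(\<integral>s. 2 * K\<^sup>2 / \<epsilon> \<partial>lebesgue_on {0..?S}) \<le> L2_sq ?S ?X"
      by (rule integral_mono[OF finite_measure.integrable_const[OF finite_measure_lebesgue_on] i]) (use big in auto)
    moreover have "(\<integral>s. 2 * K\<^sup>2 / \<epsilon> \<partial>lebesgue_on {0..?S}) = (2 * K\<^sup>2 / \<epsilon>) * ?S"
      using S(2) by (simp add: measure_restrict_space)
    moreover note bd(2)
    moreover have "(2 * K\<^sup>2 / \<epsilon>) * \<epsilon> \<le> (2 * K\<^sup>2 / \<epsilon>) * ?S" using T eps by (intro mult_left_mono) auto
    moreover have "(2 * K\<^sup>2 / \<epsilon>) * \<epsilon> = 2 * K\<^sup>2" using eps by simp
    moreover have "K\<^sup>2 > 0" using K(2) by simp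
    ultimately show False by linarith
  qed
  then obtain s where s: "s \<in> {0..?S}" "(norm (?X s))\<^sup>2 \<le> 2 * K\<^sup>2 / \<epsilon>" by blast
  have "norm (?X s) \<le> sqrt (2 * K\<^sup>2 / \<epsilon>)" using s(2) by (rule real_le_rsqrt)
  moreover have "norm (?X t - ?X s) \<le> K * sqrt ?S"
  proof -
    have "\<bar>t - s\<bar> \<le> ?S" using s(1) t by auto
    then have "K * sqrt \<bar>t - s\<bar> \<le> K * sqrt ?S" using K(2) by (intro mult_left_mono) auto
    with hol[OF s(1) t] show ?thesis by linarith
  qed
  ultimately show ?thesis using norm_triangle_sub[of "?X t" "?X s"] by linarith
qed

section \<open>Extraction of a convergent minimizing subsequence\<close>

theorem theorem4p2:
  fixes P :: "('n::finite, 'd::finite, 'm::finite, 's::finite) sweeping_problem"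
    and x u :: "nat \<Rightarrow> real \<Rightarrow> real ^ 'n"
    and a :: "nat \<Rightarrow> real \<Rightarrow> real ^ 'd"
    and T :: "nat \<Rightarrow> real"
    and \<epsilon> \<mu> :: real
  assumes "problem_data P"
    and "closed (sweeping_problem.Xi_x P)" and "closed (sweeping_problem.Xi_T P)"
    and "\<epsilon> > 0"
    and "minimizing_sequence P x u a T"
    and "\<And>k. standing_assumptions P (T k + \<epsilon>) (const_ext (T k) (u k))"
    and "\<exists>K. \<forall>k. W12_norm (T k + \<epsilon>) (const_ext (T k) (u k)) \<le> K"
    and "bounded (range (\<lambda>k. (a k 0, T k)))"
    and "\<And>k. total_variation (T k + \<epsilon>) (const_ext (T k) (a k)) \<le> ereal \<mu>"
    and "\<And>k. convex_in_velocities P (T k + \<epsilon>)"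
    and "\<And>k. majorized_by_summable P (T k + \<epsilon>)"
  shows "\<exists>x u a T. W12_on T x \<and> W12_on T u \<and> L2_on T a \<and> 0 \<le> T \<and> optimal_solution P x u a T"
proof -
  note data = assms(1) and eps = assms(4)
  let ?inf = "INF (y, w, b, S) \<in> {(y, w, b, S). feasible P y w b S}. J P y w b S"
  have feas: "\<And>k. feasible P (x k) (u k) (a k) (T k)"
    and Jlim: "(\<lambda>k. J P (x k) (u k) (a k) (T k)) \<longlonglongrightarrow> ?inf"
    using assms(5) by (simp_all add: minimizing_sequence_def)
  have f: "assumption_f P (T k + \<epsilon>) (const_ext (T k) (u k))" and g: "assumption_g P" and A: "assumption_A P"
    and cost: "assumption_cost P (T k + \<epsilon>)" for k
    using assms(6)[of k] by (simp_all add: standing_assumptions_def)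
  have W: "W12_on (T k) (x k)" "W12_on (T k) (u k)" and T0: "0 \<le> T k" for k
    using feas[of k] by (auto simp: feasible_def)
  obtain B where B: "\<And>k. norm (a k 0, T k) \<le> B" using assms(8) unfolding bounded_iff by blast
  have a0: "norm (a k 0) \<le> B" and TB: "T k \<le> B" for k
    using B[of k] norm_fst_le[of "a k 0" "T k"] norm_snd_le[of "T k" "a k 0"] abs_ge_self[of "T k"] by auto
  \<comment> \<open>One interval that contains every enlarged horizon.\<close>
  define S where "S = B + \<epsilon>"
  have TS: "T k \<le> S" "T k + \<epsilon> \<le> S" for k using TB[of k] eps by (auto simp: S_def)
  have S0: "0 \<le> S" using TS(1)[of 0] T0[of 0] by linarith
  obtain M where M: "M > 0" "\<And>x a. a \<in> sweeping_problem.A P \<Longrightarrow> norm (sweeping_problem.f P x a) \<le> M * (1 + norm x)"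
    using f_linear_growth[OF f[of 0] A] by blast
  obtain K' where K': "\<And>k. W12_norm (T k + \<epsilon>) (const_ext (T k) (u k)) \<le> K'" using assms(7) by blast
  \<comment> \<open>The maximum with 1 makes the bound positive, as the estimates that divide by it
    require.\<close>
  define K where "K = max K' 1"
  have K: "K > 0" "\<And>k. W12_norm (T k + \<epsilon>) (const_ext (T k) (u k)) \<le> K"
    using K' by (auto simp: K_def intro: max.coboundedI1)
  have uK: "L2_sq (T k) (velocity (u k)) \<le> K\<^sup>2" for k
    by (rule W12_norm_const_ext_bounds(1)[OF W(2) T0 _ K(2)]) (use eps in simp)
  define R where "R = (norm (sweeping_problem.x0 P) + 2 * M * S + K * sqrt S) * exp (2 * M * S)"
  have ub1: "norm (x k t) \<le> R" if "t \<in> {0..T k}" for k t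
    by (rule feasible_uniform_bounds(1)[OF data g feas M(1) _ K(1) uK TS(1) R_def that]) (rule M(2))
  have ub3: "AE t in lebesgue_on {0..T k}. norm (sweeping_problem.f P (x k t) (a k t)) \<le> M * (1 + R)" for k
    by (rule feasible_uniform_bounds(3)[OF data g feas M(1) _ K(1) uK TS(1) R_def]) (rule M(2))
  have ub4: "L2_sq (T k) (velocity (x k)) \<le> 8 * (M * (1 + R))\<^sup>2 * S + 2 * K\<^sup>2" for k
    by (rule feasible_uniform_bounds(4)[OF data g feas M(1) _ K(1) uK TS(1) R_def]) (rule M(2))
  define D where "D = 8 * (M * (1 + R))\<^sup>2 * S + 2 * K\<^sup>2"
  \<comment> \<open>A single constant whose square dominates the bounds for both velocities.\<close>
  define C where "C = sqrt D + K"
  have D0: "0 \<le> D" using S0 by (simp add: D_def)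
  have C: "C > 0" "D \<le> C\<^sup>2" "K\<^sup>2 \<le> C\<^sup>2"
  proof -
    have s: "0 \<le> sqrt D" "sqrt D \<le> C" "K \<le> C" using D0 K(1) by (auto simp: C_def)
    show "C > 0" using s K(1) by linarith
    show "D \<le> C\<^sup>2" using power_mono[OF s(2,1), of 2] D0 by simp
    show "K\<^sup>2 \<le> C\<^sup>2" using power_mono[OF s(3), of 2] K(1) by simp
  qed
  have xC: "L2_sq (T k) (velocity (x k)) \<le> C\<^sup>2"
    and uC: "L2_sq (T k) (velocity (u k)) \<le> C\<^sup>2" for k
    using ub4[of k] uK[of k] C unfolding D_def by linarith+
  define Ru where "Ru = sqrt (2 * K\<^sup>2 / \<epsilon>) + K * sqrt S"
  define Rm where "Rm = max R Ru"
  have uRu: "norm (u k t) \<le> Ru" if t: "t \<in> {0..T k}" for k t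
  proof -
    have "norm (const_ext (T k) (u k) t) \<le> sqrt (2 * K\<^sup>2 / \<epsilon>) + K * sqrt (T k + \<epsilon>)"
      by (rule const_ext_sup_bound[OF W(2) T0 eps K(2,1)]) (use t eps in auto)
    moreover have "K * sqrt (T k + \<epsilon>) \<le> K * sqrt S" using TS(2)[of k] K(1) by simp
    ultimately show ?thesis using t by (simp add: const_ext_def Ru_def)
  qed
  have xm: "norm (x k t) \<le> Rm" and um: "norm (u k t) \<le> Rm" if "t \<in> {0..T k}" for k t
    using ub1[OF that] uRu[OF that] by (auto simp: Rm_def)
  have "\<exists>l r. strict_mono (r :: nat \<Rightarrow> nat) \<and> (T \<circ> r) \<longlonglongrightarrow> l"
  proof -
    have "seq_compact {0..S}" by (simp add: compact_imp_seq_compact)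
    moreover have "\<forall>k. T k \<in> {0..S}" using T0 TS by simp
    ultimately show ?thesis unfolding seq_compact_def by meson
  qed
  then obtain Ts r1 where r1: "strict_mono (r1 :: nat \<Rightarrow> nat)" "(T \<circ> r1) \<longlonglongrightarrow> Ts" by blast
  have "\<exists>V. (\<forall>s t. 0 \<le> s \<longrightarrow> s \<le> t \<longrightarrow> V s + norm (const_ext (T k) (a k) t - const_ext (T k) (a k) s) \<le> V t) \<and>
    (\<forall>t\<ge>0. 0 \<le> V t \<and> V t \<le> \<mu>)" for k
    by (rule variation_function_exists[OF T0 _ assms(9)]) (use eps in simp)
  then obtain V where V: "\<And>k s t. 0 \<le> s \<Longrightarrow> s \<le> t \<Longrightarrow> V k s + norm (const_ext (T k) (a k) t - const_ext (T k) (a k) s) \<le> V k t"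
    "\<And>k t. 0 \<le> t \<Longrightarrow> 0 \<le> V k t \<and> V k t \<le> \<mu>" by metis
  have "\<exists>r a' N. strict_mono r \<and> countable N \<and> (\<forall>t>0. t \<notin> N \<longrightarrow> (\<lambda>k. const_ext (T (r1 (r k))) (a (r1 (r k))) t) \<longlonglongrightarrow> a' t)"
    by (rule helly_selection_vector[where a = "\<lambda>k. const_ext (T (r1 k)) (a (r1 k))" and V = "\<lambda>k. V (r1 k)" and B = B and \<mu> = \<mu>])
       (use V a0 T0 in \<open>auto simp: const_ext_def\<close>)
  then obtain r2 Al N where r2: "strict_mono (r2 :: nat \<Rightarrow> nat)" and N: "countable N"
    and Al: "\<And>t. t > 0 \<Longrightarrow> t \<notin> N \<Longrightarrow> (\<lambda>k. const_ext (T (r1 (r2 k))) (a (r1 (r2 k))) t) \<longlonglongrightarrow> Al t"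
    by (elim exE conjE) (rule that, assumption, assumption, blast)
  \<comment> \<open>State and moving-set control are paired to obtain one common subsequence from
    the Arzela-Ascoli theorem.\<close>
  let ?F = "\<lambda>k t. (const_ext (T (r1 (r2 k))) (x (r1 (r2 k))) t, const_ext (T (r1 (r2 k))) (u (r1 (r2 k))) t)"
  have ext_m: "norm (const_ext (T k) (x k) t) \<le> Rm" "norm (const_ext (T k) (u k) t) \<le> Rm" if "0 \<le> t" for k t
    using xm[of t k] xm[of "T k" k] um[of t k] um[of "T k" k] T0[of k] that by (auto simp: const_ext_def)
  have Fb: "norm (?F k t) \<le> Rm + Rm" if "t \<in> {0..S}" for k t
    using norm_Pair_le[of "fst (?F k t)" "snd (?F k t)"] ext_m[of t "r1 (r2 k)"] that by simp
  \<comment> \<open>By the Hoelder bound this radius makes each component vary by at most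
    \<open>e / 4\<close>, uniformly in \<open>k\<close>.\<close>
  have Fe: "\<exists>d. 0 < d \<and> (\<forall>k s. s \<in> {0..S} \<and> norm (t - s) < d \<longrightarrow> norm (?F k t - ?F k s) < e)"
    if t: "t \<in> {0..S}" and e: "0 < e" for t e
  proof (intro exI[of _ "(e / (4 * C))\<^sup>2"] conjI allI impI)
    show "0 < (e / (4 * C))\<^sup>2" using e C by simp
    fix k s assume s: "s \<in> {0..S} \<and> norm (t - s) < (e / (4 * C))\<^sup>2"
    let ?j = "r1 (r2 k)"
    have "sqrt \<bar>t - s\<bar> \<le> e / (4 * C)" using s e C by (intro real_le_lsqrt) auto
    then have C4: "C * sqrt \<bar>t - s\<bar> \<le> e / 4" using C by (simp add: field_simps)
    have "norm (?F k t - ?F k s) \<le> norm (const_ext (T ?j) (x ?j) t - const_ext (T ?j) (x ?j) s)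
        + norm (const_ext (T ?j) (u ?j) t - const_ext (T ?j) (u ?j) s)"
      using norm_Pair_le by (simp add: minus_prod_def)
    also have "\<dots> \<le> C * sqrt \<bar>t - s\<bar> + C * sqrt \<bar>t - s\<bar>"
      by (intro add_mono const_ext_holder[OF W(1) T0 TS(1) xC C(1)] const_ext_holder[OF W(2) T0 TS(1) uC C(1)]) (use s t in auto)
    also have "\<dots> < e" using C4 e by linarith
    finally show "norm (?F k t - ?F k s) < e" .
  qed
  obtain G r3 where "strict_mono (r3 :: nat \<Rightarrow> nat)" and
    G: "\<And>e. 0 < e \<Longrightarrow> \<exists>n0. \<forall>n t. n \<ge> n0 \<and> t \<in> {0..S} \<longrightarrow> norm (?F (r3 n) t - G t) < e"
    by (rule Arzela_Ascoli[of "{0..S}" ?F "Rm + Rm"]) (use Fb Fe in auto)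
  define r where "r = r1 \<circ> r2 \<circ> r3"
  have r3: "strict_mono r3" by fact
  have r: "strict_mono r" unfolding r_def by (intro strict_mono_o r1 r2 r3)
  have ul: "uniform_limit {0..S} (\<lambda>k. ?F (r3 k)) G sequentially"
  proof (rule uniform_limitI)
    fix e :: real assume "e > 0"
    from G[OF this] obtain n0 where "\<forall>n t. n \<ge> n0 \<and> t \<in> {0..S} \<longrightarrow> norm (?F (r3 n) t - G t) < e" by blast
    then show "\<forall>\<^sub>F k in sequentially. \<forall>t\<in>{0..S}. dist (?F (r3 k) t) (G t) < e"
      unfolding eventually_sequentially dist_norm by (intro exI[of _ n0]) simp
  qed
  define X where "X t = fst (G t)" for t
  define U where "U t = snd (G t)" for t
  have XU: "uniform_limit {0..S} (\<lambda>k. const_ext (T (r k)) (x (r k))) X sequentially"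
    "uniform_limit {0..S} (\<lambda>k. const_ext (T (r k)) (u (r k))) U sequentially"
    using bounded_linear.uniform_limit[OF bounded_linear_fst ul] bounded_linear.uniform_limit[OF bounded_linear_snd ul]
    unfolding X_def U_def r_def by (simp_all add: o_def)
  have Tlim: "(\<lambda>k. T (r k)) \<longlonglongrightarrow> Ts"
    using LIMSEQ_subseq_LIMSEQ[OF r1(2) strict_mono_o[OF r2 r3]] by (simp add: r_def o_def)
  have alim: "AE t in lebesgue_on {0..S}. (\<lambda>k. const_ext (T (r k)) (a (r k)) t) \<longlonglongrightarrow> Al t"
  proof -
    \<comment> \<open>Time 0 is added because the selection theorem asserts convergence only for
      positive times.\<close>
    have "negligible (insert 0 N)"
      using N by (simp add: negligible_iff_null_sets countable_imp_null_set_lborel null_sets_completionI)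
    then have "AE t in lebesgue_on {0..S}. t \<in> {0..S} \<and> t \<notin> insert 0 N"
      by (intro AE_lebesgue_on_not_negligible) auto
    then show ?thesis
    proof eventually_elim
      case (elim t)
      then have "(\<lambda>k. const_ext (T (r1 (r2 k))) (a (r1 (r2 k))) t) \<longlonglongrightarrow> Al t" by (intro Al) auto
      from LIMSEQ_subseq_LIMSEQ[OF this r3] show ?case by (simp add: r_def o_def)
    qed
  qed
  have feasl: "feasible P X U Al Ts"
    by (rule feasible_limit[OF data g A f[of 0] assms(2,3) feas TS(1) Tlim XU alim ub3 xC uC])
  have WX: "W12_on Ts X" "W12_on Ts U" "L2_on Ts Al" "0 \<le> Ts" using feasl by (simp_all add: feasible_def)
  have Xc: "continuous_on {0..S} X"
  proof (rule uniform_limit_theorem[OF _ XU(1)])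
    show "\<forall>\<^sub>F k in sequentially. continuous_on {0..S} (const_ext (T (r k)) (x (r k)))"
      by (intro always_eventually allI const_ext_continuous W T0)
  qed simp
  have xT: "(\<lambda>k. x (r k) (T (r k))) \<longlonglongrightarrow> X Ts"
    by (rule const_ext_endpoint_tendsto[OF XU(1) Xc Tlim]) (use T0 TS in auto)
  have Jr: "(\<lambda>k. J P (x (r k)) (u (r k)) (a (r k)) (T (r k))) \<longlonglongrightarrow> ?inf"
    using LIMSEQ_subseq_LIMSEQ[OF Jlim r] by (simp add: o_def)
  \<comment> \<open>Lower semicontinuity is phrased through real levels below the limiting cost, so
    infinite values need no separate treatment.\<close>
  have lsc: "ereal c \<le> ?inf" if c: "ereal c < J P X U Al Ts" for c
  proof (rule tendsto_lowerbound[OF Jr])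
    have "\<forall>\<^sub>F k in sequentially. ereal c < J P (x (r k)) (u (r k)) (a (r k)) (T (r k))"
      by (rule J_lower_semicontinuous[OF data A eps assms(10) assms(11) cost feas feasl TS(1) Tlim
            tendsto_uniform_limitI[OF XU(1)] tendsto_uniform_limitI[OF XU(2)] alim xm um xT c])
    then show "\<forall>\<^sub>F k in sequentially. ereal c \<le> J P (x (r k)) (u (r k)) (a (r k)) (T (r k))"
      by (rule eventually_mono) simp
  qed simp
  have le: "J P X U Al Ts \<le> ?inf"
  proof (rule ccontr)
    assume "\<not> ?thesis"
    then have "?inf < J P X U Al Ts" by simp
    then obtain c where "?inf < ereal c" "ereal c < J P X U Al Ts" using ereal_dense2 by blast
    with lsc show False by (meson not_le)
  qed
  have "?inf \<le> J P y w b R'" if "feasible P y w b R'" for y w b R'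
    by (rule INF_lower2[of "(y, w, b, R')"]) (use that in auto)
  with le have "optimal_solution P X U Al Ts"
    unfolding optimal_solution_def using feasl by (meson order_trans)
  with WX show ?thesis by blast
qed

end
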